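(* Every countable partial ordering embeds into the partial order of ML-degrees of $K$-trivial sets. In particular, there is an infinite antichain of ML-degrees of $K$-trivial sets.
   Context: For sets $A,B$, $B\le_{\mathrm{ML}}A$ means that every ML-random $Y$ with $A\le_{\mathrm T}Y$ satisfies $B\le_{\mathrm T}Y$; ML-degrees are the equivalence classes of the induced equivalence relation, partially ordered by $\le_{\mathrm{ML}}$. $K$-trivial: $K(A\upharpoonright n)\le K(n)+O(1)$. *)

theory Defs
  imports Complex_Main "HOL-Library.Nat_Bijection" "HOL-Library.Countable_Set" "HOL-Library.Sublist"
begin

datatype recf =
    Zero
  | Succ
  | Proj nat
  | Orc
  | Comp recf "recf list"
  | Prim recf recf
  | Mu recf

inductive orc_eval :: "nat set \<Rightarrow> recf \<Rightarrow> nat list \<Rightarrow> nat \<Rightarrow> bool" for A where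
  zero: "orc_eval A Zero xs 0"
| succ: "orc_eval A Succ (x # xs) (Suc x)"
| proj: "i < length xs \<Longrightarrow> orc_eval A (Proj i) xs (xs ! i)"
| orc:  "orc_eval A Orc (x # xs) (if x \<in> A then 1 else 0)"
| comp: "list_all2 (\<lambda>g y. orc_eval A g xs y) gs ys \<Longrightarrow> orc_eval A f ys z
          \<Longrightarrow> orc_eval A (Comp f gs) xs z"
| prim0: "orc_eval A f xs y \<Longrightarrow> orc_eval A (Prim f g) (0 # xs) y"
| primS: "orc_eval A (Prim f g) (n # xs) y \<Longrightarrow> orc_eval A g (y # n # xs) z
          \<Longrightarrow> orc_eval A (Prim f g) (Suc n # xs) z"
| mu: "orc_eval A f (n # xs) 0 \<Longrightarrow> (\<forall>m<n. \<exists>y. orc_eval A f (m # xs) y \<and> y \<noteq> 0)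
          \<Longrightarrow> orc_eval A (Mu f) xs n"

abbreviation eval :: "recf \<Rightarrow> nat list \<Rightarrow> nat \<Rightarrow> bool" where
  "eval \<equiv> orc_eval {}"

definition turing_le :: "nat set \<Rightarrow> nat set \<Rightarrow> bool" where
  "turing_le B A \<longleftrightarrow> (\<exists>f. \<forall>x. orc_eval A f [x] (if x \<in> B then 1 else 0))"

definition code :: "bool list \<Rightarrow> nat" where
  "code \<sigma> = list_encode (map (\<lambda>b. if b then 1 else 0) \<sigma>)"

definition restr :: "nat set \<Rightarrow> nat \<Rightarrow> bool list" where
  "restr A n = map (\<lambda>i. i \<in> A) [0..<n]"

text \<open>standard bijection between naturals and strings (n+1 in binary without leading 1)\<close>
function nat_str :: "nat \<Rightarrow> bool list" where
  "nat_str n = (if n = 0 then [] else nat_str ((n - 1) div 2) @ [even n])"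
  by auto
termination by (relation "measure id") auto

definition machine :: "recf \<Rightarrow> bool list \<Rightarrow> bool list \<Rightarrow> bool" where
  "machine f p \<sigma> \<longleftrightarrow> eval f [code p] (code \<sigma>)"

definition prefix_free_machine :: "recf \<Rightarrow> bool" where
  "prefix_free_machine f \<longleftrightarrow>
     (\<forall>p q \<sigma> \<tau>. machine f p \<sigma> \<and> machine f q \<tau> \<and> prefix p q \<longrightarrow> p = q)"

definition universal_pf :: "recf \<Rightarrow> bool" where
  "universal_pf u \<longleftrightarrow> prefix_free_machine u \<and>
     (\<forall>f. prefix_free_machine f \<longrightarrow>
        (\<exists>c. \<forall>p \<sigma>. machine f p \<sigma> \<longrightarrow> (\<exists>q. machine u q \<sigma> \<and> length q \<le> length p + c)))"

text \<open>A fixed universal prefix-free machine (one exists).\<close>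
definition U :: recf where
  "U = (SOME u. universal_pf u)"

definition K :: "bool list \<Rightarrow> nat" where
  "K \<sigma> = (LEAST n. \<exists>p. machine U p \<sigma> \<and> length p = n)"

definition K_trivial :: "nat set \<Rightarrow> bool" where
  "K_trivial A \<longleftrightarrow> (\<exists>c. \<forall>n. K (restr A n) \<le> K (nat_str n) + c)"

text \<open>Lebesgue measure of the open set [W] generated by a set W of strings:
  supremum over finite F \<subseteq> W of the measure of the union of the cylinders of F,
  computed at a common length m.\<close>
definition fin_measure :: "bool list set \<Rightarrow> real" where
  "fin_measure F = (let m = Max (insert 0 (length ` F)) in
      real (card {\<tau>. length \<tau> = m \<and> (\<exists>\<sigma>\<in>F. prefix \<sigma> \<tau>)}) / 2 ^ m)"

definition open_measure :: "bool list set \<Rightarrow> real" where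
  "open_measure W = (SUP F \<in> {F. finite F \<and> F \<subseteq> W}. fin_measure F)"

definition in_open :: "nat set \<Rightarrow> bool list set \<Rightarrow> bool" where
  "in_open X W \<longleftrightarrow> (\<exists>\<sigma>\<in>W. restr X (length \<sigma>) = \<sigma>)"

definition unif_ce :: "(nat \<Rightarrow> bool list set) \<Rightarrow> bool" where
  "unif_ce V \<longleftrightarrow> (\<exists>f. \<forall>n \<sigma>. \<sigma> \<in> V n \<longleftrightarrow> (\<exists>y. eval f [n, code \<sigma>] y))"

definition MLtest :: "(nat \<Rightarrow> bool list set) \<Rightarrow> bool" where
  "MLtest V \<longleftrightarrow> unif_ce V \<and> (\<forall>n. open_measure (V n) \<le> (1/2) ^ n)"

definition MLrandom :: "nat set \<Rightarrow> bool" where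
  "MLrandom Y \<longleftrightarrow> (\<forall>V. MLtest V \<longrightarrow> \<not> (\<forall>n. in_open Y (V n)))"

definition MLred_le :: "nat set \<Rightarrow> nat set \<Rightarrow> bool" where
  "MLred_le B A \<longleftrightarrow> (\<forall>Y. MLrandom Y \<and> turing_le A Y \<longrightarrow> turing_le B Y)"

end

theory Submission
  imports Defs
begin

text \<open>Let \<open>Omega\<close> be a left-c.e. random set, the halting probability. Assign to every \<open>i\<close> infinitely many long
  intervals of positions, and let \<open>gapped i\<close> consist of the bits of \<open>Omega\<close> outside the intervals of \<open>i\<close>; it is
  random. We enumerate one c.e. set with columns indexed by \<open>i\<close>. A requirement working in an interval of \<open>i\<close>
  enumerates its witness into column \<open>i\<close> only when the approximation to \<open>Omega\<close> is about to change, for the first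
  time since the witness was chosen, before the end of the interval. So the cost is small for every oracle that
  sees the interval: the set is K-trivial, and the union of all columns but the \<open>i\<close>-th is computable from
  \<open>gapped i\<close>, by waiting until the approximation is correct on the interval. On the other hand \<open>gapped i\<close> does not
  compute column \<open>i\<close>. Otherwise, the stage at which it computes the value at the witness yields a guess of the bits
  of \<open>Omega\<close> in the interval, of which \<open>gapped i\<close> is independent; a large measure of oracles with wrong guesses
  is refuted by enumerating the witness. Hence, for computable \<open>D\<close>, the unions of the columns in \<open>D\<close> are ordered by
  ML-reducibility as the sets \<open>D\<close> are by inclusion, and every countable partial order embeds into the computable
  sets under inclusion.\<close>

section \<open>Computable functions on the natural numbers\<close>

text \<open>The order in which the constants are chosen is the delicate point. The first
  \<open>hi q\<close> digits can change almost \<open>2 ^ hi q\<close> times, so requirement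
  \<open>q\<close> may have that many lives, each with a set of unrefuted good oracles just below
  the kill threshold \<delta>. A guess of the interval succeeds with probability
  \<open>(1/2) ^ (hi q - lo q)\<close>; the number of lives therefore cancels against it, and these
  lives contribute at most \<open>2 ^ lo q\<close> times \<delta>. Hence \<delta> can be fixed from
  \<open>lo q\<close> and \<open>q\<close> alone. It limits the kills to
  \<open>1 / \<delta>\<close>, and only then \<open>hi q\<close> is taken so large that this many
  kills are cheap. The second obstacle is that a life ends with a change anywhere before
  \<open>hi q\<close>, also below \<open>lo q\<close>, where \<open>gapped i\<close> has gaps and
  cannot watch. So a kill is charged not only \<open>(1/2) ^ hi q\<close>, as K-triviality asks, but
  the larger \<open>(1/2) ^ (hi q - lo q)\<close>, the measure of the oracles that agree with the
  approximation on the interval alone. The charges form a test, and as \<open>Omega\<close> is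
  random, for almost all \<open>q\<close> no kill happens while the interval shows its final bits.
  The finitely many exceptions are stored in the reduction.\<close>

inductive_cases orc_eval_ZeroE: "orc_eval A Zero xs y"
inductive_cases orc_eval_SuccE: "orc_eval A Succ xs y"
inductive_cases orc_eval_ProjE: "orc_eval A (Proj i) xs y"
inductive_cases orc_eval_OrcE: "orc_eval A Orc xs y"
inductive_cases orc_eval_CompE: "orc_eval A (Comp f gs) xs y"
inductive_cases orc_eval_Prim0E: "orc_eval A (Prim f g) (0 # xs) y"
inductive_cases orc_eval_PrimSE: "orc_eval A (Prim f g) (Suc n # xs) y"
inductive_cases orc_eval_MuE: "orc_eval A (Mu f) xs y"

lemmas orc_evalEs = orc_eval_ZeroE orc_eval_SuccE orc_eval_ProjE orc_eval_OrcE orc_eval_Prim0E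

lemma orc_eval_det: "orc_eval A f xs y \<Longrightarrow> orc_eval A f xs z \<Longrightarrow> y = z"
proof (induction arbitrary: z rule: orc_eval.induct)
  case (comp xs gs ys f y)
  from comp.prems obtain ys' where ys': "list_all2 (\<lambda>g y. orc_eval A g xs y) gs ys'"
      "orc_eval A f ys' z" by (rule orc_eval_CompE)
  have "ys = ys'"
    using comp.hyps ys'(1) comp.IH(1) by (auto simp: list_all2_conv_all_nth intro!: nth_equalityI)
  then show ?case using comp.IH ys' by simp
next
  case (primS f g n xs y z)
  from primS.prems obtain y' where "orc_eval A (Prim f g) (n # xs) y'" "orc_eval A g (y' # n # xs) z"
    by (rule orc_eval_PrimSE)
  then show ?case using primS.IH by metis
next
  case (mu f n xs)
  from mu.prems have z: "orc_eval A f (z # xs) 0" "\<forall>m<z. \<exists>y. orc_eval A f (m # xs) y \<and> y \<noteq> 0"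
    by (auto elim: orc_eval_MuE)
  show ?case
  proof (cases n z rule: linorder_cases)
    case less
    with z(2) obtain y where "orc_eval A f (n # xs) y" "y \<noteq> 0" by blast
    with mu.IH(1) show ?thesis by blast
  next
    case greater
    with mu.IH(2) z(1) show ?thesis by fastforce
  qed
next
  case (prim0 f xs y g)
  then show ?case by (blast elim: orc_eval_Prim0E)
qed (auto elim!: orc_evalEs)

lemma eval_Comp1: "orc_eval A g xs y \<Longrightarrow> orc_eval A f [y] z \<Longrightarrow> orc_eval A (Comp f [g]) xs z"
  by (rule comp[where ys = "[y]"]) auto

lemma eval_Comp2: "orc_eval A g xs y \<Longrightarrow> orc_eval A h xs y' \<Longrightarrow> orc_eval A f [y, y'] z \<Longrightarrow>
    orc_eval A (Comp f [g, h]) xs z"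
  by (rule comp[where ys = "[y, y']"]) auto

lemma eval_Comp1_iff: "orc_eval A (Comp f [g]) xs z \<longleftrightarrow> (\<exists>y. orc_eval A g xs y \<and> orc_eval A f [y] z)"
  by (auto intro: eval_Comp1 elim!: orc_eval_CompE simp: list_all2_Cons1)

lemma eval_Mu_iff: "orc_eval A (Mu f) xs n \<longleftrightarrow>
    orc_eval A f (n # xs) 0 \<and> (\<forall>m<n. \<exists>y. orc_eval A f (m # xs) y \<and> y \<noteq> 0)"
  by (auto intro: mu elim!: orc_eval_MuE)

lemma eval_Proj0: "orc_eval A (Proj 0) (x # xs) x"
  using proj[of 0 "x # xs" A] by simp

lemma eval_Proj1: "orc_eval A (Proj (Suc 0)) (x # y # xs) y"
  using proj[of 1 "x # y # xs" A] by simp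

lemma eval_Proj2: "orc_eval A (Proj (Suc (Suc 0))) (x # y # z # xs) z"
  using proj[of 2 "x # y # z # xs" A] by (simp add: numeral_2_eq_2)

lemmas eval_Proj = eval_Proj0 eval_Proj1 eval_Proj2

lemma eval_Prim:
  assumes "\<And>xs. orc_eval A f [xs] (F xs)" "\<And>y n x. orc_eval A g [y, n, x] (G y n x)"
  shows "orc_eval A (Prim f g) [n, x] (rec_nat (F x) (\<lambda>n y. G y n x) n)"
  by (induction n) (auto intro: prim0 primS assms)

section \<open>Arithmetic and the inverse of the pairing function as recursive programs\<close>

definition rf_add where "rf_add = Prim (Proj 0) (Comp Succ [Proj 0])"
definition rf_pred where "rf_pred = Comp (Prim Zero (Proj (Suc 0))) [Proj 0, Zero]"
definition rf_monus where "rf_monus = Comp (Prim (Proj 0) (Comp rf_pred [Proj 0])) [Proj (Suc 0), Proj 0]"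
definition rf_tri where "rf_tri = Comp (Prim Zero (Comp rf_add [Proj 0, Comp Succ [Proj (Suc 0)]])) [Proj 0, Zero]"
definition rf_pair where "rf_pair = Comp rf_add [Comp rf_tri [rf_add], Proj 0]"
text \<open>Since \<open>prod_encode (x, y) = triangle (x + y) + x\<close>, the diagonal
  \<open>x + y\<close> is the least \<open>k\<close> with \<open>z < triangle (Suc k)\<close>; the
  truncated difference is 0 exactly then.\<close>

definition rf_diag where
  "rf_diag = Mu (Comp rf_monus [Comp Succ [Proj (Suc 0)], Comp rf_tri [Comp Succ [Proj 0]]])"
definition rf_fst where "rf_fst = Comp rf_monus [Proj 0, Comp rf_tri [rf_diag]]"
definition rf_snd where "rf_snd = Comp rf_monus [rf_diag, rf_fst]"

lemma eval_add: "orc_eval A rf_add [x, y] (x + y)"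
proof -
  have "orc_eval A rf_add [x, y] (rec_nat y (\<lambda>n y. Suc y) x)"
    unfolding rf_add_def by (rule eval_Prim) (auto intro!: eval_Proj eval_Comp1 succ)
  moreover have "rec_nat y (\<lambda>n y. Suc y) x = x + y" by (induction x) auto
  ultimately show ?thesis by simp
qed

lemma eval_pred: "orc_eval A rf_pred [x] (x - 1)"
proof -
  have "orc_eval A (Prim Zero (Proj (Suc 0))) [x, 0] (rec_nat 0 (\<lambda>n y. n) x)"
    by (rule eval_Prim[where F = "\<lambda>_. 0"]) (rule zero eval_Proj)+
  moreover have "rec_nat 0 (\<lambda>n y. n) x = x - 1" by (cases x) auto
  ultimately show ?thesis
    unfolding rf_pred_def by (auto intro!: eval_Comp2 eval_Proj zero)
qed

lemma eval_monus: "orc_eval A rf_monus [x, y] (x - y)"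
proof -
  have "orc_eval A (Prim (Proj 0) (Comp rf_pred [Proj 0])) [y, x] (rec_nat x (\<lambda>n y. y - 1) y)"
    by (rule eval_Prim) (rule eval_Proj eval_Comp1 eval_pred)+
  moreover have "rec_nat x (\<lambda>n y. y - 1) y = x - y" by (induction y) auto
  ultimately show ?thesis
    unfolding rf_monus_def by (auto intro!: eval_Comp2 eval_Proj)
qed

lemma eval_tri: "orc_eval A rf_tri [x] (triangle x)"
proof -
  have "orc_eval A (Prim Zero (Comp rf_add [Proj 0, Comp Succ [Proj (Suc 0)]])) [x, 0]
      (rec_nat 0 (\<lambda>n y. y + Suc n) x)"
    by (rule eval_Prim[where F = "\<lambda>_. 0"]) (rule eval_Proj zero eval_Comp1 eval_Comp2 succ eval_add)+
  moreover have "rec_nat 0 (\<lambda>n y. y + Suc n) x = triangle x" by (induction x) auto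
  ultimately show ?thesis
    unfolding rf_tri_def by (auto intro!: eval_Comp2 eval_Proj zero)
qed

lemma eval_pair: "orc_eval A rf_pair [x, y] (prod_encode (x, y))"
  unfolding rf_pair_def prod_encode_def
  by (auto intro!: eval_Comp2 eval_Comp1 eval_Proj eval_add eval_tri)

lemma triangle_mono: "a \<le> b \<Longrightarrow> triangle a \<le> triangle b"
  by (induction b) (auto simp: le_Suc_eq)

lemma eval_diag: "orc_eval A rf_diag [prod_encode (x, y)] (x + y)"
proof -
  let ?z = "prod_encode (x, y)"
  have body: "orc_eval A (Comp rf_monus [Comp Succ [Proj (Suc 0)], Comp rf_tri [Comp Succ [Proj 0]]])
      [k, ?z] (Suc ?z - triangle (Suc k))" for k
    by (rule eval_Proj succ eval_Comp2 eval_Comp1 eval_monus eval_tri)+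
  have "Suc ?z - triangle (Suc (x + y)) = 0" by (simp add: prod_encode_def)
  moreover have "Suc ?z - triangle (Suc k) \<noteq> 0" if "k < x + y" for k
    using triangle_mono[of "Suc k" "x + y"] that by (simp add: prod_encode_def)
  ultimately show ?thesis
    unfolding rf_diag_def eval_Mu_iff using body by metis
qed

lemma eval_fst: "orc_eval A rf_fst [z] (fst (prod_decode z))"
proof -
  obtain x y where z: "z = prod_encode (x, y)" by (metis prod_decode_inverse surj_pair)
  have "orc_eval A rf_fst [z] (z - triangle (x + y))"
    unfolding rf_fst_def z
    by (intro eval_Comp2[OF _ _ eval_monus] eval_Comp1[OF eval_diag] eval_Proj eval_tri)
  then show ?thesis by (simp add: z) (simp add: prod_encode_def)
qed

lemma eval_snd: "orc_eval A rf_snd [z] (snd (prod_decode z))"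
proof -
  obtain x y where z: "z = prod_encode (x, y)" by (metis prod_decode_inverse surj_pair)
  have "orc_eval A rf_snd [z] (x + y - x)"
    unfolding rf_snd_def z using eval_fst[of A z]
    by (intro eval_Comp2[OF _ _ eval_monus] eval_diag) (simp add: z)
  then show ?thesis by (simp add: z)
qed

section \<open>Closure properties of unary functions computable in an oracle\<close>

definition nat_computable :: "nat set \<Rightarrow> (nat \<Rightarrow> nat) \<Rightarrow> bool" where
  "nat_computable A f \<longleftrightarrow> (\<exists>r. \<forall>n. orc_eval A r [n] (f n))"

lemma nc_id: "nat_computable A (\<lambda>n. n)"
  unfolding nat_computable_def by (auto intro!: exI[of _ "Proj 0"] eval_Proj)

lemma nc_comp: "nat_computable A f \<Longrightarrow> nat_computable A g \<Longrightarrow> nat_computable A (\<lambda>n. f (g n))"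
  unfolding nat_computable_def by (blast intro: eval_Comp1)

lemma nc_Suc: "nat_computable A f \<Longrightarrow> nat_computable A (\<lambda>n. Suc (f n))"
  by (rule nc_comp[of A Suc]) (auto simp: nat_computable_def intro: succ)

lemma nc_const: "nat_computable A (\<lambda>n. c)"
  by (induction c) (auto simp: nat_computable_def intro: zero intro!: nc_Suc[unfolded nat_computable_def])

lemma nc_pred: "nat_computable A f \<Longrightarrow> nat_computable A (\<lambda>n. f n - 1)"
  by (rule nc_comp[of A "\<lambda>x. x - 1"]) (unfold nat_computable_def, metis eval_pred)

lemma nc_pair: "nat_computable A f \<Longrightarrow> nat_computable A g \<Longrightarrow>
    nat_computable A (\<lambda>n. prod_encode (f n, g n))"
  unfolding nat_computable_def by (blast intro: eval_Comp2 eval_pair)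

lemma nc_fst: "nat_computable A f \<Longrightarrow> nat_computable A (\<lambda>n. fst (prod_decode (f n)))"
  by (rule nc_comp[of A "\<lambda>x. fst (prod_decode x)"]) (unfold nat_computable_def, metis eval_fst)

lemma nc_snd: "nat_computable A f \<Longrightarrow> nat_computable A (\<lambda>n. snd (prod_decode (f n)))"
  by (rule nc_comp[of A "\<lambda>x. snd (prod_decode x)"]) (unfold nat_computable_def, metis eval_snd)

lemma nc_oracle: "nat_computable A (\<lambda>n. if n \<in> A then 1 else 0)"
  unfolding nat_computable_def using orc[of A _ "[]"] by blast

text \<open>All parameters travel inside one number, so that unary functions and a recursion with a
  single parameter suffice everywhere.\<close>

lemma nc_rec:
  assumes f: "nat_computable A f" and h: "nat_computable A h" and
    g: "nat_computable A g"
  shows "nat_computable A (\<lambda>x. rec_nat (f x) (\<lambda>n y. g (prod_encode (x, prod_encode (n, y)))) (h x))"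
proof -
  from f obtain rf where rf: "\<And>n. orc_eval A rf [n] (f n)" unfolding nat_computable_def by auto
  from g obtain rg where rg: "\<And>n. orc_eval A rg [n] (g n)" unfolding nat_computable_def by auto
  from h obtain rh where rh: "\<And>n. orc_eval A rh [n] (h n)" unfolding nat_computable_def by auto
  let ?g = "Comp rg [Comp rf_pair [Proj (Suc (Suc 0)), Comp rf_pair [Proj (Suc 0), Proj 0]]]"
  have "orc_eval A ?g [y, n, x] (g (prod_encode (x, prod_encode (n, y))))" for y n x
    by (intro eval_Comp1[OF _ rg] eval_Comp2[OF _ _ eval_pair] eval_Proj)
  then have "orc_eval A (Comp (Prim rf ?g) [rh, Proj 0]) [x]
      (rec_nat (f x) (\<lambda>n y. g (prod_encode (x, prod_encode (n, y)))) (h x))" for x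
    by (intro eval_Comp2[OF rh eval_Proj0] eval_Prim[where F = f and G = "\<lambda>y n x. g (prod_encode (x, prod_encode (n, y)))"] rf)
  then show ?thesis unfolding nat_computable_def by blast
qed

lemma nc_iterate:
  assumes "nat_computable A f" "nat_computable A h" "nat_computable A g"
  shows "nat_computable A (\<lambda>x. (g ^^ h x) (f x))"
proof -
  have eq: "(\<lambda>x. (g ^^ h x) (f x)) = (\<lambda>x. rec_nat (f x) (\<lambda>n y. g (snd (prod_decode (snd (prod_decode
      (prod_encode (x, prod_encode (n, y)))))))) (h x))"
  proof
    fix x
    have "(g ^^ n) (f x) = rec_nat (f x) (\<lambda>n y. g y) n" for n by (induction n) auto
    then show "(g ^^ h x) (f x) = rec_nat (f x) (\<lambda>n y. g (snd (prod_decode (snd (prod_decode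
      (prod_encode (x, prod_encode (n, y)))))))) (h x)" by simp
  qed
  show ?thesis unfolding eq
    by (rule nc_rec[where g = "\<lambda>z. g (snd (prod_decode (snd (prod_decode z))))"])
      (rule assms nc_snd nc_id nc_comp[OF assms(3)])+
qed

text \<open>A conditional is a primitive recursion whose step forgets the previous value.\<close>

lemma nc_if:
  assumes "nat_computable A h" "nat_computable A f" "nat_computable A g"
  shows "nat_computable A (\<lambda>x. if h x = 0 then f x else g x)"
proof -
  have eq: "(\<lambda>x. if h x = 0 then f x else g x) =
      (\<lambda>x. rec_nat (f x) (\<lambda>n y. g (fst (prod_decode (prod_encode (x, prod_encode (n, y)))))) (h x))"
  proof
    show "(if h x = 0 then f x else g x) =
      rec_nat (f x) (\<lambda>n y. g (fst (prod_decode (prod_encode (x, prod_encode (n, y)))))) (h x)" for x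
      by (cases "h x") auto
  qed
  show ?thesis unfolding eq
    by (rule nc_rec[where g = "\<lambda>z. g (fst (prod_decode z))"]) (rule assms nc_fst nc_id nc_comp[OF assms(3)])+
qed

text \<open>One pass moves the list, mapped through \<open>g\<close>, onto an accumulator in reverse order, so two
  passes compute a map on codes of lists.\<close>

definition move_step :: "(nat \<Rightarrow> nat) \<Rightarrow> nat \<Rightarrow> nat" where
  "move_step g z = (if snd (prod_decode z) = 0 then z else
     prod_encode (Suc (prod_encode (g (fst (prod_decode (snd (prod_decode z) - 1))), fst (prod_decode z))),
       snd (prod_decode (snd (prod_decode z) - 1))))"

lemma length_le_list_encode: "length l \<le> list_encode l"
proof (induction l)
  case (Cons a l)
  then show ?case using le_prod_encode_2[of "list_encode l" a] by simp
qed simp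

lemma move_step_iterate:
  "length l \<le> n \<Longrightarrow> (move_step g ^^ n) (prod_encode (list_encode acc, list_encode l)) =
     prod_encode (list_encode (rev (map g l) @ acc), 0)"
proof (induction n arbitrary: l acc)
  case (Suc n)
  show ?case
  proof (cases l)
    case Nil
    have "(move_step g ^^ n) (prod_encode (x, 0)) = prod_encode (x, 0)" for n x
      by (induction n) (auto simp: move_step_def)
    from this[of "Suc n"] show ?thesis using Nil by (simp del: funpow.simps)
  next
    case (Cons a k)
    have "move_step g (prod_encode (list_encode acc, list_encode l)) =
        prod_encode (list_encode (g a # acc), list_encode k)"
      by (simp add: move_step_def Cons)
    then have "(move_step g ^^ Suc n) (prod_encode (list_encode acc, list_encode l)) =
        (move_step g ^^ n) (prod_encode (list_encode (g a # acc), list_encode k))"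
      by (simp only: funpow_Suc_right o_apply)
    then show ?thesis using Suc.IH[of k "g a # acc"] Suc.prems Cons by (simp del: list_encode.simps funpow.simps)
  qed
qed simp

lemma nc_move_step:
  assumes "nat_computable A g"
  shows "nat_computable A (move_step g)"
  unfolding move_step_def [abs_def]
  by (rule nc_if nc_snd nc_fst nc_id nc_pair nc_Suc nc_pred nc_comp[OF assms])+

lemma nc_list_map:
  assumes "nat_computable A g"
  shows "nat_computable A (\<lambda>n. list_encode (map g (list_decode n)))"
proof -
  define mv where "mv g n = fst (prod_decode ((move_step g ^^ n) (prod_encode (0, n))))" for g n
  have mv: "mv g n = list_encode (rev (map g (list_decode n)))" for g n
    using move_step_iterate[of "list_decode n" n g "[]"] length_le_list_encode[of "list_decode n"]
    by (simp add: mv_def)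
  have "nat_computable A (mv g)" if "nat_computable A g" for g
    unfolding mv_def [abs_def] by (rule nc_fst nc_iterate nc_pair nc_id nc_const nc_move_step that)+
  from nc_comp[OF this[OF nc_id] this[OF assms]] show ?thesis
    by (simp add: mv rev_map)
qed

section \<open>Computable functions between encoded types\<close>

text \<open>\<open>dec\<close> is total, and a number that is no code decodes to junk. The second
  axiom makes the normalisation of such numbers computable; it is precisely the computability of the
  identity.\<close>

class enc =
  fixes enc :: "'a \<Rightarrow> nat" and dec :: "nat \<Rightarrow> 'a"
  assumes dec_enc [simp]: "dec (enc x) = x"
    and nc_dec: "nat_computable A (\<lambda>n. enc (dec n))"

lemma enc_eq_iff [simp]: "enc x = enc y \<longleftrightarrow> x = y"
  by (metis dec_enc)

instantiation nat :: enc
begin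
definition "enc (n::nat) = n"
definition "dec n = (n::nat)"
instance by standard (auto simp: enc_nat_def dec_nat_def nc_id)
end

instantiation bool :: enc
begin
definition "enc (b::bool) = (if b then 1 else 0)"
definition "dec n \<longleftrightarrow> (n::nat) \<noteq> 0"
instance
proof
  fix A
  have "nat_computable A (\<lambda>n. if n = 0 then 0 else 1)" by (intro nc_if nc_id nc_const)
  then show "nat_computable A (\<lambda>n. enc (dec n :: bool))"
    by (rule back_subst[of "nat_computable A"]) (auto simp: enc_bool_def dec_bool_def)
qed (simp add: enc_bool_def dec_bool_def)
end

instantiation prod :: (enc, enc) enc
begin
definition "enc (p :: 'a \<times> 'b) = prod_encode (enc (fst p), enc (snd p))"
definition "dec n = (dec (fst (prod_decode n)) :: 'a, dec (snd (prod_decode n)) :: 'b)"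
instance
proof
  fix A
  have "nat_computable A (\<lambda>n. prod_encode (enc (dec (fst (prod_decode n)) :: 'a), enc (dec (snd (prod_decode n)) :: 'b)))"
    by (intro nc_pair nc_comp[OF nc_dec[where 'a = 'a]] nc_comp[OF nc_dec[where 'a = 'b]] nc_fst nc_snd nc_id)
  then show "nat_computable A (\<lambda>n. enc (dec n :: 'a \<times> 'b))"
    by (simp add: enc_prod_def dec_prod_def)
qed (simp add: enc_prod_def dec_prod_def)
end

instantiation list :: (enc) enc
begin
definition "enc (l :: 'a list) = list_encode (map enc l)"
definition "dec n = (map dec (list_decode n) :: 'a list)"
instance
proof
  fix A
  show "nat_computable A (\<lambda>n. enc (dec n :: 'a list))"
    using nc_list_map[OF nc_dec[where 'a = 'a]] by (simp add: enc_list_def dec_list_def comp_def)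
qed (simp add: enc_list_def dec_list_def comp_def)
end

lemma code_eq_enc: "code \<sigma> = enc \<sigma>"
  by (simp add: code_def enc_list_def enc_bool_def[abs_def])

lemma enc_nat_list [simp]: "enc (l :: nat list) = list_encode l"
  by (simp add: enc_list_def enc_nat_def[abs_def])

lemma enc_nat_id [simp]: "enc (n::nat) = n"
  by (simp add: enc_nat_def)

lemma dec_nat_id [simp]: "dec n = (n::nat)"
  by (simp add: dec_nat_def)

lemma length_le_enc: "length l \<le> enc l"
  using length_le_list_encode[of "map enc l"] by (simp add: enc_list_def)

section \<open>Closure properties of computability between encoded types\<close>

definition computable :: "nat set \<Rightarrow> ('a::enc \<Rightarrow> 'b::enc) \<Rightarrow> bool" where
  "computable A f \<longleftrightarrow> nat_computable A (\<lambda>n. enc (f (dec n)))"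

named_theorems comp_intros

lemma computable_comp: "computable A g \<Longrightarrow> computable A f \<Longrightarrow> computable A (\<lambda>x. g (f x))"
  unfolding computable_def by (drule (1) nc_comp) simp

lemma computable_id [comp_intros]: "computable A (\<lambda>x. x)"
  unfolding computable_def by (rule nc_dec)

lemma computable_const [comp_intros]: "computable A (\<lambda>x. c)"
  unfolding computable_def by (rule nc_const)

lemma computable_Pair [comp_intros]:
  "computable A f \<Longrightarrow> computable A g \<Longrightarrow> computable A (\<lambda>x. (f x, g x))"
  unfolding computable_def by (drule (1) nc_pair) (simp add: enc_prod_def)

lemma computable_fst [comp_intros]: "computable A f \<Longrightarrow> computable A (\<lambda>x. fst (f x))"
  unfolding computable_def by (drule nc_fst) (simp add: enc_prod_def)

lemma computable_snd [comp_intros]: "computable A f \<Longrightarrow> computable A (\<lambda>x. snd (f x))"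
  unfolding computable_def by (drule nc_snd) (simp add: enc_prod_def)

text \<open>Functions of several arguments are treated as functions of a tuple \<open>p\<close>;
  stated with \<open>fst\<close> and \<open>snd\<close>, the rules in \<open>comp_intros\<close>
  pass under binders by plain resolution.\<close>

lemma computable_comp2:
  assumes "computable A (\<lambda>p. F (fst p) (snd p))" "computable A f" "computable A g"
  shows "computable A (\<lambda>x. F (f x) (g x))"
  using computable_comp[OF assms(1) computable_Pair[OF assms(2,3)]] by simp

lemma computable_comp3:
  assumes "computable A (\<lambda>p. F (fst p) (fst (snd p)) (snd (snd p)))"
    "computable A f" "computable A g" "computable A h"
  shows "computable A (\<lambda>x. F (f x) (g x) (h x))"
  using computable_comp[OF assms(1) computable_Pair[OF assms(2) computable_Pair[OF assms(3,4)]]] by simp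

text \<open>Computability sees a function only through codes, so a change of type that keeps the
  code, such as \<open>enc\<close> or \<open>prod_decode\<close>, is free.\<close>

lemma computable_cast:
  "computable A f \<Longrightarrow> (\<And>x. enc (g x) = enc (f x)) \<Longrightarrow> computable A g"
  unfolding computable_def by simp

lemma computable_enc [comp_intros]: "computable A f \<Longrightarrow> computable A (\<lambda>x. enc (f x))"
  by (erule computable_cast) simp

lemma computable_dec [comp_intros]: "computable A f \<Longrightarrow> computable A (\<lambda>x. dec (f x))"
  by (rule computable_comp[of _ dec]) (auto simp: computable_def nc_dec)

lemma computable_Suc [comp_intros]: "computable A f \<Longrightarrow> computable A (\<lambda>x. Suc (f x))"
  unfolding computable_def by (drule nc_Suc) simp

lemma computable_pred: "computable A f \<Longrightarrow> computable A (\<lambda>x. f x - Suc 0)"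
  unfolding computable_def by (drule nc_pred) simp

lemma computable_if [comp_intros]:
  assumes "computable A c" "computable A f" "computable A g"
  shows "computable A (\<lambda>x. if c x then f x else g x)"
  using nc_if[OF assms(1,3,2)[unfolded computable_def]] unfolding computable_def
  by (rule back_subst[of "nat_computable A"]) (auto simp: enc_bool_def)

lemma computable_rec_nat [comp_intros]:
  assumes f: "computable A f" and h: "computable A h"
    and g: "computable A (\<lambda>p. g (fst p) (fst (snd p)) (snd (snd p)))"
  shows "computable A (\<lambda>x. rec_nat (f x) (\<lambda>n y. g x n y) (h x))"
proof -
  have "rec_nat (enc (f x)) (\<lambda>n y. enc (g x n (dec y))) k = enc (rec_nat (f x) (g x) k)" for x k
    by (induction k) auto
  then show ?thesis
    using nc_rec[OF f[unfolded computable_def] h[unfolded computable_def] g[unfolded computable_def]]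
    by (simp add: computable_def dec_prod_def)
qed

lemma computable_add [comp_intros]:
  assumes "computable A f" "computable A g"
  shows "computable A (\<lambda>x. f x + g x :: nat)"
proof -
  have "rec_nat b (\<lambda>n y. Suc y) a = a + b" for a b :: nat by (induction a) auto
  moreover have "computable A (\<lambda>x. rec_nat (g x) (\<lambda>n y. Suc y) (f x))"
    by (rule comp_intros assms)+
  ultimately show ?thesis by simp
qed

lemma computable_minus [comp_intros]:
  assumes "computable A f" "computable A g"
  shows "computable A (\<lambda>x. f x - g x :: nat)"
proof -
  have "rec_nat a (\<lambda>n y. y - Suc 0) b = a - b" for a b :: nat by (induction b) auto
  moreover have "computable A (\<lambda>x. rec_nat (f x) (\<lambda>n y. y - Suc 0) (g x))"
    by (rule comp_intros computable_pred assms)+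
  ultimately show ?thesis by simp
qed

lemma computable_mult [comp_intros]:
  assumes "computable A f" "computable A g"
  shows "computable A (\<lambda>x. f x * g x :: nat)"
proof -
  have "rec_nat 0 (\<lambda>n y. y + b) a = a * b" for a b :: nat by (induction a) auto
  moreover have "computable A (\<lambda>x. rec_nat 0 (\<lambda>n y. y + g x) (f x))"
    by (rule comp_intros computable_comp[OF assms(2)] assms)+
  ultimately show ?thesis by simp
qed

lemma computable_power [comp_intros]:
  assumes "computable A f" "computable A g"
  shows "computable A (\<lambda>x. f x ^ g x :: nat)"
proof -
  have "rec_nat 1 (\<lambda>n y. y * a) b = a ^ b" for a b :: nat by (induction b) auto
  moreover have "computable A (\<lambda>x. rec_nat 1 (\<lambda>n y. y * f x) (g x))"
    by (rule comp_intros computable_comp[OF assms(1)] assms)+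
  ultimately show ?thesis by simp
qed

lemma computable_not [comp_intros]: 
  assumes "computable A f"
  shows "computable A (\<lambda>x. \<not> f x)"
proof -
  have "computable A (\<lambda>x. if f x then False else True)" by (rule comp_intros assms)+
  then show ?thesis by (rule back_subst[of "computable A"]) auto
qed

lemma computable_conj [comp_intros]: 
  assumes "computable A f" "computable A g"
  shows "computable A (\<lambda>x. f x \<and> g x)"
proof -
  have "computable A (\<lambda>x. if f x then g x else False)" by (rule comp_intros assms)+
  then show ?thesis by (rule back_subst[of "computable A"]) auto
qed

lemma computable_disj [comp_intros]: 
  assumes "computable A f" "computable A g"
  shows "computable A (\<lambda>x. f x \<or> g x)"
proof -
  have "computable A (\<lambda>x. if f x then True else g x)" by (rule comp_intros assms)+
  then show ?thesis by (rule back_subst[of "computable A"]) auto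
qed

lemma computable_imp [comp_intros]: 
  assumes "computable A f" "computable A g"
  shows "computable A (\<lambda>x. f x \<longrightarrow> g x)"
proof -
  have "computable A (\<lambda>x. if f x then g x else True)" by (rule comp_intros assms)+
  then show ?thesis by (rule back_subst[of "computable A"]) auto
qed

lemma computable_eq_0:
  assumes "computable A f"
  shows "computable A (\<lambda>x. f x = (0::nat))"
  unfolding computable_def
  using nc_if[OF assms[unfolded computable_def] nc_const[of _ 1] nc_const[of _ 0]]
  by (rule back_subst[of "nat_computable A"]) (auto simp: enc_bool_def)

lemma computable_less [comp_intros]: 
  assumes "computable A f" "computable A g"
  shows "computable A (\<lambda>x. f x < (g x :: nat))"
proof -
  have "computable A (\<lambda>x. \<not> (g x - f x = 0))" by (rule comp_intros computable_eq_0 assms)+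
  then show ?thesis by (rule back_subst[of "computable A"]) auto
qed

lemma computable_le [comp_intros]: 
  assumes "computable A f" "computable A g"
  shows "computable A (\<lambda>x. f x \<le> (g x :: nat))"
proof -
  have "computable A (\<lambda>x. f x - g x = 0)" by (rule comp_intros computable_eq_0 assms)+
  then show ?thesis by (rule back_subst[of "computable A"]) auto
qed

lemma computable_eq [comp_intros]: 
  fixes f :: "'a::enc \<Rightarrow> 'b::enc"
  assumes "computable A f" "computable A g"
  shows "computable A (\<lambda>x. f x = g x)"
proof -
  have "computable A (\<lambda>x. enc (f x) \<le> enc (g x) \<and> enc (g x) \<le> enc (f x))"
    by (rule comp_intros assms)+
  then show ?thesis by (simp flip: order_eq_iff)
qed

lemma computable_all_less [comp_intros]:
  fixes h :: "'a::enc \<Rightarrow> nat"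
  assumes "computable A h" "computable A (\<lambda>p. P (fst p) (snd p))"
  shows "computable A (\<lambda>x. \<forall>i<h x. P x i)"
proof -
  have "rec_nat True (\<lambda>n y. y \<and> Q n) k \<longleftrightarrow> (\<forall>i<k. Q i)" for Q k
    by (induction k) (auto simp: less_Suc_eq)
  moreover have "computable A (\<lambda>x. rec_nat True (\<lambda>n y. y \<and> P x n) (h x))"
    by (rule comp_intros assms computable_comp2[OF assms(2)])+
  ultimately show ?thesis by simp
qed

lemma computable_ex_less [comp_intros]:
  fixes h :: "'a::enc \<Rightarrow> nat"
  assumes "computable A h" "computable A (\<lambda>p. P (fst p) (snd p))"
  shows "computable A (\<lambda>x. \<exists>i<h x. P x i)"
proof -
  have "computable A (\<lambda>x. \<not> (\<forall>i<h x. \<not> P x i))"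
    by (rule comp_intros assms)+
  then show ?thesis by simp
qed

lemma computable_sum [comp_intros]:
  fixes h :: "'a::enc \<Rightarrow> nat"
  assumes "computable A h" "computable A (\<lambda>p. f (fst p) (snd p))"
  shows "computable A (\<lambda>x. \<Sum>i<h x. f x i :: nat)"
proof -
  have "rec_nat 0 (\<lambda>n y. y + F n) k = (\<Sum>i<k. F i)" for F :: "nat \<Rightarrow> nat" and k
    by (induction k) auto
  moreover have "computable A (\<lambda>x. rec_nat 0 (\<lambda>n y. y + f x n) (h x))"
    by (rule comp_intros assms computable_comp2[OF assms(2)])+
  ultimately show ?thesis by simp
qed

lemma computable_div [comp_intros]:
  assumes "computable A f" "computable A g"
  shows "computable A (\<lambda>x. f x div g x :: nat)"
proof -
  \<comment> \<open>The quotient counts the positive multiples of \<open>b\<close> that fit into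
    \<open>a\<close>; the clause \<open>b \<noteq> 0\<close> yields the value 0 for division by
    0.\<close>
  have "a div b = (\<Sum>i<a. if b \<noteq> 0 \<and> Suc i * b \<le> a then 1 else 0)" for a b :: nat
  proof (cases "b = 0")
    case False
    have "{i. i < a \<and> Suc i * b \<le> a} = {i. i < a div b}"
    proof (intro set_eqI, unfold mem_Collect_eq)
      fix i
      have "i < a div b \<longleftrightarrow> Suc i * b \<le> a"
        using False by (metis Suc_le_eq less_eq_div_iff_mult_less_eq neq0_conv)
      moreover have "i < a" if "i < a div b"
        using that div_le_dividend[of a b] by linarith
      ultimately show "i < a \<and> Suc i * b \<le> a \<longleftrightarrow> i < a div b" by blast
    qed
    moreover have "(\<Sum>i<a. if Suc i * b \<le> a then 1 else 0) = card {i. i < a \<and> Suc i * b \<le> a}"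
      by (subst sum.inter_filter[symmetric]) (auto intro: arg_cong[where f = card])
    ultimately show ?thesis using False by simp
  qed simp
  moreover have "computable A (\<lambda>x. \<Sum>i<f x. if g x \<noteq> 0 \<and> Suc i * g x \<le> f x then 1 else 0 :: nat)"
    by (rule comp_intros assms computable_comp[OF assms(1)] computable_comp[OF assms(2)])+
  ultimately show ?thesis by simp
qed

lemma computable_mod [comp_intros]:
  assumes "computable A f" "computable A g"
  shows "computable A (\<lambda>x. f x mod g x :: nat)"
proof -
  have "computable A (\<lambda>x. f x - f x div g x * g x)"
    by (rule comp_intros assms)+
  then show ?thesis by (simp add: minus_div_mult_eq_mod)
qed

lemma computable_even [comp_intros]:
  assumes "computable A f"
  shows "computable A (\<lambda>x. even (f x :: nat))"
  unfolding even_iff_mod_2_eq_zero by (rule comp_intros assms)+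

lemma computable_Least [comp_intros]:
  fixes P :: "'a::enc \<Rightarrow> nat \<Rightarrow> bool"
  assumes ex: "\<And>x. \<exists>n. P x n" and P: "computable A (\<lambda>p. P (fst p) (snd p))"
  shows "computable A (\<lambda>x. LEAST n. P x n)"
proof -
  \<comment> \<open>\<open>Mu\<close> looks for the value 0, which encodes \<open>False\<close>;
    hence the negation.\<close>
  have "computable A (\<lambda>p. \<not> P (fst p) (snd p))" by (intro computable_not P)
  then obtain r where r: "\<And>n. orc_eval A r [n] (enc (\<not> P (fst (dec n :: 'a \<times> nat)) (snd (dec n :: 'a \<times> nat))))"
    unfolding computable_def nat_computable_def by blast
  have r': "orc_eval A (Comp r [Comp rf_pair [Proj (Suc 0), Proj 0]]) [k, n] (enc (\<not> P (dec n) k))" for n k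
    using r[of "prod_encode (n, k)"]
    by (intro eval_Comp1[OF eval_Comp2[OF eval_Proj1 eval_Proj0 eval_pair]]) (simp add: dec_prod_def)
  have "orc_eval A (Mu (Comp r [Comp rf_pair [Proj (Suc 0), Proj 0]])) [n] (LEAST k. P (dec n) k)" for n
    unfolding eval_Mu_iff
  proof (intro conjI allI impI)
    show "orc_eval A (Comp r [Comp rf_pair [Proj (Suc 0), Proj 0]]) [LEAST k. P (dec n) k, n] 0"
      using r'[of "LEAST k. P (dec n) k" n] LeastI_ex[OF ex[of "dec n"]] by (simp add: enc_bool_def)
    fix m assume "m < (LEAST k. P (dec n) k)"
    then have "\<not> P (dec n) m" by (rule not_less_Least)
    then show "\<exists>y. orc_eval A (Comp r [Comp rf_pair [Proj (Suc 0), Proj 0]]) [m, n] y \<and> y \<noteq> 0"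
      using r'[of m n] by (auto simp: enc_bool_def)
  qed
  then show ?thesis unfolding computable_def nat_computable_def by auto
qed

section \<open>List operations on codes\<close>

definition lhd :: "'a::enc list \<Rightarrow> 'a" where "lhd l = dec (fst (prod_decode (enc l - 1)))"

lemma lhd_Cons [simp]: "lhd (x # xs) = x"
  by (simp add: lhd_def enc_list_def)

lemma computable_lhd [comp_intros]: "computable A f \<Longrightarrow> computable A (\<lambda>x. lhd (f x))"
proof -
  assume f: "computable A f"
  have "computable A (\<lambda>x. dec (fst (dec (enc (f x) - 1) :: nat \<times> nat)))"
    by (rule comp_intros f)+
  then show ?thesis by (simp add: lhd_def dec_prod_def)
qed

lemma computable_tl [comp_intros]: "computable A f \<Longrightarrow> computable A (\<lambda>x. tl (f x))"
proof -
  assume f: "computable A f"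
  have "computable A (\<lambda>x. dec (if f x = [] then 0 else snd (dec (enc (f x) - 1) :: nat \<times> nat)) :: 'b list)"
    by (rule comp_intros f)+
  also have "(\<lambda>x. dec (if f x = [] then 0 else snd (dec (enc (f x) - 1) :: nat \<times> nat)) :: 'b list) = (\<lambda>x. tl (f x))"
  proof
    fix x
    show "(dec (if f x = [] then 0 else snd (dec (enc (f x) - 1) :: nat \<times> nat)) :: 'b list) = tl (f x)"
      by (cases "f x") (auto simp: dec_prod_def enc_list_def dec_list_def comp_def)
  qed
  finally show ?thesis .
qed

lemma computable_Cons [comp_intros]:
  assumes "computable A f" "computable A g"
  shows "computable A (\<lambda>x. f x # g x)"
proof -
  have "computable A (\<lambda>x. Suc (enc (f x, g x)))" by (rule comp_intros assms)+
  then show ?thesis by (rule computable_cast) (simp add: enc_prod_def enc_list_def)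
qed

lemma computable_foldl [comp_intros]:
  assumes "computable A f" "computable A l"
    "computable A (\<lambda>p. g (fst p) (fst (snd p)) (snd (snd p)))"
  shows "computable A (\<lambda>x. foldl (\<lambda>a y. g x a y) (f x) (l x))"
proof -
  \<comment> \<open>The code of a list bounds its length, so \<open>enc l\<close> rounds reach the
    end, and the state no longer changes once the rest is empty.\<close>
  define st where "st x = (\<lambda>(n::nat) s. if snd s = [] then s else (g x (fst s) (lhd (snd s)), tl (snd s)))" for x
  have "rec_nat (a, l) (st x) n = (foldl (g x) a (take n l), drop n l)" for x n a l
  proof (induction n)
    case (Suc n)
    show ?case
    proof (cases "n < length l")
      case True
      then have "drop n l = l ! n # drop (Suc n) l" by (simp add: Cons_nth_drop_Suc)
      then show ?thesis using Suc True
        by (simp add: st_def take_Suc_conv_app_nth)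
    qed (use Suc in \<open>simp add: st_def\<close>)
  qed simp
  then have "fst (rec_nat (a, l) (st x) (enc l)) = foldl (g x) a l" for a l x
    using length_le_enc[of l] by simp
  moreover have "computable A (\<lambda>x. fst (rec_nat (f x, l x) (st x) (enc (l x))))"
    unfolding st_def by (rule comp_intros assms computable_comp3[OF assms(3)])+
  ultimately show ?thesis by simp
qed

lemma computable_ball_set [comp_intros]:
  assumes "computable A l" "computable A (\<lambda>p. P (fst p) (snd p))"
  shows "computable A (\<lambda>x. \<forall>y\<in>set (l x). P x y)"
proof -
  have "foldl (\<lambda>a y. a \<and> Q y) b l \<longleftrightarrow> b \<and> (\<forall>y\<in>set l. Q y)" for Q b and l :: "'b list"
    by (induction l arbitrary: b) auto
  moreover have "computable A (\<lambda>x. foldl (\<lambda>a y. a \<and> P x y) True (l x))"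
    by (rule comp_intros assms computable_comp2[OF assms(2)])+
  ultimately show ?thesis by simp
qed

lemma computable_bex_set [comp_intros]:
  assumes "computable A l" "computable A (\<lambda>p. P (fst p) (snd p))"
  shows "computable A (\<lambda>x. \<exists>y\<in>set (l x). P x y)"
proof -
  have "computable A (\<lambda>x. \<not> (\<forall>y\<in>set (l x). \<not> P x y))"
    by (rule comp_intros assms)+
  then show ?thesis by simp
qed

lemma computable_member [comp_intros]:
  assumes "computable A l" "computable A f"
  shows "computable A (\<lambda>x. f x \<in> set (l x))"
proof -
  have "computable A (\<lambda>x. \<exists>y\<in>set (l x). f x = y)"
    by (rule comp_intros assms computable_comp[OF assms(2)])+
  then show ?thesis by (rule back_subst[of "computable A"]) auto
qed

lemma computable_length [comp_intros]:
  assumes "computable A l"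
  shows "computable A (\<lambda>x. length (l x))"
proof -
  have "foldl (\<lambda>a y. Suc a) n l = n + length l" for n and l :: "'b list"
    by (induction l arbitrary: n) auto
  moreover have "computable A (\<lambda>x. foldl (\<lambda>a y. Suc a) 0 (l x))"
    by (rule comp_intros assms)+
  ultimately show ?thesis by simp
qed

lemma computable_rev [comp_intros]:
  assumes "computable A l"
  shows "computable A (\<lambda>x. rev (l x))"
proof -
  have "foldl (\<lambda>a y. y # a) k l = rev l @ k" for k and l :: "'b list"
    by (induction l arbitrary: k) auto
  moreover have "computable A (\<lambda>x. foldl (\<lambda>a y. y # a) [] (l x))"
    by (rule comp_intros assms)+
  ultimately show ?thesis by simp
qed

lemma computable_append [comp_intros]:
  assumes "computable A l" "computable A k"
  shows "computable A (\<lambda>x. l x @ k x)"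
proof -
  have "foldl (\<lambda>a y. y # a) k l = rev l @ k" for k and l :: "'b list"
    by (induction l arbitrary: k) auto
  moreover have "computable A (\<lambda>x. foldl (\<lambda>a y. y # a) (k x) (rev (l x)))"
    by (rule comp_intros assms)+
  ultimately show ?thesis by simp
qed

lemma computable_map [comp_intros]:
  assumes "computable A l" "computable A (\<lambda>p. f (fst p) (snd p))"
  shows "computable A (\<lambda>x. map (\<lambda>y. f x y) (l x))"
proof -
  have "foldl (\<lambda>a y. a @ [g y]) k l = k @ map g l" for k and l :: "'b list" and g :: "'b \<Rightarrow> 'c"
    by (induction l arbitrary: k) auto
  moreover have "computable A (\<lambda>x. foldl (\<lambda>a y. a @ [f x y]) [] (l x))"
    by (rule comp_intros assms computable_comp2[OF assms(2)])+
  ultimately show ?thesis by simp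
qed

lemma computable_filter [comp_intros]:
  assumes "computable A l" "computable A (\<lambda>p. P (fst p) (snd p))"
  shows "computable A (\<lambda>x. filter (\<lambda>y. P x y) (l x))"
proof -
  have "foldl (\<lambda>a y. if Q y then a @ [y] else a) k l = k @ filter Q l" for k and l :: "'b list" and Q
    by (induction l arbitrary: k) auto
  moreover have "computable A (\<lambda>x. foldl (\<lambda>a y. if P x y then a @ [y] else a) [] (l x))"
    by (rule comp_intros assms computable_comp2[OF assms(2)])+
  ultimately show ?thesis by simp
qed

lemma computable_drop [comp_intros]:
  assumes "computable A h" "computable A l"
  shows "computable A (\<lambda>x. drop (h x) (l x))"
proof -
  have "rec_nat l (\<lambda>_ k. tl k) n = drop n l" for n and l :: "'b list"
    by (induction n) (auto simp: drop_Suc tl_drop)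
  moreover have "computable A (\<lambda>x. rec_nat (l x) (\<lambda>_ k. tl k) (h x))"
    by (rule comp_intros assms)+
  ultimately show ?thesis by simp
qed

text \<open>Total versions of \<open>(!)\<close>: the junk value beyond the end of the list is computable.\<close>

definition lnth :: "'a::enc list \<Rightarrow> nat \<Rightarrow> 'a" where "lnth l i = lhd (drop i l)"

lemma lnth_eq [simp]: "i < length l \<Longrightarrow> lnth l i = l ! i"
  unfolding lnth_def by (metis Cons_nth_drop_Suc lhd_Cons)

lemma computable_lnth [comp_intros]:
  "computable A l \<Longrightarrow> computable A h \<Longrightarrow> computable A (\<lambda>x. lnth (l x) (h x))"
  unfolding lnth_def by (rule comp_intros | assumption)+

lemma computable_upt [comp_intros]:
  assumes "computable A g" "computable A h"
  shows "computable A (\<lambda>x. [g x..<h x])"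
proof -
  have "rec_nat [] (\<lambda>n k. if a \<le> n then k @ [n] else k) b = [a..<b]" for a b
    by (induction b) auto
  moreover have "computable A (\<lambda>x. rec_nat [] (\<lambda>n k. if g x \<le> n then k @ [n] else k) (h x))"
    by (rule comp_intros assms computable_comp[OF assms(1)])+
  ultimately show ?thesis by simp
qed

lemma computable_take [comp_intros]:
  assumes "computable A h" "computable A l"
  shows "computable A (\<lambda>x. take (h x) (l x))"
proof -
  have "take n l = rev (drop (length l - n) (rev l))" for n and l :: "'b list"
    by (cases "n \<le> length l") (simp_all add: rev_drop)
  moreover have "computable A (\<lambda>x. rev (drop (length (l x) - h x) (rev (l x))))"
    by (rule comp_intros assms)+
  ultimately show ?thesis by simp
qed

lemma computable_prod_decode [comp_intros]: "computable A f \<Longrightarrow> computable A (\<lambda>x. prod_decode (f x))"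
  by (erule computable_cast) (simp add: enc_prod_def)

lemma computable_prod_encode [comp_intros]: "computable A f \<Longrightarrow> computable A (\<lambda>x. prod_encode (f x))"
  by (erule computable_cast) (simp add: enc_prod_def)

lemma computable_list_decode [comp_intros]: "computable A f \<Longrightarrow> computable A (\<lambda>x. list_decode (f x))"
  by (erule computable_cast) simp

lemma computable_oracle [comp_intros]: "computable A f \<Longrightarrow> computable A (\<lambda>x. f x \<in> A)"
  by (rule computable_comp[of A "\<lambda>n. n \<in> A"])
    (use nc_oracle[of A] in \<open>auto simp: computable_def enc_bool_def\<close>)

lemma turing_le_iff: "turing_le B A \<longleftrightarrow> computable A (\<lambda>x. x \<in> B)"
  unfolding turing_le_def computable_def nat_computable_def enc_bool_def by simp

section \<open>Derivations and stage-wise convergence\<close>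

primrec recf_code :: "recf \<Rightarrow> nat" where
  "recf_code Zero = prod_encode (0, 0)"
| "recf_code Succ = prod_encode (1, 0)"
| "recf_code (Proj i) = prod_encode (2, i)"
| "recf_code Orc = prod_encode (3, 0)"
| "recf_code (Comp f gs) = prod_encode (4, prod_encode (recf_code f, list_encode (map recf_code gs)))"
| "recf_code (Prim f g) = prod_encode (5, prod_encode (recf_code f, recf_code g))"
| "recf_code (Mu f) = prod_encode (6, recf_code f)"

text \<open>An item \<open>(c, xs, y)\<close> claims that the program with code \<open>c\<close> maps \<open>xs\<close> to \<open>y\<close>; it is justified by
  earlier items and by a finite initial segment \<open>\<sigma>\<close> of the oracle.\<close>

type_synonym item = "nat \<times> nat list \<times> nat"

definition justified :: "bool list \<Rightarrow> item list \<Rightarrow> nat \<Rightarrow> nat list \<Rightarrow> nat \<Rightarrow> bool" where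
  "justified \<sigma> L c xs y \<longleftrightarrow>
    (let t = fst (prod_decode c); a = snd (prod_decode c);
         b = fst (prod_decode a); bs = list_decode (snd (prod_decode a)) in
      (t = 0 \<and> y = 0) \<or>
      (t = 1 \<and> xs \<noteq> [] \<and> y = Suc (lhd xs)) \<or>
      (t = 2 \<and> a < length xs \<and> y = lnth xs a) \<or>
      (t = 3 \<and> xs \<noteq> [] \<and> lhd xs < length \<sigma> \<and> y = (if lnth \<sigma> (lhd xs) then 1 else 0)) \<or>
      (t = 4 \<and> (\<exists>it\<in>set L. fst it = b \<and> snd (snd it) = y \<and> length (fst (snd it)) = length bs \<and>
          (\<forall>i<length bs. (lnth bs i, xs, lnth (fst (snd it)) i) \<in> set L))) \<or>
      (t = 5 \<and> xs \<noteq> [] \<and> (if lhd xs = 0 then (b, tl xs, y) \<in> set L else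
          (\<exists>it\<in>set L. fst it = c \<and> fst (snd it) = (lhd xs - 1) # tl xs \<and>
            (snd (prod_decode a), snd (snd it) # (lhd xs - 1) # tl xs, y) \<in> set L))) \<or>
      (t = 6 \<and> (a, y # xs, 0) \<in> set L \<and>
          (\<forall>m<y. \<exists>it\<in>set L. fst it = a \<and> fst (snd it) = m # xs \<and> snd (snd it) \<noteq> 0)))"

definition valid :: "bool list \<Rightarrow> item list \<Rightarrow> bool" where
  "valid \<sigma> L \<longleftrightarrow> (\<forall>i<length L. justified \<sigma> (take i L) (fst (lnth L i)) (fst (snd (lnth L i))) (snd (snd (lnth L i))))"

text \<open>The bound \<open>s\<close> on the code of the derivation makes convergence decidable.
  The use is bounded by the length of \<sigma>, because a query beyond it is never
  justified.\<close>

definition conv :: "bool list \<Rightarrow> nat \<Rightarrow> nat \<Rightarrow> nat list \<Rightarrow> nat \<Rightarrow> bool" where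
  "conv \<sigma> s c xs y \<longleftrightarrow> (\<exists>d<s. valid \<sigma> (dec d) \<and> (c, xs, y) \<in> set (dec d))"

lemma computable_justified [comp_intros]:
  assumes "computable A f1" "computable A f2" "computable A f3" "computable A f4" "computable A f5"
  shows "computable A (\<lambda>x. justified (f1 x) (f2 x) (f3 x) (f4 x) (f5 x))"
  unfolding justified_def Let_def
  by (rule comp_intros assms[THEN computable_comp])+

lemma computable_valid [comp_intros]:
  assumes "computable A f1" "computable A f2"
  shows "computable A (\<lambda>x. valid (f1 x) (f2 x))"
  unfolding valid_def
  by (rule comp_intros assms[THEN computable_comp])+

lemma computable_conv [comp_intros]:
  assumes "computable A f1" "computable A f2" "computable A f3" "computable A f4" "computable A f5"
  shows "computable A (\<lambda>x. conv (f1 x) (f2 x) (f3 x) (f4 x) (f5 x))"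
  unfolding conv_def
  by (rule comp_intros assms[THEN computable_comp])+

lemma justified_mono:
  assumes "justified \<sigma> L c xs y" "prefix \<sigma> \<tau>" "set L \<subseteq> set L'"
  shows "justified \<tau> L' c xs y"
proof -
  have "\<sigma> ! i = \<tau> ! i" "i < length \<tau>" if "i < length \<sigma>" for i
    using that assms(2) by (auto simp: prefix_def nth_append)
  note \<sigma>\<tau> = this
  note sub = subsetD[OF assms(3)]
  show ?thesis
    using assms(1) unfolding justified_def Let_def
    apply (elim disjE)
    subgoal by simp
    subgoal by simp
    subgoal by simp
    subgoal by (simp add: \<sigma>\<tau>)
    subgoal by simp (blast intro: sub)
    subgoal by (simp split: if_splits) (blast intro: sub)+
    subgoal by simp (blast intro: sub)
    done
qed

lemma valid_iff: "valid \<sigma> L \<longleftrightarrow> (\<forall>i c xs y. i < length L \<longrightarrow> L ! i = (c, xs, y) \<longrightarrow> justified \<sigma> (take i L) c xs y)"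
  unfolding valid_def by (metis fst_conv lnth_eq snd_conv surj_pair)

lemma valid_Nil: "valid \<sigma> []"
  by (simp add: valid_iff)

lemma valid_prefix: "valid \<sigma> L \<Longrightarrow> prefix \<sigma> \<tau> \<Longrightarrow> valid \<tau> L"
  unfolding valid_iff by (meson justified_mono order_refl)

lemma valid_append:
  assumes "valid \<sigma> L" "valid \<sigma> L'"
  shows "valid \<sigma> (L @ L')"
  unfolding valid_iff
proof (intro allI impI)
  fix i c xs y assume i: "i < length (L @ L')" "(L @ L') ! i = (c, xs, y)"
  show "justified \<sigma> (take i (L @ L')) c xs y"
  proof (cases "i < length L")
    case True
    with i assms(1) show ?thesis unfolding valid_iff by (simp add: nth_append)
  next
    case False
    with i have "justified \<sigma> (take (i - length L) L') c xs y"
      using assms(2) unfolding valid_iff by (simp add: nth_append)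
    then show ?thesis by (rule justified_mono) (use False in auto)
  qed
qed

lemma valid_snoc: "valid \<sigma> L \<Longrightarrow> justified \<sigma> L c xs y \<Longrightarrow> valid \<sigma> (L @ [(c, xs, y)])"
  unfolding valid_iff by (auto simp: nth_append less_Suc_eq)

lemma length_restr [simp]: "length (restr A n) = n"
  by (simp add: restr_def)

lemma nth_restr [simp]: "i < n \<Longrightarrow> restr A n ! i = (i \<in> A)"
  by (simp add: restr_def)

lemma take_restr [simp]: "take m (restr A n) = restr A (min m n)"
  by (auto intro: nth_equalityI)

lemma restr_eq_iff: "restr A n = restr B n \<longleftrightarrow> (\<forall>i<n. i \<in> A \<longleftrightarrow> i \<in> B)"
  by (auto simp: list_eq_iff_nth_eq)

lemma prefix_restr: "m \<le> n \<Longrightarrow> prefix (restr A m) (restr A n)"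
  by (metis min_absorb1 take_is_prefix take_restr)

lemma conv_mono: "conv \<sigma> s c xs y \<Longrightarrow> prefix \<sigma> \<tau> \<Longrightarrow> s \<le> t \<Longrightarrow> conv \<tau> t c xs y"
  unfolding conv_def by (meson order_less_le_trans valid_prefix)

section \<open>Evaluation coincides with derivability\<close>

definition derivable :: "nat set \<Rightarrow> item \<Rightarrow> bool" where
  "derivable A it \<longleftrightarrow> (\<exists>n L. valid (restr A n) L \<and> it \<in> set L)"

text \<open>Derivations can be concatenated and survive a longer oracle segment, so finitely many
  items fit into one. The bound \<open>k\<close> makes the segment long enough to answer a query
  below \<open>k\<close>.\<close>

lemma derivable_finite:
  assumes "finite I" "\<And>it. it \<in> I \<Longrightarrow> derivable A it"
  shows "\<exists>n L. k \<le> n \<and> valid (restr A n) L \<and> I \<subseteq> set L"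
  using assms
proof (induction I)
  case empty
  show ?case using valid_Nil by auto
next
  case (insert it I)
  then obtain n L where nL: "k \<le> n" "valid (restr A n) L" "I \<subseteq> set L" by auto
  from insert obtain n' L' where "valid (restr A n') L'" "it \<in> set L'"
    unfolding derivable_def by blast
  then show ?case using nL
    by (intro exI[of _ "max n n'"] exI[of _ "L @ L'"])
      (auto intro!: valid_append elim!: valid_prefix intro: prefix_restr)
qed

lemma derivableI:
  assumes "finite I" "\<And>it. it \<in> I \<Longrightarrow> derivable A it"
    "\<And>n L. k \<le> n \<Longrightarrow> I \<subseteq> set L \<Longrightarrow> justified (restr A n) L c xs y"
  shows "derivable A (c, xs, y)"
proof -
  obtain n L where "k \<le> n" "valid (restr A n) L" "I \<subseteq> set L"
    using derivable_finite[OF assms(1,2)] by blast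
  then show ?thesis
    unfolding derivable_def using valid_snoc assms(3) by (metis UnCI list.set_intros(1) set_append)
qed

lemma orc_eval_derivable: "orc_eval A f xs y \<Longrightarrow> derivable A (recf_code f, xs, y)"
proof (induction rule: orc_eval.induct)
  case (orc x xs)
  show ?case
    by (rule derivableI[of "{}" _ "Suc x"]) (auto simp: justified_def Let_def)
next
  case (comp xs gs ys f z)
  then have len: "length gs = length ys" by (simp add: list_all2_lengthD)
  show ?case
  proof (rule derivableI[of "insert (recf_code f, ys, z) ((\<lambda>i. (recf_code (gs ! i), xs, ys ! i)) ` {..<length gs})" _ 0])
    fix it assume "it \<in> insert (recf_code f, ys, z) ((\<lambda>i. (recf_code (gs ! i), xs, ys ! i)) ` {..<length gs})"
    then show "derivable A it" using comp.IH by (auto simp: list_all2_conv_all_nth)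
  next
    fix n and L :: "item list"
    assume L: "insert (recf_code f, ys, z) ((\<lambda>i. (recf_code (gs ! i), xs, ys ! i)) ` {..<length gs}) \<subseteq> set L"
    show "justified (restr A n) L (recf_code (Comp f gs)) xs z"
      unfolding justified_def Let_def using L len
      by (auto intro!: bexI[of _ "(recf_code f, ys, z)"])
  qed simp
next
  case (prim0 f xs y g)
  show ?case
    by (rule derivableI[of "{(recf_code f, xs, y)}" _ 0]) (use prim0 in \<open>auto simp: justified_def\<close>)
next
  case (primS f g n xs y z)
  show ?case
  proof (rule derivableI[of "{(recf_code (Prim f g), n # xs, y), (recf_code g, y # n # xs, z)}" _ 0])
    fix m and L :: "item list"
    assume "{(recf_code (Prim f g), n # xs, y), (recf_code g, y # n # xs, z)} \<subseteq> set L"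
    then show "justified (restr A m) L (recf_code (Prim f g)) (Suc n # xs) z"
      unfolding justified_def Let_def by (auto intro!: bexI[of _ "(recf_code (Prim f g), n # xs, y)"])
  qed (use primS in auto)
next
  case (mu f n xs)
  from mu.IH(2) obtain Y where Y: "\<And>m. m < n \<Longrightarrow> derivable A (recf_code f, m # xs, Y m) \<and> Y m \<noteq> 0"
    by metis
  show ?case
  proof (rule derivableI[of "insert (recf_code f, n # xs, 0) ((\<lambda>m. (recf_code f, m # xs, Y m)) ` {..<n})" _ 0])
    fix k and L :: "item list"
    assume L: "insert (recf_code f, n # xs, 0) ((\<lambda>m. (recf_code f, m # xs, Y m)) ` {..<n}) \<subseteq> set L"
    have "\<exists>it\<in>set L. fst it = recf_code f \<and> fst (snd it) = m # xs \<and> snd (snd it) \<noteq> 0" if "m < n" for m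
      using L Y[OF that] that by (intro bexI[of _ "(recf_code f, m # xs, Y m)"]) auto
    then show "justified (restr A k) L (recf_code (Mu f)) xs n"
      unfolding justified_def Let_def using L by auto
  qed (use mu Y in auto)
qed (rule derivableI[of "{}" _ 0]; auto simp: justified_def Let_def)+

lemma valid_sound:
  assumes "valid (restr A n) L" "i < length L" "L ! i = (recf_code f, xs, y)"
  shows "orc_eval A f xs y"
  using assms(2,3)
proof (induction i arbitrary: f xs y rule: less_induct)
  case (less i)
  have J: "justified (restr A n) (take i L) (recf_code f) xs y"
    using assms(1) less.prems unfolding valid_iff by blast
  have IH: "orc_eval A g xs' y'" if "(recf_code g, xs', y') \<in> set (take i L)" for g xs' y'
    using that less.IH less.prems(1) by (auto simp: in_set_conv_nth)
  show ?case
  proof (cases f)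
    case Zero
    with J show ?thesis by (auto simp: justified_def Let_def intro: zero)
  next
    case Succ
    with J show ?thesis by (cases xs) (auto simp: justified_def Let_def intro: succ)
  next
    case (Proj j)
    with J show ?thesis by (auto simp: justified_def Let_def intro: proj)
  next
    case Orc
    with J obtain x xs' where x: "xs = x # xs'" "x < n" "y = (if lnth (restr A n) x then 1 else 0)"
      by (cases xs) (auto simp: justified_def Let_def)
    then show ?thesis using Orc orc[of A x xs'] by auto
  next
    case (Comp h gs)
    with J obtain ys where ys: "(recf_code h, ys, y) \<in> set (take i L)" "length ys = length gs"
      "\<And>j. j < length gs \<Longrightarrow> (recf_code (gs ! j), xs, ys ! j) \<in> set (take i L)"
      by (auto simp: justified_def Let_def)
    then have "list_all2 (\<lambda>g y. orc_eval A g xs y) gs ys"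
      by (auto simp: list_all2_conv_all_nth intro: IH)
    then show ?thesis using Comp IH[OF ys(1)] by (auto intro: comp)
  next
    case (Prim g h)
    with J obtain k xs' where xs: "xs = k # xs'"
      by (cases xs) (auto simp: justified_def Let_def)
    show ?thesis
    proof (cases k)
      case 0
      with J Prim xs have "(recf_code g, xs', y) \<in> set (take i L)"
        by (auto simp: justified_def Let_def)
      then show ?thesis unfolding Prim xs 0 by (blast intro: prim0 IH)
    next
      case (Suc k')
      with J Prim xs obtain y' where "(recf_code (Prim g h), k' # xs', y') \<in> set (take i L)"
          "(recf_code h, y' # k' # xs', y) \<in> set (take i L)"
        by (auto simp: justified_def Let_def)
      then show ?thesis unfolding Prim xs Suc by (blast intro: primS IH)
    qed
  next
    case (Mu g)
    with J have "(recf_code g, y # xs, 0) \<in> set (take i L)"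
        "\<forall>m<y. \<exists>it\<in>set (take i L). fst it = recf_code g \<and> fst (snd it) = m # xs \<and> snd (snd it) \<noteq> 0"
      by (auto simp: justified_def Let_def)
    moreover from this(2) have "\<forall>m<y. \<exists>z. (recf_code g, m # xs, z) \<in> set (take i L) \<and> z \<noteq> 0"
      by (metis prod.collapse)
    ultimately show ?thesis unfolding Mu by (blast intro: mu IH)
  qed
qed

text \<open>Kleene's normal form with use: a single number bounds both the oracle segment and the
  code of the derivation.\<close>

lemma orc_eval_iff_conv: "orc_eval A f xs y \<longleftrightarrow> (\<exists>s. conv (restr A s) s (recf_code f) xs y)"
proof
  assume "orc_eval A f xs y"
  then obtain n L where nL: "valid (restr A n) L" "(recf_code f, xs, y) \<in> set L"
    using orc_eval_derivable derivable_def by blast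
  define s where "s = max n (Suc (enc L))"
  have "valid (restr A s) L" using nL(1) by (rule valid_prefix) (simp add: s_def prefix_restr)
  then have "conv (restr A s) s (recf_code f) xs y"
    unfolding conv_def using nL(2) by (intro exI[of _ "enc L"]) (simp add: s_def)
  then show "\<exists>s. conv (restr A s) s (recf_code f) xs y" ..
next
  assume "\<exists>s. conv (restr A s) s (recf_code f) xs y"
  then show "orc_eval A f xs y"
    unfolding conv_def in_set_conv_nth by (blast intro: valid_sound)
qed

section \<open>Stages without an oracle, and c.e. families\<close>

definition pconv :: "nat \<Rightarrow> nat \<Rightarrow> nat list \<Rightarrow> nat \<Rightarrow> bool" where
  "pconv s c xs y \<longleftrightarrow> conv (restr {} s) s c xs y"

definition halts :: "nat \<Rightarrow> nat \<Rightarrow> nat list \<Rightarrow> bool" where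
  "halts s c xs \<longleftrightarrow> (\<exists>d<s. valid (restr {} s) (dec d) \<and> (\<exists>it\<in>set (dec d :: item list). fst it = c \<and> fst (snd it) = xs))"

lemma halts_iff: "halts s c xs \<longleftrightarrow> (\<exists>y. pconv s c xs y)"
  unfolding halts_def pconv_def conv_def by (metis fst_conv snd_conv surj_pair)

lemma computable_pconv [comp_intros]:
  assumes "computable A f2" "computable A f3" "computable A f4" "computable A f5"
  shows "computable A (\<lambda>x. pconv (f2 x) (f3 x) (f4 x) (f5 x))"
  unfolding pconv_def restr_def empty_iff
  by (rule comp_intros assms[THEN computable_comp] assms)+

lemma computable_halts [comp_intros]:
  assumes "computable A f2" "computable A f3" "computable A f4"
  shows "computable A (\<lambda>x. halts (f2 x) (f3 x) (f4 x))"
  unfolding halts_def restr_def empty_iff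
  by (rule comp_intros assms[THEN computable_comp] assms)+

lemma pconv_mono: "pconv s c xs y \<Longrightarrow> s \<le> t \<Longrightarrow> pconv t c xs y"
  unfolding pconv_def by (erule conv_mono) (simp_all add: prefix_restr)

lemma halts_mono: "halts s c xs \<Longrightarrow> s \<le> t \<Longrightarrow> halts t c xs"
  unfolding halts_iff using pconv_mono by blast

lemma eval_iff_pconv: "eval f xs y \<longleftrightarrow> (\<exists>s. pconv s (recf_code f) xs y)"
  unfolding pconv_def by (rule orc_eval_iff_conv)

lemma eval_iff_halts: "(\<exists>y. eval f xs y) \<longleftrightarrow> (\<exists>s. halts s (recf_code f) xs)"
  unfolding halts_iff eval_iff_pconv by blast

text \<open>The source of partial programs: unlike in \<open>computable_Least\<close>, the search
  may fail, and then the program diverges.\<close>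

lemma search_program:
  fixes D :: "'a::enc \<Rightarrow> nat \<Rightarrow> bool" and out :: "nat \<Rightarrow> 'b::enc"
  assumes D: "computable {} (\<lambda>p. D (fst p) (snd p))" and out: "computable {} out"
  shows "\<exists>f. \<forall>x y. eval f [enc x] y \<longleftrightarrow> (\<exists>t. D x t \<and> (\<forall>t'<t. \<not> D x t') \<and> y = enc (out t))"
proof -
  have "computable {} (\<lambda>p. \<not> D (fst p) (snd p))" by (intro computable_not D)
  then obtain r where r: "\<forall>n. eval r [n] (enc (\<not> D (fst (dec n :: 'a \<times> nat)) (snd (dec n :: 'a \<times> nat))))"
    unfolding computable_def nat_computable_def by blast
  from out obtain ro where ro: "\<forall>n. eval ro [n] (enc (out n))"
    unfolding computable_def nat_computable_def by auto
  let ?r = "Comp r [Comp rf_pair [Proj (Suc 0), Proj 0]]"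
  have r': "eval ?r [k, enc x] (enc (\<not> D x k))" for x :: 'a and k
    using r[rule_format, of "prod_encode (enc x, k)"]
    by (intro eval_Comp1[OF eval_Comp2[OF eval_Proj1 eval_Proj0 eval_pair]]) (simp add: dec_prod_def)
  then have r'': "eval ?r [k, enc x] y \<longleftrightarrow> y = enc (\<not> D x k)" for x :: 'a and k y
    using orc_eval_det by blast
  have ro': "eval ro [n] y \<longleftrightarrow> y = enc (out n)" for n y
    using ro orc_eval_det by blast
  have "eval (Comp ro [Mu ?r]) [enc x] y \<longleftrightarrow> (\<exists>t. D x t \<and> (\<forall>t'<t. \<not> D x t') \<and> y = enc (out t))" for x y
    unfolding eval_Comp1_iff[of _ ro] eval_Mu_iff r'' ro' by (auto simp: enc_bool_def)
  then show ?thesis by blast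
qed

lemma unif_ceI:
  fixes P :: "nat \<Rightarrow> bool list \<Rightarrow> 'c::enc \<Rightarrow> bool"
  assumes "computable {} (\<lambda>p. P (fst p) (fst (snd p)) (snd (snd p)))"
  shows "unif_ce (\<lambda>n. {\<sigma>. \<exists>z. P n \<sigma> z})"
proof -
  have "computable {} (\<lambda>p. P (fst (fst p)) (snd (fst p)) (dec (snd p)))"
    by (rule comp_intros computable_comp3[OF assms])+
  from search_program[OF this computable_id] obtain f where
    f: "\<forall>n \<sigma> y. eval f [enc (n :: nat, \<sigma> :: bool list)] y \<longleftrightarrow> P n \<sigma> (dec y) \<and> (\<forall>t'<y. \<not> P n \<sigma> (dec t'))"
    by auto
  have "eval (Comp f [rf_pair]) [n, code \<sigma>] y \<longleftrightarrow> eval f [enc (n, \<sigma>)] y" for n \<sigma> y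
    unfolding eval_Comp1_iff code_eq_enc using eval_pair[of "{}" n "enc \<sigma>"] orc_eval_det
    by (simp add: enc_prod_def) blast
  moreover have "(\<exists>y. eval f [enc (n, \<sigma>)] y) \<longleftrightarrow> (\<exists>z. P n \<sigma> z)" for n \<sigma>
  proof
    assume "\<exists>z. P n \<sigma> z"
    then have "\<exists>t. P n \<sigma> (dec t)" by (metis dec_enc)
    then show "\<exists>y. eval f [enc (n, \<sigma>)] y"
      using f exists_least_iff[of "\<lambda>t. P n \<sigma> (dec t)"] by blast
  qed (use f in blast)
  ultimately have "\<forall>n \<sigma>. \<sigma> \<in> {\<sigma>. \<exists>z. P n \<sigma> z} \<longleftrightarrow> (\<exists>y. eval (Comp f [rf_pair]) [n, code \<sigma>] y)"
    by simp
  then show ?thesis unfolding unif_ce_def by blast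
qed

lemma unif_ceE:
  assumes "unif_ce V"
  obtains P :: "nat \<Rightarrow> bool list \<Rightarrow> nat \<Rightarrow> bool" where
    "\<And>A. computable A (\<lambda>p. P (fst p) (fst (snd p)) (snd (snd p)))"
    "\<And>n \<sigma>. \<sigma> \<in> V n \<longleftrightarrow> (\<exists>s. P n \<sigma> s)" "\<And>n \<sigma> s t. P n \<sigma> s \<Longrightarrow> s \<le> t \<Longrightarrow> P n \<sigma> t"
proof -
  from assms obtain f where "\<And>n \<sigma>. \<sigma> \<in> V n \<longleftrightarrow> (\<exists>y. eval f [n, code \<sigma>] y)"
    unfolding unif_ce_def by auto
  then have "\<sigma> \<in> V n \<longleftrightarrow> (\<exists>s. halts s (recf_code f) [n, enc \<sigma>])" for n \<sigma>
    by (simp add: eval_iff_halts code_eq_enc)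
  then show ?thesis
    by (intro that[of "\<lambda>n \<sigma> s. halts s (recf_code f) [n, enc \<sigma>]"])
      ((rule comp_intros)+ | auto intro: halts_mono)+
qed

section \<open>Counting measure on strings\<close>

definition meas :: "nat \<Rightarrow> (bool list \<Rightarrow> bool) \<Rightarrow> real" where
  "meas M P = real (card {\<tau>. length \<tau> = M \<and> P \<tau>}) / 2 ^ M"

lemma card_strings: "card {\<tau> :: bool list. length \<tau> = M} = 2 ^ M"
  using card_lists_length_eq[of "UNIV :: bool set" M] by simp

lemma finite_strings [simp]: "finite {\<tau> :: bool list. length \<tau> = M \<and> P \<tau>}"
  by (rule finite_subset[OF _ finite_lists_length_eq[of "UNIV :: bool set" M]]) auto

lemma finite_strings_eq [simp]: "finite {\<tau> :: bool list. length \<tau> = M}"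
  using finite_strings[of M "\<lambda>_. True"] by simp

lemma meas_nonneg [simp]: "0 \<le> meas M P"
  by (simp add: meas_def)

lemma meas_mono: "(\<And>\<tau>. length \<tau> = M \<Longrightarrow> P \<tau> \<Longrightarrow> Q \<tau>) \<Longrightarrow> meas M P \<le> meas M Q"
  unfolding meas_def by (intro divide_right_mono of_nat_mono card_mono) auto

lemma meas_cong: "(\<And>\<tau>. length \<tau> = M \<Longrightarrow> P \<tau> \<longleftrightarrow> Q \<tau>) \<Longrightarrow> meas M P = meas M Q"
  by (intro antisym meas_mono) auto

lemma meas_True: "meas M (\<lambda>_. True) = 1"
  by (simp add: meas_def card_strings)

lemma meas_le_1: "meas M P \<le> 1"
  using meas_mono[of M P "\<lambda>_. True"] by (simp add: meas_True)

lemma meas_UN_le: "finite I \<Longrightarrow> meas M (\<lambda>\<tau>. \<exists>i\<in>I. P i \<tau>) \<le> (\<Sum>i\<in>I. meas M (P i))"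
proof -
  assume I: "finite I"
  have eq: "{\<tau>. length \<tau> = M \<and> (\<exists>i\<in>I. P i \<tau>)} = (\<Union>i\<in>I. {\<tau>. length \<tau> = M \<and> P i \<tau>})" by auto
  have "real (card {\<tau>. length \<tau> = M \<and> (\<exists>i\<in>I. P i \<tau>)}) \<le> (\<Sum>i\<in>I. real (card {\<tau>. length \<tau> = M \<and> P i \<tau>}))"
    unfolding eq of_nat_sum[symmetric] of_nat_le_iff by (rule card_UN_le[OF I])
  then show ?thesis unfolding meas_def sum_divide_distrib[symmetric] by (rule divide_right_mono) simp
qed

lemma meas_UN_disjoint:
  assumes "finite I" "\<And>i j \<tau>. i \<in> I \<Longrightarrow> j \<in> I \<Longrightarrow> i \<noteq> j \<Longrightarrow> length \<tau> = M \<Longrightarrow> P i \<tau> \<Longrightarrow> \<not> P j \<tau>"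
  shows "(\<Sum>i\<in>I. meas M (P i)) = meas M (\<lambda>\<tau>. \<exists>i\<in>I. P i \<tau>)"
proof -
  have eq: "{\<tau>. length \<tau> = M \<and> (\<exists>i\<in>I. P i \<tau>)} = (\<Union>i\<in>I. {\<tau>. length \<tau> = M \<and> P i \<tau>})" by auto
  have "card {\<tau>. length \<tau> = M \<and> (\<exists>i\<in>I. P i \<tau>)} = (\<Sum>i\<in>I. card {\<tau>. length \<tau> = M \<and> P i \<tau>})"
    unfolding eq using assms(2) by (intro card_UN_disjoint[OF assms(1)]) auto
  then show ?thesis by (simp add: meas_def sum_divide_distrib)
qed

lemma card_strings_snoc:
  "card {\<tau>. length \<tau> = Suc M \<and> P \<tau>} =
     card {\<tau>. length \<tau> = M \<and> P (\<tau> @ [False])} + card {\<tau>. length \<tau> = M \<and> P (\<tau> @ [True])}"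
proof -
  let ?A = "\<lambda>b. (\<lambda>\<tau>. \<tau> @ [b]) ` {\<tau>. length \<tau> = M \<and> P (\<tau> @ [b])}"
  have eq: "{\<tau>. length \<tau> = Suc M \<and> P \<tau>} = ?A False \<union> ?A True"
  proof (intro set_eqI iffI)
    fix \<tau> assume \<tau>: "\<tau> \<in> {\<tau>. length \<tau> = Suc M \<and> P \<tau>}"
    then obtain \<rho> b where "\<tau> = \<rho> @ [b]" by (cases \<tau> rule: rev_cases) auto
    with \<tau> show "\<tau> \<in> ?A False \<union> ?A True" by (cases b) auto
  qed auto
  have "card (?A b) = card {\<tau>. length \<tau> = M \<and> P (\<tau> @ [b])}" for b
    by (rule card_image) (simp add: inj_on_def)
  moreover have "card (?A False \<union> ?A True) = card (?A False) + card (?A True)"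
    by (rule card_Un_disjoint) auto
  ultimately show ?thesis unfolding eq by simp
qed

lemma meas_Suc: "meas (Suc M) P = (meas M (\<lambda>\<tau>. P (\<tau> @ [False])) + meas M (\<lambda>\<tau>. P (\<tau> @ [True]))) / 2"
  by (simp add: meas_def card_strings_snoc add_divide_distrib)

lemma meas_take: "t \<le> M \<Longrightarrow> meas M (\<lambda>\<tau>. P (take t \<tau>)) = meas t P"
proof (induction M)
  case (Suc M)
  show ?case
  proof (cases "t = Suc M")
    case False
    with Suc have "t \<le> M" by simp
    then have "meas M (\<lambda>\<tau>. P (take t (\<tau> @ [b]))) = meas M (\<lambda>\<tau>. P (take t \<tau>))" for b
      by (intro meas_cong) simp
    then show ?thesis using Suc \<open>t \<le> M\<close> by (simp only: meas_Suc) simp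
  qed (auto intro: meas_cong)
qed (auto intro: meas_cong)

text \<open>Selecting coordinates preserves measure: the last bit is either appended to the
  selection or ignored, and then both of its values give the same fraction.\<close>

lemma meas_nths: "meas M (\<lambda>\<tau>. P (nths \<tau> R)) = meas (card (R \<inter> {..<M})) P"
proof (induction M arbitrary: P)
  case (Suc M)
  have eq: "meas M (\<lambda>\<tau>. P (nths (\<tau> @ [b]) R)) = meas M (\<lambda>\<tau>. P (nths \<tau> R @ (if M \<in> R then [b] else [])))" for b
    by (rule meas_cong) (simp add: nths_append nths_singleton)
  have "R \<inter> {..<Suc M} = (if M \<in> R then insert M (R \<inter> {..<M}) else R \<inter> {..<M})"
    by (auto simp: less_Suc_eq)
  then have c: "card (R \<inter> {..<Suc M}) = (if M \<in> R then Suc (card (R \<inter> {..<M})) else card (R \<inter> {..<M}))"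
    by simp
  show ?case
    unfolding meas_Suc[of M] eq c
    using Suc.IH[of "\<lambda>\<tau>. P (\<tau> @ [False])"] Suc.IH[of "\<lambda>\<tau>. P (\<tau> @ [True])"] Suc.IH[of P]
    by (simp add: meas_Suc)
qed (auto intro: meas_cong)

lemma meas_prefix: "length \<sigma> \<le> M \<Longrightarrow> meas M (prefix \<sigma>) = (1/2) ^ length \<sigma>"
proof -
  assume l: "length \<sigma> \<le> M"
  have "meas M (prefix \<sigma>) = meas M (\<lambda>\<tau>. take (length \<sigma>) \<tau> = \<sigma>)"
    by (rule meas_cong) (metis append_eq_conv_conj prefix_def take_is_prefix)
  also have "\<dots> = meas (length \<sigma>) (\<lambda>\<tau>. \<tau> = \<sigma>)"
    using meas_take[OF l, of "\<lambda>\<tau>. \<tau> = \<sigma>"] .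
  also have "{\<tau>. length \<tau> = length \<sigma> \<and> \<tau> = \<sigma>} = {\<sigma>}" by auto
  then have "meas (length \<sigma>) (\<lambda>\<tau>. \<tau> = \<sigma>) = (1/2) ^ length \<sigma>"
    by (simp add: meas_def power_divide)
  finally show ?thesis .
qed

section \<open>Measure of open sets and the Kraft inequality\<close>

lemma prefix_take_iff: "length \<sigma> \<le> m \<Longrightarrow> prefix \<sigma> (take m \<tau>) \<longleftrightarrow> prefix \<sigma> \<tau>"
  by (metis prefix_length_prefix prefix_order.trans take_is_prefix length_take min_def nle_le prefix_length_le take_all)

lemma fin_measure_eq_meas:
  assumes "finite F" "\<And>\<sigma>. \<sigma> \<in> F \<Longrightarrow> length \<sigma> \<le> M"
  shows "fin_measure F = meas M (\<lambda>\<tau>. \<exists>\<sigma>\<in>F. prefix \<sigma> \<tau>)"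
proof -
  define m where "m = Max (insert 0 (length ` F))"
  have m: "length \<sigma> \<le> m" if "\<sigma> \<in> F" for \<sigma> using that assms(1) by (auto simp: m_def)
  have "m \<le> M" using assms by (auto simp: m_def)
  have "fin_measure F = meas m (\<lambda>\<tau>. \<exists>\<sigma>\<in>F. prefix \<sigma> \<tau>)"
    by (simp add: fin_measure_def meas_def m_def Let_def)
  also have "\<dots> = meas M (\<lambda>\<tau>. \<exists>\<sigma>\<in>F. prefix \<sigma> (take m \<tau>))"
    using meas_take[OF \<open>m \<le> M\<close>, of "\<lambda>\<tau>. \<exists>\<sigma>\<in>F. prefix \<sigma> \<tau>"] by simp
  also have "\<dots> = meas M (\<lambda>\<tau>. \<exists>\<sigma>\<in>F. prefix \<sigma> \<tau>)"
    using prefix_take_iff m by (intro meas_cong) blast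
  finally show ?thesis .
qed

lemma fin_measure_le_open_measure:
  assumes "finite F" "F \<subseteq> W"
  shows "fin_measure F \<le> open_measure W"
  unfolding open_measure_def
proof (rule cSUP_upper)
  have "fin_measure F \<le> 1" if "finite F" for F
    using fin_measure_eq_meas[OF that, of "Max (length ` F)"] that by (simp add: meas_le_1)
  then show "bdd_above (fin_measure ` {F. finite F \<and> F \<subseteq> W})"
    by (auto intro!: bdd_aboveI[of _ 1])
qed (use assms in auto)

lemma open_measure_leI:
  assumes "\<And>F M. finite F \<Longrightarrow> F \<subseteq> W \<Longrightarrow> (\<And>\<sigma>. \<sigma> \<in> F \<Longrightarrow> length \<sigma> \<le> M) \<Longrightarrow>
    meas M (\<lambda>\<tau>. \<exists>\<sigma>\<in>F. prefix \<sigma> \<tau>) \<le> b"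
  shows "open_measure W \<le> b"
  unfolding open_measure_def
proof (rule cSUP_least)
  fix F assume F: "F \<in> {F. finite F \<and> F \<subseteq> W}"
  then show "fin_measure F \<le> b"
    using fin_measure_eq_meas[of F "Max (length ` F)"] assms[of F "Max (length ` F)"] by simp
qed auto

lemma prefix_free_sum:
  fixes F :: "bool list set"
  assumes "finite F" "\<And>\<sigma> \<tau>. \<sigma> \<in> F \<Longrightarrow> \<tau> \<in> F \<Longrightarrow> prefix \<sigma> \<tau> \<Longrightarrow> \<sigma> = \<tau>"
    "\<And>\<sigma>. \<sigma> \<in> F \<Longrightarrow> length \<sigma> \<le> M"
  shows "(\<Sum>\<sigma>\<in>F. (1/2) ^ length \<sigma>) = meas M (\<lambda>\<tau>. \<exists>\<sigma>\<in>F. prefix \<sigma> \<tau>)"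
proof -
  have "(\<Sum>\<sigma>\<in>F. (1/2) ^ length \<sigma>) = (\<Sum>\<sigma>\<in>F. meas M (prefix \<sigma>))"
    using assms(3) by (intro sum.cong) (simp_all add: meas_prefix)
  also have "\<dots> = meas M (\<lambda>\<tau>. \<exists>\<sigma>\<in>F. prefix \<sigma> \<tau>)"
    using assms(2) by (intro meas_UN_disjoint[OF assms(1)]) (metis prefix_same_cases)
  finally show ?thesis .
qed

lemma Kraft:
  fixes F :: "bool list set"
  assumes "finite F" "\<And>\<sigma> \<tau>. \<sigma> \<in> F \<Longrightarrow> \<tau> \<in> F \<Longrightarrow> prefix \<sigma> \<tau> \<Longrightarrow> \<sigma> = \<tau>"
  shows "(\<Sum>\<sigma>\<in>F. (1/2) ^ length \<sigma>) \<le> (1::real)"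
  using prefix_free_sum[OF assms, of "Max (length ` F)"] assms(1) by (simp add: meas_le_1)

text \<open>\<open>inv\<close> says that \<open>P\<close> ignores the positions in
  \<open>[a, m)\<close>. Overwriting one such bit injects each half of the strings into the other,
  so the halves are equally large and each prescribed bit halves the measure.\<close>

lemma meas_independent:
  assumes "a \<le> m" "m \<le> M"
    and inv: "\<And>\<tau> j b. length \<tau> = M \<Longrightarrow> a \<le> j \<Longrightarrow> j < m \<Longrightarrow> P \<tau> \<Longrightarrow> P (\<tau>[j := b])"
  shows "meas M (\<lambda>\<tau>. P \<tau> \<and> (\<forall>j. a \<le> j \<and> j < m \<longrightarrow> \<tau> ! j = g j)) = (1/2) ^ (m - a) * meas M P"
  using assms
proof (induction m)
  case (Suc m)
  show ?case
  proof (cases "a \<le> m")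
    case False
    with Suc.prems have "a = Suc m" by simp
    then show ?thesis by (auto intro: meas_cong)
  next
    case True
    let ?Q = "\<lambda>\<tau>. P \<tau> \<and> (\<forall>j. a \<le> j \<and> j < m \<longrightarrow> \<tau> ! j = g j)"
    let ?S = "\<lambda>b. {\<tau>. length \<tau> = M \<and> ?Q \<tau> \<and> \<tau> ! m = b}"
    have IH: "meas M ?Q = (1/2) ^ (m - a) * meas M P"
      using Suc.IH[OF True] Suc.prems by simp
    have sub: "(\<lambda>\<tau>. \<tau>[m := b]) ` ?S (\<not> b) \<subseteq> ?S b" for b
    proof (rule image_subsetI)
      fix \<tau> assume \<tau>: "\<tau> \<in> ?S (\<not> b)"
      with Suc.prems(3)[of \<tau> m b] True have "P (\<tau>[m := b])" by simp
      with \<tau> Suc.prems(2) show "\<tau>[m := b] \<in> ?S b" by simp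
    qed
    have inj: "inj_on (\<lambda>\<tau>. \<tau>[m := b]) (?S (\<not> b))" for b
    proof (rule inj_onI)
      fix \<tau> \<rho> assume \<tau>: "\<tau> \<in> ?S (\<not> b)" and \<rho>: "\<rho> \<in> ?S (\<not> b)" and eq: "\<tau>[m := b] = \<rho>[m := b]"
      have "\<tau>[m := \<not> b] = \<tau>" "\<rho>[m := \<not> b] = \<rho>"
        using \<tau> \<rho> Suc.prems(2) by (simp_all add: list_update_same_conv)
      moreover have "\<tau>[m := b, m := \<not> b] = \<rho>[m := b, m := \<not> b]" using eq by simp
      ultimately show "\<tau> = \<rho>" by (simp only: list_update_overwrite)
    qed
    have fin: "finite (?S b)" for b by (rule finite_subset[OF _ finite_strings_eq[of M]]) auto
    have "card (?S (\<not> b)) \<le> card (?S b)" for b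
      using card_image[OF inj[of b]] card_mono[OF fin sub[of b]] by simp
    from this[of True] this[of False] have eq: "card (?S b) = card (?S (g m))" for b
      by (cases b; cases "g m") auto
    have "{\<tau>. length \<tau> = M \<and> ?Q \<tau>} = ?S True \<union> ?S False" by auto
    then have "card {\<tau>. length \<tau> = M \<and> ?Q \<tau>} = card (?S True) + card (?S False)"
      by (simp only:) (rule card_Un_disjoint[OF fin fin], auto)
    then have half: "card {\<tau>. length \<tau> = M \<and> ?Q \<tau>} = 2 * card (?S (g m))"
      using eq[of True] eq[of False] by simp
    have "meas M (\<lambda>\<tau>. P \<tau> \<and> (\<forall>j. a \<le> j \<and> j < Suc m \<longrightarrow> \<tau> ! j = g j)) = meas M (\<lambda>\<tau>. ?Q \<tau> \<and> \<tau> ! m = g m)"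
      using True by (intro meas_cong) (auto simp: less_Suc_eq)
    also have "\<dots> = meas M ?Q / 2"
      using half by (simp add: meas_def conj_assoc)
    finally show ?thesis unfolding IH using True by (simp add: Suc_diff_le)
  qed
qed auto

section \<open>Binary strings of numbers\<close>

text \<open>Most significant bit first: the string names the dyadic interval from
  \<open>c / 2 ^ l\<close> to \<open>(c + 1) / 2 ^ l\<close>, and taking a prefix is division by a
  power of two.\<close>

definition bstr :: "nat \<Rightarrow> nat \<Rightarrow> bool list" where
  "bstr l c = map (\<lambda>i. odd (c div 2 ^ (l - 1 - i))) [0..<l]"

lemma computable_bstr [comp_intros]:
  assumes "computable A f" "computable A g"
  shows "computable A (\<lambda>x. bstr (f x) (g x))"
  unfolding bstr_def by (rule comp_intros assms[THEN computable_comp] assms)+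

lemma length_bstr [simp]: "length (bstr l c) = l"
  by (simp add: bstr_def)

lemma nth_bstr: "i < l \<Longrightarrow> bstr l c ! i = odd (c div 2 ^ (l - 1 - i))"
  by (simp add: bstr_def)

lemma take_bstr: "l \<le> l' \<Longrightarrow> take l (bstr l' c) = bstr l (c div 2 ^ (l' - l))"
proof (rule nth_equalityI)
  fix i assume l: "l \<le> l'" and "i < length (take l (bstr l' c))"
  then have i: "i < l" by simp
  have "2 ^ (l' - l) * 2 ^ (l - 1 - i) = (2::nat) ^ (l' - 1 - i)"
    using l i by (simp flip: power_add)
  then have "c div 2 ^ (l' - l) div 2 ^ (l - 1 - i) = c div 2 ^ (l' - 1 - i)"
    by (simp add: div_mult2_eq[symmetric])
  then show "take l (bstr l' c) ! i = bstr l (c div 2 ^ (l' - l)) ! i"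
    using l i by (simp add: nth_bstr)
qed simp

lemma bstr_Suc: "bstr (Suc l) c = bstr l (c div 2) @ [odd c]"
proof -
  have "bstr (Suc l) c = take l (bstr (Suc l) c) @ [bstr (Suc l) c ! l]"
    using take_Suc_conv_app_nth[of l "bstr (Suc l) c"] by simp
  also have "take l (bstr (Suc l) c) = bstr l (c div 2)"
    using take_bstr[of l "Suc l" c] by simp
  finally show ?thesis by (simp add: nth_bstr)
qed

lemma bstr_inj: "bstr l c = bstr l c' \<Longrightarrow> c < 2 ^ l \<Longrightarrow> c' < 2 ^ l \<Longrightarrow> c = c'"
proof (induction l arbitrary: c c')
  case (Suc l)
  then have "c div 2 = c' div 2" "odd c = odd c'" by (auto simp: bstr_Suc)
  then show ?case by (metis dvd_mult_div_cancel odd_two_times_div_two_succ)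
qed (simp add: bstr_def)

lemma bij_betw_bstr: "bij_betw (bstr l) {..<2 ^ l} {\<tau>. length \<tau> = l}"
proof -
  have inj: "inj_on (bstr l) {..<2 ^ l}" by (rule inj_onI) (use bstr_inj in auto)
  have "bstr l ` {..<2 ^ l} = {\<tau>. length \<tau> = l}"
    by (rule card_seteq) (use card_image[OF inj] in \<open>auto simp: card_strings\<close>)
  with inj show ?thesis by (simp add: bij_betw_def)
qed

text \<open>Counting strings becomes a bounded sum over numbers, which makes the kill condition of
  the construction decidable.\<close>

lemma card_strings_eq_sum: "card {\<tau>. length \<tau> = l \<and> P \<tau>} = (\<Sum>c<2 ^ l. if P (bstr l c) then 1 else 0)"
proof -
  have "bij_betw (bstr l) {c \<in> {..<2 ^ l}. P (bstr l c)} {\<tau>. length \<tau> = l \<and> P \<tau>}"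
    unfolding bij_betw_def
  proof (intro conjI set_eqI iffI)
    show "inj_on (bstr l) {c \<in> {..<2 ^ l}. P (bstr l c)}"
      using bij_betw_bstr[of l] by (auto simp: bij_betw_def intro: inj_on_subset)
    fix \<tau> assume \<tau>: "\<tau> \<in> {\<tau>. length \<tau> = l \<and> P \<tau>}"
    then have "\<tau> \<in> bstr l ` {..<2 ^ l}"
      unfolding bij_betw_imp_surj_on[OF bij_betw_bstr[of l]] by simp
    with \<tau> show "\<tau> \<in> bstr l ` {c \<in> {..<2 ^ l}. P (bstr l c)}" by fast
  qed auto
  from bij_betw_same_card[OF this] show ?thesis
    by (simp only: card_eq_sum sum.inter_filter[OF finite_lessThan] flip: One_nat_def)
qed

section \<open>The Kraft-Chaitin theorem\<close>

text \<open>Request number \<open>t\<close> owns the interval \<open>[S t, S (Suc t))\<close>, where \<open>S t\<close> is the weight of the earlier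
  requests; it contains a dyadic interval of half its size, and the strings of these are prefix-free.\<close>

theorem Kraft_Chaitin:
  fixes R :: "'a::enc \<Rightarrow> bool" and len :: "'a \<Rightarrow> nat" and out :: "'a \<Rightarrow> bool list"
  assumes R: "computable {} R" and len: "computable {} len" and out: "computable {} out"
    and weight: "\<And>F. finite F \<Longrightarrow> (\<And>x. x \<in> F \<Longrightarrow> R x) \<Longrightarrow> (\<Sum>x\<in>F. (1/2) ^ len x) \<le> (1::real)"
  shows "\<exists>f. prefix_free_machine f \<and> (\<forall>x. R x \<longrightarrow> (\<exists>p. length p = Suc (len x) \<and> machine f p (out x)))"
proof -
  \<comment> \<open>Requests are numbered by their codes; the first conjunct admits only one number
    for each request.\<close>
  define R' where "R' t \<longleftrightarrow> enc (dec t :: 'a) = t \<and> R (dec t)" for t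
  define l where "l t = len (dec t)" for t
  \<comment> \<open>\<open>B t\<close> dominates all lengths up to \<open>t\<close>, so
    \<open>2 ^ B t\<close> is a common denominator for \<open>S t\<close>, with the integer
    \<open>N t\<close> as numerator.\<close>
  define B where "B t = (\<Sum>u<Suc t. l u)" for t
  define N where "N t = (\<Sum>u<t. if R' u then 2 ^ (B t - l u) else (0::nat))" for t
  \<comment> \<open>This is \<open>S t * 2 ^ Suc (l t)\<close> rounded up, so \<open>c t\<close>
    marks the first dyadic interval of length \<open>(1/2) ^ Suc (l t)\<close> that starts at or
    after \<open>S t\<close>.\<close>
  define c where "c t = (N t * 2 ^ Suc (l t) + 2 ^ B t - 1) div 2 ^ B t" for t
  define str where "str t = bstr (Suc (l t)) (c t)" for t
  define S where "S t = (\<Sum>u<t. if R' u then (1/2) ^ l u else (0::real))" for t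
  have comp_str: "computable {} str" and comp_R': "computable {} R'"
    unfolding str_def[abs_def] c_def N_def B_def l_def R'_def[abs_def]
    by (rule comp_intros assms(1-3)[THEN computable_comp])+
  have S_mono: "S t \<le> S t'" if "t \<le> t'" for t t'
    unfolding S_def by (rule sum_mono2) (use that in auto)
  have S_le_1: "S t \<le> 1" for t
  proof -
    have "S t = (\<Sum>u\<in>{u\<in>{..<t}. R' u}. (1/2) ^ l u)"
      unfolding S_def by (rule sum.inter_filter[symmetric]) simp
    also have "\<dots> = (\<Sum>x\<in>dec ` {u\<in>{..<t}. R' u}. (1/2) ^ len x)"
    proof -
      have inj: "inj_on (dec :: nat \<Rightarrow> 'a) {u\<in>{..<t}. R' u}"
        by (rule inj_on_inverseI[of _ enc]) (simp add: R'_def)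
      show ?thesis unfolding sum.reindex[OF inj] by (simp add: l_def)
    qed
    also have "\<dots> \<le> 1" by (rule weight) (auto simp: R'_def)
    finally show ?thesis .
  qed
  have S_N: "S t * 2 ^ B t = N t" for t
  proof -
    have "(1/2) ^ l u * 2 ^ B t = (2::real) ^ (B t - l u)" if "u < t" for u
    proof -
      have "l u \<le> B t" unfolding B_def using that by (intro member_le_sum) auto
      then show ?thesis by (simp add: power_diff power_divide)
    qed
    then show ?thesis
      unfolding S_def N_def sum_distrib_right of_nat_sum by (intro sum.cong) auto
  qed
  have lower: "S t \<le> c t / 2 ^ Suc (l t)" and upper: "R' t \<Longrightarrow> (c t + 1) / 2 ^ Suc (l t) < S (Suc t)" for t
  proof -
    define b where "b = (2::nat) ^ B t"
    define n where "n = N t * 2 ^ Suc (l t)"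
    have b: "b > 0" by (simp add: b_def)
    have ct: "c t = (n + b - 1) div b" by (simp add: c_def n_def b_def)
    have "n \<le> c t * b"
    proof -
      have "(n + b - 1) mod b + c t * b = n + b - 1" unfolding ct by simp
      moreover have "(n + b - 1) mod b < b" using b by simp
      ultimately show ?thesis using b by linarith
    qed
    then have le: "real n \<le> real (c t) * real b" by (simp flip: of_nat_mult)
    have "c t * b \<le> n + b - 1" unfolding ct by simp
    then have "c t * b < n + b" using b by linarith
    then have less: "real (c t) * real b < real n + real b" by (simp flip: of_nat_mult of_nat_add)
    have n: "real n = S t * real b * 2 ^ Suc (l t)" using S_N[of t] by (simp add: n_def b_def)
    from le b show "S t \<le> c t / 2 ^ Suc (l t)" unfolding n by (simp add: field_simps)
    assume "R' t"
    then have Suc: "S (Suc t) = S t + 2 / 2 ^ Suc (l t)" by (simp add: S_def power_divide)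
    from less have "real (c t) * b < (S t * 2 ^ Suc (l t) + 1) * b" unfolding n by (simp add: algebra_simps)
    then have "real (c t) < S t * 2 ^ Suc (l t) + 1" using b by simp
    then have "(c t + 1) / 2 ^ Suc (l t) < (S t * 2 ^ Suc (l t) + 2) / 2 ^ Suc (l t)"
      by (intro divide_strict_right_mono) auto
    also have "\<dots> = S (Suc t)" unfolding Suc by (simp add: add_divide_distrib)
    finally show "(c t + 1) / 2 ^ Suc (l t) < S (Suc t)" .
  qed
  have c_less: "c t < 2 ^ Suc (l t)" if "R' t" for t
  proof -
    have "(c t + 1) / 2 ^ Suc (l t) < 1" using upper[OF that] S_le_1[of "Suc t"] by linarith
    then have "real (c t + 1) < real (2 ^ Suc (l t))" by (simp add: field_simps)
    then show ?thesis by linarith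
  qed
  \<comment> \<open>Prefixes correspond to nested dyadic intervals; here only the position of the
    left end of the inner one is kept.\<close>
  have prefix_bounds: "real (c t) / 2 ^ Suc (l t) \<le> c t' / 2 ^ Suc (l t') \<and> c t' / 2 ^ Suc (l t') < (c t + 1) / 2 ^ Suc (l t)"
    if "prefix (str t) (str t')" "R' t" "R' t'" for t t'
  proof -
    have le: "Suc (l t) \<le> Suc (l t')" using prefix_length_le[OF that(1)] by (simp add: str_def)
    have "bstr (Suc (l t)) (c t) = take (Suc (l t)) (str t')"
      using that(1) by (auto simp: str_def prefix_def)
    also have "\<dots> = bstr (Suc (l t)) (c t' div 2 ^ (l t' - l t))"
      unfolding str_def using take_bstr[OF le] by simp
    finally have "c t = c t' div 2 ^ (l t' - l t)"
    proof (rule bstr_inj[OF _ c_less[OF that(2)]])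
      have "(2::nat) ^ Suc (l t) * 2 ^ (l t' - l t) = 2 ^ Suc (l t')"
        using le by (simp flip: power_add)
      then have "c t' < 2 ^ Suc (l t) * 2 ^ (l t' - l t)" using c_less[OF that(3)] by (simp only:)
      then show "c t' div 2 ^ (l t' - l t) < 2 ^ Suc (l t)" by (rule less_mult_imp_div_less)
    qed
    then have "c t * 2 ^ (l t' - l t) \<le> c t'" "c t' < (c t + 1) * 2 ^ (l t' - l t)"
      by (simp_all add: dividend_less_div_times)
    then have "real (c t) * 2 ^ (l t' - l t) \<le> real (c t')" "real (c t') < real (c t + 1) * 2 ^ (l t' - l t)"
      using of_nat_mono[of "c t * 2 ^ (l t' - l t)" "c t'", where 'a = real]
        of_nat_less_iff[of "c t'" "(c t + 1) * 2 ^ (l t' - l t)", where 'a = real]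
      by (simp_all add: algebra_simps)
    moreover have "(2::real) ^ Suc (l t') = 2 ^ (l t' - l t) * 2 ^ Suc (l t)"
      using le by (simp flip: power_add power_Suc)
    ultimately show ?thesis by (simp add: field_simps)
  qed
  have incomparable: "t = t'" if "prefix (str t) (str t')" "R' t" "R' t'" for t t'
  proof (rule ccontr)
    assume "t \<noteq> t'"
    then consider "Suc t \<le> t'" | "Suc t' \<le> t" by linarith
    then show False
    proof cases
      case 1
      from S_mono[OF 1] upper[OF that(2)] lower[of t'] prefix_bounds[OF that] show False by linarith
    next
      case 2
      have "real (c t') / 2 ^ Suc (l t') \<le> (c t' + 1) / 2 ^ Suc (l t')" by (intro divide_right_mono) auto
      with S_mono[OF 2] upper[OF that(3)] lower[of t] show False
        using prefix_bounds[OF that] 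
        by (smt (verit) add_divide_distrib divide_pos_pos of_nat_1 of_nat_add zero_less_power)
    qed
  qed
  have "computable {} (\<lambda>p. R' (snd p) \<and> str (snd p) = fst p)"
    by (rule comp_intros comp_R'[THEN computable_comp] comp_str[THEN computable_comp])+
  then have "computable {} (\<lambda>p. (\<lambda>p t. R' t \<and> str t = p) (fst p) (snd p))" .
  from search_program[OF this, of "\<lambda>t. out (dec t)"] obtain f where
    f: "\<forall>p y. eval f [enc p] y \<longleftrightarrow> (\<exists>t. (R' t \<and> str t = p) \<and> (\<forall>t'<t. \<not> (R' t' \<and> str t' = p)) \<and> y = enc (out (dec t)))"
    using computable_comp[OF out computable_dec[OF computable_id]] by auto
  have f': "machine f p \<sigma> \<longleftrightarrow> (\<exists>t. R' t \<and> str t = p \<and> \<sigma> = out (dec t))" for p \<sigma>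
    unfolding machine_def code_eq_enc f[rule_format] enc_eq_iff
    using incomparable by (metis less_irrefl prefix_order.order_refl)
  have "prefix_free_machine f"
    unfolding prefix_free_machine_def f' using incomparable by blast
  moreover have "\<exists>p. length p = Suc (len x) \<and> machine f p (out x)" if "R x" for x
    unfolding f' using that by (intro exI[of _ "str (enc x)"] conjI exI[of _ "enc x"]) (auto simp: str_def l_def R'_def)
  ultimately show ?thesis by blast
qed

section \<open>A universal prefix-free machine\<close>

lemma prefix_iff_take: "prefix p q \<longleftrightarrow> take (length p) q = p"
  by (metis append_eq_conv_conj prefix_def take_is_prefix)

lemma computable_prefix [comp_intros]:
  fixes f g :: "'a::enc \<Rightarrow> 'b::enc list"
  assumes "computable A f" "computable A g"
  shows "computable A (\<lambda>x. prefix (f x) (g x))"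
  unfolding prefix_iff_take by (rule comp_intros assms)+

lemma sum_half_powers: "(\<Sum>e<n. (1/2) ^ Suc e) \<le> (1::real)"
proof -
  have "(\<Sum>e<n. (1/2) ^ Suc e) = 1 - (1/2::real) ^ n" by (induction n) auto
  then show ?thesis by simp
qed

lemma sum_group_le:
  fixes f :: "'a \<Rightarrow> real" and e :: "'a \<Rightarrow> nat"
  assumes F: "finite F" and g: "\<And>k. (\<Sum>x\<in>{x \<in> F. e x = k}. f x) \<le> (1/2) ^ Suc k"
  shows "(\<Sum>x\<in>F. f x) \<le> 1"
proof -
  define n where "n = Suc (Max (e ` F))"
  have "e ` F \<subseteq> {..<n}" using F by (auto simp: n_def less_Suc_eq_le)
  then have "(\<Sum>x\<in>F. f x) = (\<Sum>k<n. \<Sum>x\<in>{x \<in> F. e x = k}. f x)"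
    by (intro sum.group[symmetric] F) auto
  also have "\<dots> \<le> (\<Sum>k<n. (1/2) ^ Suc k)" by (intro sum_mono g)
  also have "\<dots> \<le> 1" by (rule sum_half_powers)
  finally show ?thesis .
qed

text \<open>An event \<open>(e, p, \<sigma>, s)\<close> says that program \<open>e\<close> is seen to map \<open>p\<close> to \<open>\<sigma>\<close> at stage \<open>s\<close>. It is accepted
  if \<open>p\<close> is incomparable to the inputs of all earlier events of \<open>e\<close>; prefix-free machines lose nothing.\<close>

type_synonym evt = "nat \<times> bool list \<times> bool list \<times> nat"

definition event :: "evt \<Rightarrow> bool" where
  "event x \<longleftrightarrow> pconv (snd (snd (snd x))) (fst x) [enc (fst (snd x))] (enc (fst (snd (snd x))))"

definition accepted :: "evt \<Rightarrow> bool" where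
  "accepted x \<longleftrightarrow> event x \<and> (\<forall>t<enc x. enc (dec t :: evt) = t \<and> event (dec t) \<longrightarrow>
     fst (dec t :: evt) = fst x \<longrightarrow>
     \<not> prefix (fst (snd (dec t :: evt))) (fst (snd x)) \<and>
     \<not> prefix (fst (snd x)) (fst (snd (dec t :: evt))))"

lemma computable_event [comp_intros]: "computable A f \<Longrightarrow> computable A (\<lambda>x. event (f x))"
  unfolding event_def by (rule comp_intros | assumption)+

lemma computable_accepted: "computable A accepted"
  unfolding accepted_def[abs_def] by (rule comp_intros)+

lemma accepted_incomparable:
  assumes "accepted x" "accepted y" "fst x = fst y" "prefix (fst (snd x)) (fst (snd y))"
  shows "x = y"
proof (rule ccontr)
  assume "x \<noteq> y"
  then consider "enc x < enc y" | "enc y < enc x" by (metis enc_eq_iff linorder_neqE_nat)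
  then show False
  proof cases
    case 1
    have "event x" using assms(1) by (simp add: accepted_def)
    with 1 assms(2) have "\<not> prefix (fst (snd x)) (fst (snd y))"
      unfolding accepted_def by (metis assms(3) dec_enc)
    with assms(4) show False by simp
  next
    case 2
    have "event y" using assms(2) by (simp add: accepted_def)
    with 2 assms(1) have "\<not> prefix (fst (snd x)) (fst (snd y))"
      unfolding accepted_def by (metis assms(3) dec_enc)
    with assms(4) show False by simp
  qed
qed

text \<open>Whether a program is prefix-free is undecidable, so the filter \<open>accepted\<close>
  enforces it; the accepted events of all programs together form one request set for
  \<open>Kraft_Chaitin\<close>.\<close>

theorem universal_pf_exists: "\<exists>u. universal_pf u"
proof -
  \<comment> \<open>The summand \<open>Suc (fst x)\<close> gives program \<open>e\<close> the share
    \<open>(1/2) ^ Suc e\<close> of the weight; within one program the Kraft inequality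
    applies.\<close>
  define len where "len x = length (fst (snd x)) + Suc (fst x)"
    for x :: "evt"
  define out where "out x = fst (snd (snd x))" for x :: "evt"
  have "\<exists>u. prefix_free_machine u \<and> (\<forall>x. accepted x \<longrightarrow> (\<exists>p. length p = Suc (len x) \<and> machine u p (out x)))"
  proof (rule Kraft_Chaitin)
    show "computable {} len" "computable {} out"
      unfolding len_def[abs_def] out_def[abs_def] by (rule comp_intros)+
    fix F :: "(evt) set"
    assume F: "finite F" "\<And>x. x \<in> F \<Longrightarrow> accepted x"
    show "(\<Sum>x\<in>F. (1/2) ^ len x) \<le> (1::real)"
    proof (rule sum_group_le[OF F(1), where e = fst])
      fix e
      let ?F = "{x \<in> F. fst x = e}"
      have inj: "inj_on (\<lambda>x. fst (snd x)) ?F"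
        by (rule inj_onI) (use accepted_incomparable F(2) in auto)
      have "(\<Sum>x\<in>?F. (1/2) ^ len x) = (\<Sum>x\<in>?F. (1/2) ^ length (fst (snd x))) * (1/2::real) ^ Suc e"
        unfolding sum_distrib_right by (intro sum.cong) (auto simp: len_def power_add)
      also have "(\<Sum>x\<in>?F. (1/2) ^ length (fst (snd x))) = (\<Sum>p\<in>(\<lambda>x. fst (snd x)) ` ?F. (1/2::real) ^ length p)"
        unfolding sum.reindex[OF inj] by simp
      also have "\<dots> \<le> 1"
        using F accepted_incomparable by (intro Kraft) (auto, metis)
      finally show "(\<Sum>x\<in>?F. (1/2) ^ len x) \<le> (1/2::real) ^ Suc e" by (simp add: mult_right_mono)
    qed
  qed (rule computable_accepted)
  then obtain u where u: "prefix_free_machine u"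
    "\<And>x. accepted x \<Longrightarrow> \<exists>p. length p = Suc (len x) \<and> machine u p (out x)" by blast
  have "\<exists>c. \<forall>p \<sigma>. machine f p \<sigma> \<longrightarrow> (\<exists>q. machine u q \<sigma> \<and> length q \<le> length p + c)"
    if f: "prefix_free_machine f" for f
  \<comment> \<open>One unit comes from the \<open>Suc\<close> in \<open>len\<close>, the other from
    the \<open>Suc\<close> in \<open>Kraft_Chaitin\<close>.\<close>
  proof (intro exI[of _ "recf_code f + 2"] allI impI)
    fix p \<sigma> assume p: "machine f p \<sigma>"
    define e where "e = recf_code f"
    have ev: "machine f (fst (snd x)) (fst (snd (snd x)))" if "event x" "fst x = e" for x
      using that unfolding event_def machine_def eval_iff_pconv e_def code_eq_enc by auto
    \<comment> \<open>The first event of \<open>f\<close> with input \<open>p\<close> will be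
      accepted: earlier events of \<open>f\<close> have other inputs, which are incomparable to
      \<open>p\<close> because \<open>f\<close> is prefix-free.\<close>
    define Q where "Q t \<longleftrightarrow> enc (dec t :: evt) = t \<and>
      event (dec t) \<and> fst (dec t :: evt) = e \<and>
      fst (snd (dec t :: evt)) = p" for t
    from p obtain s where "pconv s e [enc p] (enc \<sigma>)"
      unfolding machine_def eval_iff_pconv e_def code_eq_enc by auto
    then have "Q (enc (e, p, \<sigma>, s))" unfolding Q_def event_def by simp
    then have Qt: "Q (LEAST t. Q t)" by (rule LeastI)
    define x :: "evt" where "x = dec (LEAST t. Q t)"
    have x: "enc x = (LEAST t. Q t)" "event x" "fst x = e" "fst (snd x) = p"
      using Qt by (simp_all add: x_def Q_def)
    have "machine f p (fst (snd (snd x)))" using ev[of x] x by simp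
    with p have \<sigma>: "fst (snd (snd x)) = \<sigma>"
      unfolding machine_def code_eq_enc using orc_eval_det by (metis enc_eq_iff)
    have "accepted x"
      unfolding accepted_def
    proof (intro conjI[OF x(2)] allI impI)
      fix t assume t: "t < enc x" "enc (dec t :: evt) = t \<and> event (dec t)" "fst (dec t :: evt) = fst x"
      have "\<not> Q t" using t(1) not_less_Least unfolding x(1) by blast
      then have ne: "fst (snd (dec t :: evt)) \<noteq> p"
        using t x unfolding Q_def by auto
      have "machine f (fst (snd (dec t :: evt))) (fst (snd (snd (dec t :: evt))))"
        using ev[of "dec t"] t x by simp
      then show "\<not> prefix (fst (snd (dec t :: evt))) (fst (snd x)) \<and>
        \<not> prefix (fst (snd x)) (fst (snd (dec t :: evt)))"
        using f p ne unfolding prefix_free_machine_def x(4) by blast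
    qed
    from u(2)[OF this] show "\<exists>q. machine u q \<sigma> \<and> length q \<le> length p + (recf_code f + 2)"
      by (auto simp: len_def out_def \<sigma> x e_def[symmetric])
  qed
  with u(1) show ?thesis unfolding universal_pf_def by blast
qed

section \<open>Complexity as the length of a shortest description\<close>

lemma universal_pf_U: "universal_pf U"
  unfolding U_def by (rule someI_ex[OF universal_pf_exists])

lemma prefix_free_U: "machine U p \<sigma> \<Longrightarrow> machine U q \<tau> \<Longrightarrow> prefix p q \<Longrightarrow> p = q"
  using universal_pf_U unfolding universal_pf_def prefix_free_machine_def by blast

lemma machine_det: "machine f p \<sigma> \<Longrightarrow> machine f p \<tau> \<Longrightarrow> \<sigma> = \<tau>"
  unfolding machine_def code_eq_enc using orc_eval_det enc_eq_iff by blast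

lemma Kraft_Chaitin_U:
  fixes R :: "'a::enc \<Rightarrow> bool" and len :: "'a \<Rightarrow> nat" and out :: "'a \<Rightarrow> bool list"
  assumes "computable {} R" "computable {} len" "computable {} out"
    and "\<And>F. finite F \<Longrightarrow> (\<And>x. x \<in> F \<Longrightarrow> R x) \<Longrightarrow> (\<Sum>x\<in>F. (1/2) ^ len x) \<le> (1::real)"
  shows "\<exists>c. \<forall>x. R x \<longrightarrow> (\<exists>p. machine U p (out x) \<and> length p \<le> len x + c)"
proof -
  obtain f where f: "prefix_free_machine f"
    "\<And>x. R x \<Longrightarrow> \<exists>p. length p = Suc (len x) \<and> machine f p (out x)"
    using Kraft_Chaitin[OF assms] by blast
  then obtain c where c: "\<And>p \<sigma>. machine f p \<sigma> \<Longrightarrow> \<exists>q. machine U q \<sigma> \<and> length q \<le> length p + c"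
    using universal_pf_U unfolding universal_pf_def by blast
  have "\<exists>p. machine U p (out x) \<and> length p \<le> len x + Suc c" if "R x" for x
    using f(2)[OF that] c by fastforce
  then show ?thesis by blast
qed

lemma K_le: "machine U p \<sigma> \<Longrightarrow> K \<sigma> \<le> length p"
  unfolding K_def by (rule Least_le) blast

text \<open>The \<open>LEAST\<close> in \<open>K\<close> is meaningful only if a description exists;
  a single request with output \<sigma> provides one.\<close>

lemma K_attained: "\<exists>p. machine U p \<sigma> \<and> length p = K \<sigma>"
proof -
  have "\<exists>c. \<forall>x. x = (0::nat) \<longrightarrow> (\<exists>p. machine U p \<sigma> \<and> length p \<le> 0 + c)"
  proof (rule Kraft_Chaitin_U)
    fix F :: "nat set" assume "finite F" "\<And>x. x \<in> F \<Longrightarrow> x = 0"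
    then have "F = {} \<or> F = {0}" by blast
    then show "(\<Sum>x\<in>F. (1/2) ^ 0) \<le> (1::real)" by auto
  qed (rule comp_intros)+
  then have "\<exists>n p. machine U p \<sigma> \<and> length p = n" by auto
  from LeastI_ex[OF this] show ?thesis unfolding K_def .
qed

section \<open>The halting probability\<close>

declare nat_str.simps [simp del]

lemma nat_str_inj: "nat_str m = nat_str n \<Longrightarrow> m = n"
proof (induction m arbitrary: n rule: less_induct)
  case (less m)
  show ?case
  proof (cases "m = 0 \<or> n = 0")
    case True
    with less.prems show ?thesis by (auto simp: nat_str.simps[of m] nat_str.simps[of n] nat_str.simps[of 0] split: if_splits)
  next
    case False
    with less.prems have "nat_str ((m - 1) div 2) = nat_str ((n - 1) div 2)" "even m = even n"
      by (auto simp: nat_str.simps[of m] nat_str.simps[of n])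
    with less.IH[of "(m - 1) div 2"] False have "(m - 1) div 2 = (n - 1) div 2" "even m = even n" by auto
    moreover obtain m' n' where "m = Suc m'" "n = Suc n'" using False by (metis not0_implies_Suc)
    ultimately have "m' div 2 = n' div 2" "even m' = even n'" by auto
    then have "m' = n'" by (metis dvd_mult_div_cancel odd_two_times_div_two_succ)
    then show ?thesis using \<open>m = Suc m'\<close> \<open>n = Suc n'\<close> by simp
  qed
qed

lemma computable_nat_str [comp_intros]:
  assumes "computable A f"
  shows "computable A (\<lambda>x. nat_str (f x))"
proof -
  define step where "step = (\<lambda>(i::nat) (z::nat \<times> bool list). if fst z = 0 then z else ((fst z - 1) div 2, even (fst z) # snd z))"
  have "snd (rec_nat (n, l) step k) = nat_str n @ l" if "n \<le> k" for n k l
    using that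
  proof (induction k arbitrary: n l)
    case (Suc k)
    have shift: "rec_nat z step (Suc k) = rec_nat (step 0 z) step k" for z k
      by (induction k) (auto simp: step_def)
    show ?case
    proof (cases "n = 0")
      case True
      with Suc show ?thesis by (simp only: shift) (simp add: step_def nat_str.simps[of 0])
    next
      case False
      with Suc.prems have "(n - 1) div 2 \<le> k" by auto
      from Suc.IH[OF this] False show ?thesis
        by (simp only: shift) (simp add: step_def nat_str.simps[of n])
    qed
  qed (simp add: nat_str.simps[of 0])
  from this[of _ _ "[]"] have "snd (rec_nat (n, []) step n) = nat_str n" for n by simp
  moreover have "computable A (\<lambda>x. snd (rec_nat (f x, []) step (f x)))"
    unfolding step_def by (rule comp_intros assms)+
  ultimately show ?thesis by simp
qed

text \<open>The clause \<open>n < s\<close> carries weight: a description of \<open>n\<close> counts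
  only after stage \<open>n\<close>. The proofs that \<open>Omega\<close> is random and that the
  constructed sets are K-trivial both rest on it.\<close>

definition U_stage :: "nat \<Rightarrow> bool list \<Rightarrow> nat \<Rightarrow> bool" where
  "U_stage s p n \<longleftrightarrow> n < s \<and> enc p < s \<and> pconv s (recf_code U) [enc p] (enc (nat_str n))"

definition dom_stage :: "nat \<Rightarrow> bool list set" where
  "dom_stage s = {p. \<exists>n. U_stage s p n}"

definition Omega_stage :: "nat \<Rightarrow> real" where
  "Omega_stage s = (\<Sum>p\<in>dom_stage s. (1/2) ^ Suc (length p))"

text \<open>The halving in \<open>Omega_stage\<close> keeps it below 1, so that \<open>Omega_digits s n\<close> is the number formed by the
  first \<open>n\<close> binary digits.\<close>

definition Omega_numerator :: "nat \<Rightarrow> nat" where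
  "Omega_numerator s = (\<Sum>c<s. if enc (dec c :: bool list) = c \<and> (\<exists>n<s. U_stage s (dec c) n)
     then 2 ^ (s - length (dec c :: bool list)) else 0)"

definition Omega_digits :: "nat \<Rightarrow> nat \<Rightarrow> nat" where
  "Omega_digits s n = Omega_numerator s * 2 ^ n div 2 ^ Suc s"

lemma computable_U_stage [comp_intros]:
  "computable A f \<Longrightarrow> computable A g \<Longrightarrow> computable A h \<Longrightarrow> computable A (\<lambda>x. U_stage (f x) (g x) (h x))"
  unfolding U_stage_def by (rule comp_intros | assumption)+

lemma computable_Omega_digits [comp_intros]:
  assumes "computable A f" "computable A g"
  shows "computable A (\<lambda>x. Omega_digits (f x) (g x))"
  unfolding Omega_digits_def Omega_numerator_def
  by (rule comp_intros assms[THEN computable_comp] assms)+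

lemma U_stage_mono: "U_stage s p n \<Longrightarrow> s \<le> t \<Longrightarrow> U_stage t p n"
  unfolding U_stage_def using pconv_mono by force

lemma U_stage_machine: "U_stage s p n \<Longrightarrow> machine U p (nat_str n)"
  unfolding U_stage_def machine_def code_eq_enc eval_iff_pconv by blast

lemma machine_U_stage: "machine U p (nat_str n) \<Longrightarrow> \<exists>s. U_stage s p n"
proof -
  assume "machine U p (nat_str n)"
  then obtain s where s: "pconv s (recf_code U) [enc p] (enc (nat_str n))"
    unfolding machine_def code_eq_enc eval_iff_pconv by blast
  have "U_stage (max s (max (Suc n) (Suc (enc p)))) p n"
    unfolding U_stage_def using pconv_mono[OF s] by auto
  then show ?thesis ..
qed

lemma U_stage_unique: "U_stage s p m \<Longrightarrow> U_stage t p n \<Longrightarrow> m = n"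
  by (metis U_stage_machine machine_det nat_str_inj)

lemma dom_stage_mono: "s \<le> t \<Longrightarrow> dom_stage s \<subseteq> dom_stage t"
  unfolding dom_stage_def using U_stage_mono by blast

lemma finite_dom_stage [simp]: "finite (dom_stage s)"
proof (rule finite_subset)
  show "dom_stage s \<subseteq> dec ` {..<s}"
    unfolding dom_stage_def U_stage_def by (force intro: rev_image_eqI[of "enc _"])
qed simp

lemma dom_stage_prefix_free: "p \<in> dom_stage s \<Longrightarrow> q \<in> dom_stage t \<Longrightarrow> prefix p q \<Longrightarrow> p = q"
  unfolding dom_stage_def using U_stage_machine prefix_free_U by blast

lemma Omega_stage_mono: "s \<le> t \<Longrightarrow> Omega_stage s \<le> Omega_stage t"
  unfolding Omega_stage_def by (intro sum_mono2 dom_stage_mono) auto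

lemma Omega_stage_le: "Omega_stage s \<le> 1/2"
proof -
  have "Omega_stage s = (\<Sum>p\<in>dom_stage s. (1/2) ^ length p) / 2"
    unfolding Omega_stage_def sum_divide_distrib by simp
  moreover have "(\<Sum>p\<in>dom_stage s. (1/2) ^ length p) \<le> (1::real)"
    by (rule Kraft) (use dom_stage_prefix_free in auto)
  ultimately show ?thesis by simp
qed

text \<open>The exponents \<open>s - length p\<close> do not truncate, as
  \<open>length p \<le> enc p < s\<close> for \<open>p\<close> in
  \<open>dom_stage s\<close>.\<close>

lemma Omega_numerator_eq: "real (Omega_numerator s) = Omega_stage s * 2 ^ Suc s"
proof -
  have dom: "(dec c \<in> dom_stage s) \<longleftrightarrow> (\<exists>n<s. U_stage s (dec c) n)" for c
    unfolding dom_stage_def U_stage_def by auto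
  let ?I = "{c \<in> {..<s}. enc (dec c :: bool list) = c \<and> dec c \<in> dom_stage s}"
  have inj: "inj_on (dec :: nat \<Rightarrow> bool list) ?I"
    by (rule inj_on_inverseI[of _ enc]) simp
  have img: "dec ` ?I = dom_stage s"
  proof (intro set_eqI iffI)
    fix p assume p: "p \<in> dom_stage s"
    then have "enc p < s" unfolding dom_stage_def U_stage_def by auto
    with p show "p \<in> dec ` ?I" by (intro rev_image_eqI[of "enc p"]) auto
  qed auto
  have "real (Omega_numerator s) = (\<Sum>c\<in>?I. 2 ^ (s - length (dec c :: bool list)))"
    unfolding Omega_numerator_def dom[symmetric] sum.inter_filter[OF finite_lessThan] of_nat_sum
    by (intro sum.cong) auto
  also have "\<dots> = (\<Sum>p\<in>dom_stage s. 2 ^ (s - length p))"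
    using sum.reindex[OF inj, of "\<lambda>p. 2 ^ (s - length p) :: real"] unfolding img by simp
  also have "\<dots> = Omega_stage s * 2 ^ Suc s"
    unfolding Omega_stage_def sum_distrib_right
  proof (intro sum.cong refl)
    fix p assume "p \<in> dom_stage s"
    then have "enc p < s" unfolding dom_stage_def U_stage_def by auto
    then have "length p \<le> s" using length_le_enc[of p] by linarith
    then show "2 ^ (s - length p) = (1/2) ^ Suc (length p) * (2::real) ^ Suc s"
      by (simp add: power_diff power_divide)
  qed
  finally show ?thesis .
qed

lemma Omega_digits_bounds:
  "real (Omega_digits s n) \<le> Omega_stage s * 2 ^ n" "Omega_stage s * 2 ^ n < real (Omega_digits s n) + 1"
proof -
  define N where "N = Omega_numerator s * 2 ^ n"
  have N: "real N = Omega_stage s * 2 ^ n * 2 ^ Suc s"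
    unfolding N_def using Omega_numerator_eq[of s] by simp
  have d: "Omega_digits s n = N div 2 ^ Suc s" by (simp add: Omega_digits_def N_def)
  have "N div 2 ^ Suc s * 2 ^ Suc s \<le> N" by (rule div_times_less_eq_dividend)
  then have "real (Omega_digits s n) * 2 ^ Suc s \<le> real N"
    unfolding d using of_nat_mono[of "N div 2 ^ Suc s * 2 ^ Suc s" N, where 'a = real] by simp
  then show "real (Omega_digits s n) \<le> Omega_stage s * 2 ^ n" unfolding N by (rule mult_right_le_imp_le) simp
  have "N mod 2 ^ Suc s < 2 ^ Suc s" by (rule mod_less_divisor) simp
  then have "N < (N div 2 ^ Suc s + 1) * 2 ^ Suc s"
    using div_mult_mod_eq[of N "2 ^ Suc s"] unfolding distrib_right mult_1 by linarith
  then have "real N < (real (Omega_digits s n) + 1) * 2 ^ Suc s"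
    unfolding d using of_nat_less_iff[of N "(N div 2 ^ Suc s + 1) * 2 ^ Suc s", where 'a = real]
    by (simp add: algebra_simps)
  then show "Omega_stage s * 2 ^ n < real (Omega_digits s n) + 1" unfolding N by (rule mult_right_less_imp_less) simp
qed

lemma Omega_digits_mono: "s \<le> t \<Longrightarrow> Omega_digits s n \<le> Omega_digits t n"
proof -
  assume "s \<le> t"
  then have "Omega_stage s * 2 ^ n \<le> Omega_stage t * 2 ^ n" by (simp add: Omega_stage_mono)
  then have "real (Omega_digits s n) < real (Omega_digits t n) + 1"
    using Omega_digits_bounds(1)[of s n] Omega_digits_bounds(2)[of t n] by linarith
  then show ?thesis by linarith
qed

lemma Omega_digits_less: "Omega_digits s n < 2 ^ n"
proof -
  have "Omega_stage s * 2 ^ n \<le> 1/2 * 2 ^ n" by (intro mult_right_mono Omega_stage_le) simp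
  also have "\<dots> < 2 ^ n" by simp
  finally have "real (Omega_digits s n) < 2 ^ n" using Omega_digits_bounds(1)[of s n] by linarith
  then show ?thesis by simp
qed

lemma Omega_digits_div: "m \<le> n \<Longrightarrow> Omega_digits s n div 2 ^ (n - m) = Omega_digits s m"
proof -
  assume "m \<le> n"
  then have "Omega_numerator s * 2 ^ n = Omega_numerator s * 2 ^ m * 2 ^ (n - m)"
    by (simp flip: power_add)
  then show ?thesis
    unfolding Omega_digits_def by (simp only: div_mult2_eq[symmetric] div_mult_mult2) simp
qed

text \<open>The approximation increases, so a block of digits once left never returns. This is why a
  life is an interval of stages.\<close>

lemma Omega_digits_eq_between:
  "Omega_digits s n = Omega_digits t n \<Longrightarrow> s \<le> u \<Longrightarrow> u \<le> t \<Longrightarrow> Omega_digits u n = Omega_digits t n"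
  by (metis Omega_digits_mono antisym)

lemma Omega_stage_diff:
  assumes "Omega_digits s n = Omega_digits t n"
  shows "Omega_stage t - Omega_stage s \<le> (1/2) ^ n"
proof -
  have "(Omega_stage t - Omega_stage s) * 2 ^ n \<le> 1"
    using Omega_digits_bounds[of s n] Omega_digits_bounds[of t n] assms by (simp add: algebra_simps)
  then show ?thesis by (simp add: field_simps)
qed

section \<open>The limit \<open>Omega\<close> and its randomness\<close>

definition Omega_approx :: "nat \<Rightarrow> nat set" where
  "Omega_approx s = {j. odd (Omega_digits s (Suc j))}"

lemma restr_Omega_approx: "restr (Omega_approx s) n = bstr n (Omega_digits s n)"
proof (rule nth_equalityI)
  fix j assume "j < length (restr (Omega_approx s) n)"
  then have j: "j < n" by simp
  with Omega_digits_div[of "Suc j" n s] show "restr (Omega_approx s) n ! j = bstr n (Omega_digits s n) ! j"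
    by (simp add: nth_bstr Omega_approx_def)
qed simp

lemma restr_Omega_approx_eq_iff:
  "restr (Omega_approx s) n = restr (Omega_approx t) n \<longleftrightarrow> Omega_digits s n = Omega_digits t n"
  unfolding restr_Omega_approx using bstr_inj Omega_digits_less by metis

lemma computable_restr_Omega_approx [comp_intros]:
  "computable A f \<Longrightarrow> computable A g \<Longrightarrow> computable A (\<lambda>x. restr (Omega_approx (f x)) (g x))"
  unfolding restr_Omega_approx by (rule comp_intros | assumption)+

lemma computable_mem_Omega_approx [comp_intros]:
  "computable A f \<Longrightarrow> computable A g \<Longrightarrow> computable A (\<lambda>x. g x \<in> Omega_approx (f x))"
  unfolding Omega_approx_def mem_Collect_eq by (rule comp_intros | assumption)+

lemma Omega_digits_stable: "\<exists>s0. \<forall>s\<ge>s0. Omega_digits s n = Omega_digits s0 n"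
proof -
  have fin: "finite (range (\<lambda>s. Omega_digits s n))"
    by (rule finite_subset[of _ "{..<2 ^ n}"]) (auto simp: Omega_digits_less)
  then have "Max (range (\<lambda>s. Omega_digits s n)) \<in> range (\<lambda>s. Omega_digits s n)" by (intro Max_in) auto
  then obtain s0 where s0: "Omega_digits s0 n = Max (range (\<lambda>s. Omega_digits s n))" by auto
  have "Omega_digits s n \<le> Omega_digits s0 n" for s unfolding s0 using fin by (intro Max_ge) auto
  then show ?thesis using Omega_digits_mono by (meson antisym)
qed

definition Omega :: "nat set" where
  "Omega = {j. \<exists>s0. \<forall>s\<ge>s0. j \<in> Omega_approx s}"

lemma restr_Omega_limit: "\<exists>s0. \<forall>s\<ge>s0. restr (Omega_approx s) n = restr Omega n"
proof -
  obtain s0 where s0: "\<And>s. s \<ge> s0 \<Longrightarrow> Omega_digits s n = Omega_digits s0 n" using Omega_digits_stable by blast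
  then have eq: "restr (Omega_approx s) n = restr (Omega_approx s0) n" if "s \<ge> s0" for s
    using that restr_Omega_approx_eq_iff by blast
  have "j \<in> Omega \<longleftrightarrow> j \<in> Omega_approx s0" if "j < n" for j
  proof -
    have "j \<in> Omega_approx s \<longleftrightarrow> j \<in> Omega_approx s0" if "s \<ge> s0" for s
      using eq[OF that] \<open>j < n\<close> by (simp add: restr_eq_iff)
    then show ?thesis unfolding Omega_def mem_Collect_eq by (metis max.cobounded1 max.cobounded2)
  qed
  then have "restr Omega n = restr (Omega_approx s0) n" by (simp add: restr_eq_iff)
  then have "restr (Omega_approx s) n = restr Omega n" if "s \<ge> s0" for s using eq[OF that] by (simp only:)
  then show ?thesis by blast
qed

theorem MLrandom_Omega: "MLrandom Omega"
  unfolding MLrandom_def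
proof (intro allI impI notI)
  fix V assume V: "MLtest V" and in_V: "\<forall>n. in_open Omega (V n)"
  from V have "unif_ce V" by (simp add: MLtest_def)
  then obtain P :: "nat \<Rightarrow> bool list \<Rightarrow> nat \<Rightarrow> bool" where
    P: "\<And>A. computable A (\<lambda>p. P (fst p) (fst (snd p)) (snd (snd p)))"
    "\<And>n \<sigma>. \<sigma> \<in> V n \<longleftrightarrow> (\<exists>s. P n \<sigma> s)" "\<And>n \<sigma> s t. P n \<sigma> s \<Longrightarrow> s \<le> t \<Longrightarrow> P n \<sigma> t"
    by (rule unif_ceE) blast
  \<comment> \<open>The length of a string doubles as the stage. The minimal strings in
    \<open>W n\<close> then form a decidable prefix-free set, and each extends a member of
    \<open>V n\<close>, so their weight is at most \<open>(1/2) ^ n\<close>.\<close>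
  define W where "W n \<tau> \<longleftrightarrow> (\<exists>l<Suc (length \<tau>). P n (take l \<tau>) (length \<tau>))" for n \<tau>
  define D where "D n \<sigma> \<longleftrightarrow> W n \<sigma> \<and> (\<forall>l<length \<sigma>. \<not> W n (take l \<sigma>))" for n \<sigma>
  have comp_D: "computable A (\<lambda>p. D (fst p) (snd p))" for A
    unfolding D_def W_def by (rule comp_intros P(1)[THEN computable_comp3])+
  have D_prefix_free: "\<sigma> = \<tau>" if "D n \<sigma>" "D n \<tau>" "prefix \<sigma> \<tau>" for n \<sigma> \<tau>
  proof (rule ccontr)
    assume "\<sigma> \<noteq> \<tau>"
    with that(3) have "length \<sigma> < length \<tau>" using prefix_length_less strict_prefix_def by blast
    moreover have "take (length \<sigma>) \<tau> = \<sigma>" using that(3) by (simp add: prefix_iff_take)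
    ultimately show False using that unfolding D_def by metis
  qed
  have D_weight: "(\<Sum>\<sigma>\<in>F. (1/2) ^ length \<sigma>) \<le> (1/2::real) ^ n" if F: "finite F" "\<And>\<sigma>. \<sigma> \<in> F \<Longrightarrow> D n \<sigma>" for F n
  proof -
    have "\<exists>\<rho>. prefix \<rho> \<sigma> \<and> \<rho> \<in> V n" if "\<sigma> \<in> F" for \<sigma>
      using F(2)[OF that] P(2) take_is_prefix unfolding D_def W_def by blast
    then obtain g where g: "\<And>\<sigma>. \<sigma> \<in> F \<Longrightarrow> prefix (g \<sigma>) \<sigma> \<and> g \<sigma> \<in> V n" by metis
    define M where "M = Max (length ` F)"
    have M: "length \<sigma> \<le> M" if "\<sigma> \<in> F" for \<sigma> using F(1) that by (simp add: M_def)
    have "(\<Sum>\<sigma>\<in>F. (1/2) ^ length \<sigma>) = meas M (\<lambda>\<tau>. \<exists>\<sigma>\<in>F. prefix \<sigma> \<tau>)"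
      using F(1) D_prefix_free[OF F(2) F(2)] M by (rule prefix_free_sum)
    also have "\<dots> \<le> meas M (\<lambda>\<tau>. \<exists>\<rho>\<in>g ` F. prefix \<rho> \<tau>)"
      using g by (intro meas_mono) (auto intro: prefix_order.trans)
    also have "\<dots> = fin_measure (g ` F)"
      using F(1) g M by (intro fin_measure_eq_meas[symmetric]) (auto dest!: prefix_length_le intro: le_trans)
    also have "\<dots> \<le> open_measure (V n)" using F(1) g by (intro fin_measure_le_open_measure) auto
    also have "\<dots> \<le> (1/2) ^ n" using V by (simp add: MLtest_def)
    finally show ?thesis .
  qed
  have D_length: "n \<le> length \<sigma>" if "D n \<sigma>" for n \<sigma>
    using D_weight[of "{\<sigma>}" n] that by (simp add: power_decreasing_iff)
  have Omega_in_D: "\<exists>l. D n (restr Omega l)" for n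
  proof -
    obtain \<sigma> where \<sigma>: "\<sigma> \<in> V n" "restr Omega (length \<sigma>) = \<sigma>" using in_V unfolding in_open_def by blast
    with P(2) obtain s where s: "P n \<sigma> s" by blast
    define L where "L = max (length \<sigma>) s"
    have "P n \<sigma> L" using P(3)[OF s] by (simp add: L_def)
    then have "W n (restr Omega L)"
      unfolding W_def using \<sigma>(2) by (intro exI[of _ "length \<sigma>"]) (simp add: L_def min_absorb1)
    then obtain m where m: "W n (restr Omega m)" "\<And>l. l < m \<Longrightarrow> \<not> W n (restr Omega l)"
      using exists_least_iff[of "\<lambda>l. W n (restr Omega l)"] by blast
    then have "D n (restr Omega m)" unfolding D_def by (simp add: min_absorb1)
    then show ?thesis ..
  qed
  text \<open>When the approximation enters a string \<open>\<sigma>\<close> of the test, a description of a fresh number forces the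
    halting probability to grow by more than \<open>2\<close> to the power \<open>- length \<sigma>\<close>.\<close>
  define R where "R x \<longleftrightarrow> D (2 * fst x + 1) (fst (snd x)) \<and>
      restr (Omega_approx (snd (snd x))) (length (fst (snd x))) = fst (snd x) \<and>
      (\<forall>s<snd (snd x). restr (Omega_approx s) (length (fst (snd x))) \<noteq> fst (snd x))" for x :: "nat \<times> bool list \<times> nat"
  have "\<exists>c. \<forall>x. R x \<longrightarrow> (\<exists>p. machine U p (nat_str (snd (snd x))) \<and> length p \<le> (length (fst (snd x)) - fst x) + c)"
  proof (rule Kraft_Chaitin_U)
    show "computable {} R" unfolding R_def[abs_def] by (rule comp_intros comp_D[THEN computable_comp2])+
    fix F assume F: "finite F" "\<And>x. x \<in> F \<Longrightarrow> R x"
    show "(\<Sum>x\<in>F. (1/2) ^ (length (fst (snd x)) - fst x)) \<le> (1::real)"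
    proof (rule sum_group_le[OF F(1), where e = fst])
      fix k
      let ?F = "{x \<in> F. fst x = k}"
      have inj: "inj_on (\<lambda>x. fst (snd x)) ?F"
      proof (rule inj_onI)
        fix x y assume xy: "x \<in> ?F" "y \<in> ?F" "fst (snd x) = fst (snd y)"
        then have "R x" "R y" using F by auto
        with xy(3) have "snd (snd x) = snd (snd y)" unfolding R_def by (metis linorder_neqE_nat)
        with xy show "x = y" by (simp add: prod_eq_iff)
      qed
      \<comment> \<open>Shortening descriptions by \<open>k\<close> bits multiplies the weight by
        \<open>2 ^ k\<close>; at level \<open>2 * k + 1\<close> of the test this still leaves
        \<open>(1/2) ^ Suc k\<close>.\<close>
      have "(\<Sum>x\<in>?F. (1/2) ^ (length (fst (snd x)) - fst x)) = 2 ^ k * (\<Sum>x\<in>?F. (1/2::real) ^ length (fst (snd x)))"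
        unfolding sum_distrib_left
      proof (intro sum.cong refl)
        fix x assume x: "x \<in> ?F"
        then have "R x" using F by auto
        then have "2 * k + 1 \<le> length (fst (snd x))" using x D_length unfolding R_def by fastforce
        then show "(1/2) ^ (length (fst (snd x)) - fst x) = 2 ^ k * (1/2::real) ^ length (fst (snd x))"
          using x by (simp add: power_diff power_divide)
      qed
      also have "(\<Sum>x\<in>?F. (1/2::real) ^ length (fst (snd x))) = (\<Sum>\<sigma>\<in>(\<lambda>x. fst (snd x)) ` ?F. (1/2) ^ length \<sigma>)"
        unfolding sum.reindex[OF inj] by simp
      also have "\<dots> \<le> (1/2) ^ (2 * k + 1)"
        by (rule D_weight) (use F in \<open>auto simp: R_def\<close>)
      finally have "(\<Sum>x\<in>?F. (1/2) ^ (length (fst (snd x)) - fst x)) \<le> 2 ^ k * (1/2::real) ^ (2 * k + 1)" by simp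
      also have "(2 * k + 1) = k + Suc k" by simp
      also have "2 ^ k * (1/2::real) ^ (k + Suc k) = (1/2) ^ Suc k" by (simp add: power_add power_divide)
      finally show "(\<Sum>x\<in>?F. (1/2) ^ (length (fst (snd x)) - fst x)) \<le> (1/2::real) ^ Suc k" .
    qed
  qed (rule comp_intros)+
  then obtain c where c: "\<And>x. R x \<Longrightarrow> \<exists>p. machine U p (nat_str (snd (snd x))) \<and> length p \<le> (length (fst (snd x)) - fst x) + c"
    by blast
  \<comment> \<open>Two bits beyond the coding constant: the description \<open>p\<close> then adds
    at least \<open>2 * (1/2) ^ l\<close> to \<open>Omega_stage\<close> in spite of the halving,
    which forces the first \<open>l\<close> digits to move.\<close>
  define k where "k = c + 2"
  obtain l where l: "D (2 * k + 1) (restr Omega l)" using Omega_in_D by blast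
  obtain s0 where s0: "\<And>s. s \<ge> s0 \<Longrightarrow> restr (Omega_approx s) l = restr Omega l" using restr_Omega_limit by blast
  define s where "s = (LEAST s. restr (Omega_approx s) l = restr Omega l)"
  have s: "restr (Omega_approx s) l = restr Omega l" unfolding s_def by (rule LeastI[of _ s0]) (simp add: s0)
  have "\<And>s'. s' < s \<Longrightarrow> restr (Omega_approx s') l \<noteq> restr Omega l" unfolding s_def by (rule not_less_Least)
  with l s have "R (k, restr Omega l, s)" unfolding R_def by simp
  from c[OF this] obtain p where p: "machine U p (nat_str s)" "length p \<le> l - k + c" by auto
  have "2 * k + 1 \<le> l" using D_length[OF l] by simp
  with p(2) have len: "length p + 2 \<le> l" by (simp add: k_def)
  have "p \<notin> dom_stage s"
  proof
    assume "p \<in> dom_stage s"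
    then obtain n where n: "U_stage s p n" unfolding dom_stage_def by blast
    with p(1) have "n = s" using U_stage_machine machine_det nat_str_inj by blast
    with n show False by (simp add: U_stage_def)
  qed
  obtain t0 where t0: "U_stage t0 p s" using machine_U_stage[OF p(1)] by blast
  define t where "t = max (max s0 s) t0"
  have "p \<in> dom_stage t" unfolding dom_stage_def using U_stage_mono[OF t0, of t] by (auto simp: t_def)
  have "Omega_stage s + (1/2) ^ Suc (length p) = (\<Sum>q\<in>insert p (dom_stage s). (1/2) ^ Suc (length q))"
    unfolding Omega_stage_def using \<open>p \<notin> dom_stage s\<close> by simp
  also have "\<dots> \<le> Omega_stage t"
    unfolding Omega_stage_def using \<open>p \<in> dom_stage t\<close> dom_stage_mono[of s t]
    by (intro sum_mono2) (auto simp: t_def)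
  finally have grow: "Omega_stage s + (1/2) ^ Suc (length p) \<le> Omega_stage t" .
  have "(1/2::real) ^ (l - 1) \<le> (1/2) ^ Suc (length p)" using len by (intro power_decreasing) auto
  moreover have "(1/2::real) ^ (l - 1) = 2 * (1/2) ^ l" using len by (cases l) auto
  ultimately have "Omega_stage s + 2 * (1/2) ^ l \<le> Omega_stage t" using grow by linarith
  then have "(Omega_stage s + 2 * (1/2) ^ l) * 2 ^ l \<le> Omega_stage t * 2 ^ l" by (intro mult_right_mono) auto
  then have "Omega_stage s * 2 ^ l + 2 \<le> Omega_stage t * 2 ^ l" by (simp add: algebra_simps power_divide)
  then have "Omega_digits s l \<noteq> Omega_digits t l"
    using Omega_digits_bounds(1)[of s l] Omega_digits_bounds(2)[of t l] by auto
  moreover have "restr (Omega_approx s) l = restr (Omega_approx t) l" using s s0[of t] by (simp add: t_def)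
  ultimately show False by (simp add: restr_Omega_approx_eq_iff)
qed

section \<open>Random sets with gaps\<close>

text \<open>The interval \<open>[lo q, hi q)\<close> of positions belongs to requirement \<open>q\<close>, which codes a triple \<open>(i, e, k)\<close>:
  program \<open>e\<close> should not compute the \<open>i\<close>-th set from \<open>gapped i\<close>, the bits of \<open>Omega\<close> outside the intervals of
  \<open>i\<close>. At most \<open>2 ^ (lo q + q + 2)\<close> numbers will be enumerated for \<open>q\<close>, each at cost \<open>2\<close> to the power
  \<open>lo q - hi q\<close>; the length of the interval makes the total cost of \<open>q\<close> at most \<open>2\<close> to the power \<open>- (q + 1)\<close>.\<close>

primrec lo :: "nat \<Rightarrow> nat" where
  "lo 0 = 0"
| "lo (Suc q) = 2 * lo q + 2 * q + 3"

definition hi :: "nat \<Rightarrow> nat" where "hi q = 2 * lo q + 2 * q + 3"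

definition idx :: "nat \<Rightarrow> nat" where "idx q = fst (prod_decode q)"

definition prog :: "nat \<Rightarrow> nat" where "prog q = fst (prod_decode (snd (prod_decode q)))"

text \<open>Bounding \<open>q\<close> by \<open>Suc j\<close> loses no interval, as
  \<open>q \<le> lo q\<close>, and makes membership decidable.\<close>

definition kept :: "nat \<Rightarrow> nat set" where
  "kept i = {j. \<not> (\<exists>q<Suc j. idx q = i \<and> lo q \<le> j \<and> j < hi q)}"

definition rank :: "nat \<Rightarrow> nat \<Rightarrow> nat" where "rank i j = card (kept i \<inter> {..<j})"

text \<open>The remaining bits are closed up by \<open>rank\<close>. Filling the gaps with zeros
  would destroy randomness.\<close>

definition gapped :: "nat \<Rightarrow> nat set" where "gapped i = {rank i j | j. j \<in> kept i \<and> j \<in> Omega}"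

lemma hi_eq: "hi q = lo (Suc q)"
  by (simp add: hi_def)

lemma lo_less: "p < q \<Longrightarrow> hi p \<le> lo q"
proof (induction q)
  case (Suc q)
  then show ?case by (cases "p = q") (auto simp: hi_eq)
qed simp

lemma le_lo: "q \<le> lo q"
  by (induction q) auto

lemma lo_less_hi: "lo q < hi q"
  by (simp add: hi_def)

lemma not_in_kept_iff: "j \<notin> kept i \<longleftrightarrow> (\<exists>q. idx q = i \<and> lo q \<le> j \<and> j < hi q)"
  unfolding kept_def using le_lo by (fastforce simp: less_Suc_eq_le intro: le_trans)

lemma interval_unique:
  assumes "lo p \<le> j" "j < hi p" "lo q \<le> j" "j < hi q"
  shows "p = q"
  using lo_less[of p q] lo_less[of q p] assms by (meson le_trans linorder_neqE_nat not_le)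

lemma interval_in_kept: "idx q \<noteq> i \<Longrightarrow> lo q \<le> j \<Longrightarrow> j < hi q \<Longrightarrow> j \<in> kept i"
  using not_in_kept_iff interval_unique by blast

lemma computable_lo [comp_intros]: "computable A f \<Longrightarrow> computable A (\<lambda>x. lo (f x))"
proof -
  assume f: "computable A f"
  have "lo = rec_nat 0 (\<lambda>q y. 2 * y + 2 * q + 3)"
  proof
    show "lo q = rec_nat 0 (\<lambda>q y. 2 * y + 2 * q + 3) q" for q by (induction q) auto
  qed
  then have eq: "(\<lambda>x. lo (f x)) = (\<lambda>x. rec_nat 0 (\<lambda>q y. 2 * y + 2 * q + 3) (f x))" by simp
  show ?thesis unfolding eq by (rule comp_intros f)+
qed

lemma computable_hi [comp_intros]: "computable A f \<Longrightarrow> computable A (\<lambda>x. hi (f x))"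
  unfolding hi_def by (rule comp_intros | assumption)+

lemma computable_idx [comp_intros]: "computable A f \<Longrightarrow> computable A (\<lambda>x. idx (f x))"
  unfolding idx_def by (rule comp_intros | assumption)+

lemma computable_prog [comp_intros]: "computable A f \<Longrightarrow> computable A (\<lambda>x. prog (f x))"
  unfolding prog_def by (rule comp_intros | assumption)+

lemma computable_kept [comp_intros]:
  assumes "computable A f" "computable A g"
  shows "computable A (\<lambda>x. g x \<in> kept (f x))"
  unfolding kept_def mem_Collect_eq by (rule comp_intros assms[THEN computable_comp] assms)+

lemma computable_rank [comp_intros]:
  assumes "computable A f" "computable A g"
  shows "computable A (\<lambda>x. rank (f x) (g x))"
proof -
  have "rank i j = (\<Sum>k<j. if k \<in> kept i then 1 else 0)" for i j
  proof -
    have "{k \<in> {..<j}. k \<in> kept i} = kept i \<inter> {..<j}" by auto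
    then show ?thesis unfolding rank_def sum.inter_filter[OF finite_lessThan, symmetric] by simp
  qed
  then have eq: "(\<lambda>x. rank (f x) (g x)) = (\<lambda>x. \<Sum>k<g x. if k \<in> kept (f x) then 1 else 0)" by simp
  show ?thesis unfolding eq by (rule comp_intros assms[THEN computable_comp] assms)+
qed

lemma nths_eq_map: "nths \<tau> S = map (\<lambda>j. \<tau> ! j) (filter (\<lambda>j. j \<in> S) [0..<length \<tau>])"
proof (induction \<tau> rule: rev_induct)
  case (snoc b \<tau>)
  have "map (\<lambda>j. (\<tau> @ [b]) ! j) (filter (\<lambda>j. j \<in> S) [0..<length \<tau>]) = map (\<lambda>j. \<tau> ! j) (filter (\<lambda>j. j \<in> S) [0..<length \<tau>])"
    by (rule map_cong) (auto simp: nth_append)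
  with snoc show ?case by (simp add: nths_append nths_singleton)
qed simp

lemma computable_nths_kept [comp_intros]:
  assumes "computable A f" "computable A g"
  shows "computable A (\<lambda>x. nths (f x) (kept (g x)))"
proof -
  have "nths \<tau> (kept i) = map (\<lambda>j. lnth \<tau> j) (filter (\<lambda>j. j \<in> kept i) [0..<length \<tau>])"
    for \<tau> :: "'b list" and i
    unfolding nths_eq_map by (rule map_cong) auto
  then have eq: "(\<lambda>x. nths (f x) (kept (g x))) =
      (\<lambda>x. map (\<lambda>j. lnth (f x) j) (filter (\<lambda>j. j \<in> kept (g x)) [0..<length (f x)]))" by simp
  show ?thesis unfolding eq by (rule comp_intros assms[THEN computable_comp] assms)+
qed

lemma rank_Suc: "rank i (Suc j) = (if j \<in> kept i then Suc (rank i j) else rank i j)"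
proof -
  have "kept i \<inter> {..<Suc j} = (if j \<in> kept i then insert j (kept i \<inter> {..<j}) else kept i \<inter> {..<j})"
    by (auto simp: less_Suc_eq)
  then show ?thesis by (simp add: rank_def)
qed

lemma rank_mono: "j \<le> k \<Longrightarrow> rank i j \<le> rank i k"
  unfolding rank_def by (intro card_mono) auto

lemma rank_less: "j \<in> kept i \<Longrightarrow> j < k \<Longrightarrow> rank i j < rank i k"
  using rank_mono[of "Suc j" k i] by (simp add: rank_Suc)

lemma rank_inj: "j \<in> kept i \<Longrightarrow> k \<in> kept i \<Longrightarrow> rank i j = rank i k \<Longrightarrow> j = k"
  using rank_less[of j i k] rank_less[of k i j] by (cases j k rule: linorder_cases) auto

lemma rank_in_gapped_iff: "j \<in> kept i \<Longrightarrow> rank i j \<in> gapped i \<longleftrightarrow> j \<in> Omega"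
  unfolding gapped_def using rank_inj by auto

lemma nths_restr: "nths (restr Omega t) (kept i) = restr (gapped i) (rank i t)"
proof (induction t)
  case (Suc t)
  have "restr Omega (Suc t) = restr Omega t @ [t \<in> Omega]" by (simp add: restr_def)
  moreover have "restr (gapped i) (Suc n) = restr (gapped i) n @ [n \<in> gapped i]" for n by (simp add: restr_def)
  ultimately show ?case using Suc by (simp add: nths_append nths_singleton rank_Suc rank_in_gapped_iff)
qed (simp add: restr_def rank_def)

lemma rank_unbounded: "\<exists>t. n \<le> rank i t"
proof (induction n)
  case (Suc n)
  then obtain t where t: "n \<le> rank i t" by blast
  \<comment> \<open>An interval of another index beyond \<open>t\<close>; all its positions are
    kept.\<close>
  define q where "q = prod_encode (Suc i, t)"
  have "t \<le> lo q" using le_lo[of q] le_prod_encode_2[of t "Suc i"] by (simp add: q_def)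
  then have "n \<le> rank i (lo q)" using t rank_mono by (meson le_trans)
  moreover have "lo q \<in> kept i" by (rule interval_in_kept[of q]) (use lo_less_hi[of q] in \<open>auto simp: q_def idx_def\<close>)
  ultimately have "Suc n \<le> rank i (Suc (lo q))" by (simp add: rank_Suc)
  then show ?case ..
qed simp

text \<open>A test that covers \<open>gapped i\<close> is pulled back along the deletion of the
  gaps, which preserves measure by \<open>meas_nths\<close>, to a test that covers
  \<open>Omega\<close>.\<close>

theorem MLrandom_gapped: "MLrandom (gapped i)"
  unfolding MLrandom_def
proof (intro allI impI notI)
  fix V assume V: "MLtest V" and in_V: "\<forall>n. in_open (gapped i) (V n)"
  from V have "unif_ce V" by (simp add: MLtest_def)
  then obtain P :: "nat \<Rightarrow> bool list \<Rightarrow> nat \<Rightarrow> bool" where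
    P: "\<And>A. computable A (\<lambda>p. P (fst p) (fst (snd p)) (snd (snd p)))"
    "\<And>n \<sigma>. \<sigma> \<in> V n \<longleftrightarrow> (\<exists>s. P n \<sigma> s)"
    by (rule unif_ceE) blast
  define W where "W n = {\<tau>. \<exists>z. P n (take (fst z) (nths \<tau> (kept i))) (snd z)}" for n
  have W_iff: "\<tau> \<in> W n \<longleftrightarrow> (\<exists>l. take l (nths \<tau> (kept i)) \<in> V n)" for n \<tau>
    by (simp add: W_def P(2))
  have "MLtest W"
    unfolding MLtest_def
  proof (intro conjI allI)
    show "unif_ce W"
      unfolding W_def[abs_def]
      by (rule unif_ceI) (rule comp_intros P(1)[THEN computable_comp3])+
    fix n
    show "open_measure (W n) \<le> (1/2) ^ n"
    proof (rule open_measure_leI)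
      fix F M assume F: "finite F" "F \<subseteq> W n" "\<And>\<sigma>. \<sigma> \<in> F \<Longrightarrow> length \<sigma> \<le> M"
      from F(2) have "\<forall>\<tau>\<in>F. \<exists>l. take l (nths \<tau> (kept i)) \<in> V n" using W_iff by blast
      then obtain l where l: "\<And>\<tau>. \<tau> \<in> F \<Longrightarrow> take (l \<tau>) (nths \<tau> (kept i)) \<in> V n" by metis
      define G where "G = (\<lambda>\<tau>. take (l \<tau>) (nths \<tau> (kept i))) ` F"
      have len: "length \<sigma> \<le> card (kept i \<inter> {..<M})" if "\<sigma> \<in> G" for \<sigma>
      proof -
        from that obtain \<tau> where \<tau>: "\<tau> \<in> F" "\<sigma> = take (l \<tau>) (nths \<tau> (kept i))" by (auto simp: G_def)
        have "length (nths \<tau> (kept i)) = card {j. j < length \<tau> \<and> j \<in> kept i}" by (rule length_nths)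
        also have "\<dots> \<le> card (kept i \<inter> {..<M})" using F(3)[OF \<tau>(1)] by (intro card_mono) auto
        finally show ?thesis unfolding \<tau>(2) by simp
      qed
      have "prefix (take (l \<sigma>) (nths \<sigma> (kept i))) (nths \<tau> (kept i))" if "prefix \<sigma> \<tau>" for \<sigma> \<tau>
        using that take_is_prefix by (auto simp: prefix_def nths_append) (metis append.assoc append_take_drop_id)
      then have "meas M (\<lambda>\<tau>. \<exists>\<sigma>\<in>F. prefix \<sigma> \<tau>) \<le> meas M (\<lambda>\<tau>. \<exists>\<sigma>\<in>G. prefix \<sigma> (nths \<tau> (kept i)))"
        unfolding G_def by (intro meas_mono) blast
      also have "\<dots> = meas (card (kept i \<inter> {..<M})) (\<lambda>\<tau>. \<exists>\<sigma>\<in>G. prefix \<sigma> \<tau>)" by (rule meas_nths)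
      also have "\<dots> = fin_measure G"
        by (rule fin_measure_eq_meas[symmetric]) (use F(1) len in \<open>auto simp: G_def\<close>)
      also have "\<dots> \<le> open_measure (V n)"
        by (rule fin_measure_le_open_measure) (use F(1) l in \<open>auto simp: G_def\<close>)
      also have "\<dots> \<le> (1/2) ^ n" using V by (simp add: MLtest_def)
      finally show "meas M (\<lambda>\<tau>. \<exists>\<sigma>\<in>F. prefix \<sigma> \<tau>) \<le> (1/2) ^ n" .
    qed
  qed
  moreover have "in_open Omega (W n)" for n
  proof -
    obtain \<sigma> where \<sigma>: "\<sigma> \<in> V n" "restr (gapped i) (length \<sigma>) = \<sigma>" using in_V unfolding in_open_def by blast
    obtain t where "length \<sigma> \<le> rank i t" using rank_unbounded by blast
    then have "take (length \<sigma>) (nths (restr Omega t) (kept i)) = \<sigma>"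
      using \<sigma>(2) by (simp add: nths_restr min_absorb1)
    with \<sigma>(1) have "restr Omega t \<in> W n" unfolding W_iff by metis
    then show ?thesis unfolding in_open_def by force
  qed
  ultimately show False using MLrandom_Omega unfolding MLrandom_def by blast
qed

section \<open>The construction\<close>

text \<open>A life of \<open>q\<close> is a maximal interval of stages on which the first \<open>hi q\<close> digits do not change; it is
  named by its first stage \<open>s\<close> and owns the witness \<open>(q, s)\<close>. A good oracle is seen to give the answer \<open>0\<close> at
  the witness. A life that ends at \<open>t\<close> is killed, that is, its witness enters the set, if many oracles are
  good and have not been refuted by an earlier killed life.\<close>

definition start :: "nat \<Rightarrow> nat \<Rightarrow> nat" where
  "start q t = (LEAST s. Omega_digits s (hi q) = Omega_digits t (hi q))"

definition good :: "nat \<Rightarrow> nat \<Rightarrow> nat \<Rightarrow> bool list \<Rightarrow> bool" where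
  "good q s t \<tau> \<longleftrightarrow> conv (nths \<tau> (kept (idx q))) t (prog q) [prod_encode (q, s)] 0"

definition alive :: "nat \<Rightarrow> (nat \<times> nat) list \<Rightarrow> bool list \<Rightarrow> bool" where
  "alive q l \<tau> \<longleftrightarrow> (\<forall>k\<in>set l. \<not> good q (fst k) (snd k) (take (snd k) \<tau>))"

text \<open>The second clause says that the fraction of good unrefuted strings is at least
  \<open>(1/2) ^ (lo q + q + 2)\<close>, multiplied out to stay within the integers. Looking at
  stage \<open>Suc t\<close> shows whether the life ends at \<open>t\<close>.\<close>

definition kill_cond :: "nat \<Rightarrow> nat \<Rightarrow> (nat \<times> nat) list \<Rightarrow> bool" where
  "kill_cond q t l \<longleftrightarrow> Omega_digits (Suc t) (hi q) \<noteq> Omega_digits t (hi q) \<and>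
     2 ^ t \<le> 2 ^ (lo q + q + 2) * card {\<tau>. length \<tau> = t \<and> good q (start q t) t \<tau> \<and> alive q l \<tau>}"

primrec kills :: "nat \<Rightarrow> nat \<Rightarrow> (nat \<times> nat) list" where
  "kills q 0 = []"
| "kills q (Suc t) = (if kill_cond q t (kills q t) then (start q t, t) # kills q t else kills q t)"

definition killed :: "nat \<Rightarrow> nat \<Rightarrow> bool" where "killed q t \<longleftrightarrow> kill_cond q t (kills q t)"

definition candidate :: "nat \<Rightarrow> nat \<Rightarrow> bool list \<Rightarrow> bool" where
  "candidate q t \<tau> \<longleftrightarrow> good q (start q t) t \<tau> \<and> alive q (kills q t) \<tau>"

lemma computable_start [comp_intros]:
  assumes "computable A f" "computable A g"
  shows "computable A (\<lambda>x. start (f x) (g x))"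
  unfolding start_def by (rule comp_intros assms[THEN computable_comp] assms exI refl)+

lemma computable_good [comp_intros]:
  assumes "computable A f" "computable A g" "computable A h" "computable A k"
  shows "computable A (\<lambda>x. good (f x) (g x) (h x) (k x))"
  unfolding good_def by (rule comp_intros assms[THEN computable_comp] assms)+

lemma computable_alive [comp_intros]:
  assumes "computable A f" "computable A g" "computable A h"
  shows "computable A (\<lambda>x. alive (f x) (g x) (h x))"
  unfolding alive_def by (rule comp_intros assms[THEN computable_comp] assms)+

lemma computable_kill_cond [comp_intros]:
  assumes "computable A f" "computable A g" "computable A h"
  shows "computable A (\<lambda>x. kill_cond (f x) (g x) (h x))"
  unfolding kill_cond_def card_strings_eq_sum by (rule comp_intros assms[THEN computable_comp] assms)+

lemma computable_kills [comp_intros]: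
  assumes "computable A f" "computable A g"
  shows "computable A (\<lambda>x. kills (f x) (g x))"
proof -
  have "kills q t = rec_nat [] (\<lambda>t l. if kill_cond q t l then (start q t, t) # l else l) t" for q t
    by (induction t) auto
  then have eq: "(\<lambda>x. kills (f x) (g x)) =
      (\<lambda>x. rec_nat [] (\<lambda>t l. if kill_cond (f x) t l then (start (f x) t, t) # l else l) (g x))" by simp
  show ?thesis unfolding eq by (rule comp_intros assms[THEN computable_comp] assms)+
qed

lemma computable_killed [comp_intros]:
  assumes "computable A f" "computable A g"
  shows "computable A (\<lambda>x. killed (f x) (g x))"
  unfolding killed_def by (rule comp_intros assms[THEN computable_comp] assms)+

lemma computable_candidate [comp_intros]:
  assumes "computable A f" "computable A g" "computable A h"
  shows "computable A (\<lambda>x. candidate (f x) (g x) (h x))"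
  unfolding candidate_def by (rule comp_intros assms[THEN computable_comp] assms)+

section \<open>Lives, kills and their number\<close>

lemma set_kills: "set (kills q u) = {(start q t, t) | t. t < u \<and> killed q t}"
  by (induction u) (auto simp: killed_def less_Suc_eq)

lemma candidate_iff: "candidate q t \<tau> \<longleftrightarrow> good q (start q t) t \<tau> \<and>
    (\<forall>u<t. killed q u \<longrightarrow> \<not> good q (start q u) u (take u \<tau>))"
  unfolding candidate_def alive_def set_kills by auto

lemma start_le: "start q t \<le> t"
  unfolding start_def by (rule Least_le) simp

lemma start_digits: "Omega_digits (start q t) (hi q) = Omega_digits t (hi q)"
  unfolding start_def by (rule LeastI[of _ t]) simp

lemma start_cong: "Omega_digits s (hi q) = Omega_digits t (hi q) \<Longrightarrow> start q s = start q t"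
  unfolding start_def by simp

lemma killed_hi: "killed q t \<Longrightarrow> Omega_digits (Suc t) (hi q) \<noteq> Omega_digits t (hi q)"
  by (simp add: killed_def kill_cond_def)

lemma killed_iff_meas:
  "killed q t \<longleftrightarrow> Omega_digits (Suc t) (hi q) \<noteq> Omega_digits t (hi q) \<and>
     (1/2) ^ (lo q + q + 2) \<le> meas t (candidate q t)"
proof -
  define c where "c = card {\<tau>. length \<tau> = t \<and> candidate q t \<tau>}"
  define k where "k = lo q + q + 2"
  have "2 ^ t \<le> 2 ^ k * c \<longleftrightarrow> real (2 ^ t) \<le> real (2 ^ k * c)" by (simp only: of_nat_le_iff)
  also have "\<dots> \<longleftrightarrow> (1/2) ^ k \<le> real c / 2 ^ t" by (simp add: power_one_over field_simps)
  also have "\<dots> \<longleftrightarrow> (1/2) ^ k \<le> meas t (candidate q t)" by (simp add: meas_def c_def)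
  finally show ?thesis
    unfolding killed_def kill_cond_def candidate_def[symmetric] c_def k_def by simp
qed

lemma good_mono:
  assumes "good q s t \<tau>" "prefix \<tau> \<rho>" "t \<le> u"
  shows "good q s u \<rho>"
proof -
  have "prefix (nths \<tau> (kept (idx q))) (nths \<rho> (kept (idx q)))"
    using assms(2) by (auto simp: prefix_def nths_append)
  then show ?thesis using assms conv_mono unfolding good_def by blast
qed

text \<open>A candidate at a kill is good for the killed witness and hence refuted at all later
  kills, so the sets are disjoint.\<close>

lemma sum_meas_killed_le_1:
  assumes "finite T" "\<And>t. t \<in> T \<Longrightarrow> killed q t \<and> t \<le> M"
  shows "(\<Sum>t\<in>T. meas M (\<lambda>\<tau>. candidate q t (take t \<tau>))) \<le> 1"
proof -
  have "\<not> candidate q u (take u \<tau>)" if "killed q t" "t < u" "candidate q t (take t \<tau>)" for t u \<tau>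
    using that unfolding candidate_iff by (auto simp: min_absorb1)
  then have "(\<Sum>t\<in>T. meas M (\<lambda>\<tau>. candidate q t (take t \<tau>))) =
      meas M (\<lambda>\<tau>. \<exists>t\<in>T. candidate q t (take t \<tau>))"
    using assms by (intro meas_UN_disjoint) (metis linorder_neqE_nat)+
  then show ?thesis by (simp add: meas_le_1)
qed

text \<open>The sets of candidates at the kills are disjoint and each has measure at least
  \<open>(1/2) ^ (lo q + q + 2)\<close>.\<close>

lemma card_killed_le:
  assumes "finite T" "\<And>t. t \<in> T \<Longrightarrow> killed q t"
  shows "card T \<le> 2 ^ (lo q + q + 2)"
proof -
  define M where "M = Max T"
  have M: "t \<le> M" if "t \<in> T" for t using assms(1) that by (simp add: M_def)
  have "real (card T) * (1/2) ^ (lo q + q + 2) = (\<Sum>t\<in>T. (1/2) ^ (lo q + q + 2))" by simp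
  also have "\<dots> \<le> (\<Sum>t\<in>T. meas M (\<lambda>\<tau>. candidate q t (take t \<tau>)))"
  proof (rule sum_mono)
    fix t assume t: "t \<in> T"
    show "(1/2) ^ (lo q + q + 2) \<le> meas M (\<lambda>\<tau>. candidate q t (take t \<tau>))"
      using meas_take[OF M[OF t], of "candidate q t"] assms(2)[OF t] by (simp add: killed_iff_meas)
  qed
  also have "\<dots> \<le> 1" by (rule sum_meas_killed_le_1) (use assms M in auto)
  finally have "real (card T) \<le> 2 ^ (lo q + q + 2)" by (simp add: power_divide field_simps)
  then show ?thesis by (metis of_nat_le_iff of_nat_numeral of_nat_power)
qed

lemma finite_killed: "finite {t. killed q t}"
proof (rule ccontr)
  assume "infinite {t. killed q t}"
  then obtain T where "T \<subseteq> {t. killed q t}" "finite T" "card T = Suc (2 ^ (lo q + q + 2))"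
    by (rule infinite_arbitrarily_large[THEN exE]) blast
  then show False using card_killed_le[of T q] by auto
qed

text \<open>Every change strictly increases a number below \<open>2 ^ n\<close>.\<close>

lemma card_changes_le: "card {t. t < M \<and> Omega_digits (Suc t) n \<noteq> Omega_digits t n} \<le> 2 ^ n"
proof -
  let ?C = "{t. t < M \<and> Omega_digits (Suc t) n \<noteq> Omega_digits t n}"
  have less: "Omega_digits t n < Omega_digits u n" if "t \<in> ?C" "t < u" for t u
  proof -
    have "Omega_digits t n < Omega_digits (Suc t) n"
      using that(1) Omega_digits_mono[of t "Suc t" n] by simp
    also have "\<dots> \<le> Omega_digits u n" using that(2) by (intro Omega_digits_mono) simp
    finally show ?thesis .
  qed
  have "inj_on (\<lambda>t. Omega_digits t n) ?C"
    by (rule inj_onI) (metis less less_irrefl linorder_neqE_nat)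
  then have "card ?C \<le> card {..<(2::nat) ^ n}"
    by (rule card_inj_on_le) (auto simp: Omega_digits_less)
  then show ?thesis by simp
qed

section \<open>The cost of the construction\<close>

text \<open>The pair \<open>z\<close> is a requirement with one of its killing stages. The strings
  look on the interval like the approximation just before that kill: these are the oracles that
  could mistake the dying life for the last one.\<close>

definition cost_test :: "nat \<Rightarrow> bool list set" where
  "cost_test n = {\<sigma>. \<exists>z. n \<le> fst z \<and> length \<sigma> = hi (fst z) \<and> killed (fst z) (snd z) \<and>
     (\<forall>j<hi (fst z). lo (fst z) \<le> j \<longrightarrow> lnth \<sigma> j = (j \<in> Omega_approx (snd z)))}"

lemma meas_interval:
  assumes "a \<le> m" "m \<le> M"
  shows "meas M (\<lambda>\<tau>. \<forall>j. a \<le> j \<and> j < m \<longrightarrow> \<tau> ! j = g j) = (1/2) ^ (m - a)"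
  using meas_independent[OF assms, of "\<lambda>_. True" g] by (simp add: meas_True)

lemma sum_half_tail: "(\<Sum>q\<in>{n..<m}. (1/2) ^ Suc q) \<le> (1/2::real) ^ n"
proof -
  have "n \<le> m \<Longrightarrow> (\<Sum>q\<in>{n..<m}. (1/2) ^ Suc q) = (1/2::real) ^ n - (1/2) ^ m"
    by (induction m) (auto simp: le_Suc_eq)
  then show ?thesis by (cases "n \<le> m") auto
qed

lemma MLtest_cost_test: "MLtest cost_test"
  unfolding MLtest_def
proof (intro conjI allI)
  show "unif_ce cost_test"
    unfolding cost_test_def[abs_def] by (rule unif_ceI) (rule comp_intros)+
  fix n
  show "open_measure (cost_test n) \<le> (1/2) ^ n"
  proof (rule open_measure_leI)
    fix F M assume F: "finite F" "F \<subseteq> cost_test n" "\<And>\<sigma>. \<sigma> \<in> F \<Longrightarrow> length \<sigma> \<le> M"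
    define I where "I = {q \<in> {n..<Suc M}. hi q \<le> M}"
    define B where "B q t \<tau> \<longleftrightarrow> (\<forall>j. lo q \<le> j \<and> j < hi q \<longrightarrow> \<tau> ! j = (j \<in> Omega_approx t))" for q t and \<tau> :: "bool list"
    have "meas M (\<lambda>\<tau>. \<exists>\<sigma>\<in>F. prefix \<sigma> \<tau>) \<le> meas M (\<lambda>\<tau>. \<exists>q\<in>I. \<exists>t\<in>{t. killed q t}. B q t \<tau>)"
    proof (rule meas_mono, elim bexE)
      fix \<tau> \<sigma> assume \<sigma>: "\<sigma> \<in> F" "prefix \<sigma> \<tau>"
      then obtain q t where z: "n \<le> q" "length \<sigma> = hi q" "killed q t"
        "\<And>j. j < hi q \<Longrightarrow> lo q \<le> j \<Longrightarrow> lnth \<sigma> j = (j \<in> Omega_approx t)"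
        using F(2) unfolding cost_test_def by auto
      have "hi q \<le> M" using F(3)[OF \<sigma>(1)] z(2) by simp
      moreover have "q \<le> hi q" using le_lo[of q] by (simp add: hi_def)
      ultimately have "q \<in> I" using z(1) by (auto simp: I_def)
      moreover have "B q t \<tau>"
        unfolding B_def
      proof (intro allI impI)
        fix j assume j: "lo q \<le> j \<and> j < hi q"
        then have "\<tau> ! j = \<sigma> ! j" using \<sigma>(2) z(2) by (auto simp: prefix_def nth_append)
        then show "\<tau> ! j = (j \<in> Omega_approx t)" using z(4)[of j] j z(2) by simp
      qed
      ultimately show "\<exists>q\<in>I. \<exists>t\<in>{t. killed q t}. B q t \<tau>" using z(3) by blast
    qed
    also have "\<dots> \<le> (\<Sum>q\<in>I. meas M (\<lambda>\<tau>. \<exists>t\<in>{t. killed q t}. B q t \<tau>))"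
      by (rule meas_UN_le) (simp add: I_def)
    also have "\<dots> \<le> (\<Sum>q\<in>I. (1/2) ^ Suc q)"
    proof (rule sum_mono)
      fix q assume q: "q \<in> I"
      have "meas M (\<lambda>\<tau>. \<exists>t\<in>{t. killed q t}. B q t \<tau>) \<le> (\<Sum>t\<in>{t. killed q t}. meas M (B q t))"
        by (rule meas_UN_le[OF finite_killed])
      also have "\<dots> = (\<Sum>t\<in>{t. killed q t}. (1/2) ^ (hi q - lo q))"
        unfolding B_def using q lo_less_hi[of q] by (intro sum.cong refl meas_interval) (auto simp: I_def)
      also have "\<dots> = real (card {t. killed q t}) * (1/2) ^ (hi q - lo q)" by simp
      also have "\<dots> \<le> 2 ^ (lo q + q + 2) * (1/2) ^ (hi q - lo q)"
        using card_killed_le[OF finite_killed, of q q] of_nat_mono[of "card {t. killed q t}" "2 ^ (lo q + q + 2)", where 'a = real]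
        by (intro mult_right_mono) auto
      also have "hi q - lo q = (lo q + q + 2) + Suc q" by (simp add: hi_def)
      also have "2 ^ (lo q + q + 2) * (1/2::real) ^ ((lo q + q + 2) + Suc q) = (1/2) ^ Suc q"
        unfolding power_add[of _ "lo q + q + 2"] by (simp add: power_divide)
      finally show "meas M (\<lambda>\<tau>. \<exists>t\<in>{t. killed q t}. B q t \<tau>) \<le> (1/2) ^ Suc q" .
    qed
    also have "\<dots> \<le> (\<Sum>q\<in>{n..<Suc M}. (1/2) ^ Suc q)" by (rule sum_mono2) (auto simp: I_def)
    also have "\<dots> \<le> (1/2) ^ n" by (rule sum_half_tail)
    finally show "meas M (\<lambda>\<tau>. \<exists>\<sigma>\<in>F. prefix \<sigma> \<tau>) \<le> (1/2) ^ n" .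
  qed
qed

text \<open>Once the interval shows its final bits, a later change can only come from positions
  below \<open>lo q\<close>. Randomness of \<open>Omega\<close> ensures that, with finitely many
  exceptions, no such change triggers a kill.\<close>

lemma almost_no_kill_at_limit:
  "\<exists>n. \<forall>q t. n \<le> q \<longrightarrow> killed q t \<longrightarrow> (\<exists>j. lo q \<le> j \<and> j < hi q \<and> (j \<in> Omega_approx t) \<noteq> (j \<in> Omega))"
proof -
  obtain n where n: "\<not> in_open Omega (cost_test n)"
    using MLrandom_Omega MLtest_cost_test unfolding MLrandom_def by blast
  have "\<exists>j. lo q \<le> j \<and> j < hi q \<and> (j \<in> Omega_approx t) \<noteq> (j \<in> Omega)" if "n \<le> q" "killed q t" for q t
  proof (rule ccontr)
    assume "\<not> ?thesis"
    with that have "restr Omega (hi q) \<in> cost_test n"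
      unfolding cost_test_def mem_Collect_eq by (intro exI[of _ "(q, t)"]) auto
    with n show False unfolding in_open_def by force
  qed
  then show ?thesis by blast
qed

section \<open>The test for a requirement\<close>

text \<open>A string is judged at the stage given by its length. Its bits in the interval, which
  \<open>good\<close> cannot see, must match the approximation of that stage.\<close>

definition req_test :: "nat \<Rightarrow> bool list set" where
  "req_test q = {\<sigma>. hi q \<le> length \<sigma> \<and> candidate q (length \<sigma>) \<sigma> \<and>
     (\<forall>j<hi q. lo q \<le> j \<longrightarrow> lnth \<sigma> j = (j \<in> Omega_approx (length \<sigma>)))}"

text \<open>Supplies the premise \<open>inv\<close> of \<open>meas_independent\<close>:
  \<open>good\<close> reads an oracle through its kept positions only, and the interval of
  \<open>q\<close> is not among them.\<close>

lemma candidate_update: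
  assumes "lo q \<le> j" "j < hi q"
  shows "candidate q t (take t (\<tau>[j := b])) = candidate q t (take t \<tau>)"
proof -
  have "j \<notin> kept (idx q)" using assms not_in_kept_iff by blast
  have nths: "nths (\<rho>[j := b]) (kept (idx q)) = nths \<rho> (kept (idx q))" for \<rho>
    unfolding nths_eq_map
  proof (rule map_cong)
    fix x assume "x \<in> set (filter (\<lambda>j. j \<in> kept (idx q)) [0..<length \<rho>])"
    then have "j \<noteq> x" using \<open>j \<notin> kept (idx q)\<close> by auto
    then show "\<rho>[j := b] ! x = \<rho> ! x" by simp
  qed simp
  have "good q s u (\<rho>[j := b]) = good q s u \<rho>" for s u \<rho>
    unfolding good_def nths ..
  then show ?thesis unfolding candidate_iff by (simp add: take_update_swap)
qed

text \<open>Goodness persists and no kill falls inside a life, so candidates survive to its end.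
  Each life thus needs to be measured only once.\<close>

lemma candidate_end_of_life:
  assumes "candidate q t (take t \<tau>)" "t \<le> u" "Omega_digits u (hi q) = Omega_digits t (hi q)"
  shows "candidate q u (take u \<tau>)"
proof -
  have start: "start q u = start q t" using assms(3) by (rule start_cong)
  have no_kill: "\<not> killed q v" if "t \<le> v" "v < u" for v
  proof
    assume "killed q v"
    moreover have "Omega_digits v (hi q) = Omega_digits u (hi q)" "Omega_digits (Suc v) (hi q) = Omega_digits u (hi q)"
      using that by (intro Omega_digits_eq_between[OF assms(3)[symmetric]]; simp)+
    ultimately show False using killed_hi[of q v] by simp
  qed
  have "prefix (take t \<tau>) (take u \<tau>)" using assms(2) by (metis min_absorb1 take_is_prefix take_take)
  then have "good q (start q u) u (take u \<tau>)"
    unfolding start using assms(1,2) by (auto simp: candidate_iff intro: good_mono)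
  moreover have "\<not> good q (start q v) v (take v (take u \<tau>))" if "v < u" "killed q v" for v
  proof -
    have "v < t" using no_kill[of v] that by (cases "t \<le> v") auto
    with assms(1) that have "\<not> good q (start q v) v (take v (take t \<tau>))" unfolding candidate_iff by blast
    with \<open>v < t\<close> that(1) show ?thesis by (simp add: min_absorb1)
  qed
  ultimately show ?thesis unfolding candidate_iff by blast
qed

text \<open>The oracles in the test guess the bits of \<open>Omega\<close> in the interval of \<open>q\<close>, which they do not see. The killed
  lives have disjoint sets of candidates, the sets of candidates of the other completed lives are small, and
  the guess multiplies all these measures by \<open>2\<close> to the power \<open>lo q - hi q\<close>.\<close>

lemma open_measure_req_test: "open_measure (req_test q) \<le> (1/2) ^ q"
proof (rule open_measure_leI)
  fix F M assume F: "finite F" "F \<subseteq> req_test q" "\<And>\<sigma>. \<sigma> \<in> F \<Longrightarrow> length \<sigma> \<le> M"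
  show "meas M (\<lambda>\<tau>. \<exists>\<sigma>\<in>F. prefix \<sigma> \<tau>) \<le> (1/2) ^ q"
  proof (cases "hi q \<le> M")
    case False
    have "F = {}" using F False unfolding req_test_def by force
    then show ?thesis by (simp add: meas_def)
  next
    case True
    let ?\<delta> = "(1/2::real) ^ (lo q + q + 2)"
    define C where "C e \<tau> \<longleftrightarrow> candidate q e (take e \<tau>)" for e \<tau>
    define B where "B e \<tau> \<longleftrightarrow> C e \<tau> \<and> (\<forall>j. lo q \<le> j \<and> j < hi q \<longrightarrow> \<tau> ! j = (j \<in> Omega_approx e))" for e \<tau>
    \<comment> \<open>\<open>L1\<close> holds the ends of killed lives and \<open>L2\<close> the
      ends of lives with few candidates; the extra element \<open>M\<close> of \<open>L\<close>
      stands for the life still running at \<open>M\<close>.\<close>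
    define L1 where "L1 = {e. e < M \<and> killed q e}"
    define L2 where "L2 = {e. e < M \<and> Omega_digits (Suc e) (hi q) \<noteq> Omega_digits e (hi q) \<and> meas M (C e) \<le> ?\<delta>}"
    define L where "L = L1 \<union> L2 \<union> {M}"
    have fin: "finite L1" "finite L2" by (simp_all add: L1_def L2_def)
    have meas_B: "meas M (B e) = (1/2) ^ (hi q - lo q) * meas M (C e)" for e
      unfolding B_def
      by (rule meas_independent) (use lo_less_hi[of q] True in \<open>auto simp: C_def candidate_update\<close>)
    have "meas M (\<lambda>\<tau>. \<exists>\<sigma>\<in>F. prefix \<sigma> \<tau>) \<le> meas M (\<lambda>\<tau>. \<exists>e\<in>L. B e \<tau>)"
    proof (rule meas_mono, elim bexE)
      fix \<tau> \<sigma> assume \<tau>: "length \<tau> = M" and \<sigma>: "\<sigma> \<in> F" "prefix \<sigma> \<tau>"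
      define t where "t = length \<sigma>"
      have \<sigma>_eq: "\<sigma> = take t \<tau>" using \<sigma>(2) by (simp add: t_def prefix_iff_take)
      have t: "hi q \<le> t" "candidate q t (take t \<tau>)" "\<And>j. j < hi q \<Longrightarrow> lo q \<le> j \<Longrightarrow> lnth \<sigma> j = (j \<in> Omega_approx t)" "t \<le> M"
        using \<sigma> F(2,3) unfolding req_test_def t_def[symmetric] \<sigma>_eq[symmetric] by (auto simp: t_def)
      define E where "E = {e. e \<le> M \<and> Omega_digits e (hi q) = Omega_digits t (hi q)}"
      have "finite E" "t \<in> E" using t(4) by (auto simp: E_def)
      \<comment> \<open>The end of the life of \<open>t\<close>, or \<open>M\<close> if that life
        outlasts \<open>M\<close>.\<close>
      define e where "e = Max E"
      have "e \<in> E" unfolding e_def using \<open>finite E\<close> \<open>t \<in> E\<close> by (intro Max_in) auto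
      have "t \<le> e" unfolding e_def using \<open>finite E\<close> \<open>t \<in> E\<close> by simp
      have eM: "e \<le> M" and digits: "Omega_digits e (hi q) = Omega_digits t (hi q)" using \<open>e \<in> E\<close> by (auto simp: E_def)
      have Suc_e: "Omega_digits (Suc e) (hi q) \<noteq> Omega_digits e (hi q)" if "e < M"
      proof
        assume "Omega_digits (Suc e) (hi q) = Omega_digits e (hi q)"
        with that digits have "Suc e \<in> E" by (simp add: E_def)
        then have "Suc e \<le> e" unfolding e_def using \<open>finite E\<close> by simp
        then show False by simp
      qed
      have meas_C: "meas M (C e) = meas e (candidate q e)"
        unfolding C_def using meas_take[OF eM, of "candidate q e"] .
      have "e \<in> L"
        using eM Suc_e meas_C unfolding L_def L1_def L2_def killed_iff_meas by (cases "e = M") auto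
      moreover have "B e \<tau>"
        unfolding B_def
      proof (intro conjI allI impI)
        show "C e \<tau>" unfolding C_def using candidate_end_of_life[OF t(2) \<open>t \<le> e\<close> digits] .
        fix j assume j: "lo q \<le> j \<and> j < hi q"
        have "\<tau> ! j = \<sigma> ! j" unfolding \<sigma>_eq using j t(1) by simp
        also have "\<sigma> ! j = (j \<in> Omega_approx t)" using t(1) t(3)[of j] j by (simp add: t_def)
        also have "\<dots> = (j \<in> Omega_approx e)"
          using digits j restr_Omega_approx_eq_iff[of e "hi q" t] by (simp add: restr_eq_iff)
        finally show "\<tau> ! j = (j \<in> Omega_approx e)" .
      qed
      ultimately show "\<exists>e\<in>L. B e \<tau>" by blast
    qed
    also have "\<dots> \<le> (\<Sum>e\<in>L. meas M (B e))" by (rule meas_UN_le) (simp add: L_def fin)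
    also have "\<dots> = (1/2) ^ (hi q - lo q) * (\<Sum>e\<in>L. meas M (C e))" by (simp add: meas_B sum_distrib_left)
    also have "\<dots> \<le> (1/2) ^ (hi q - lo q) * (1 + 2 ^ hi q * ?\<delta> + 1)"
    proof (rule mult_left_mono)
      have un: "sum f (S \<union> T) \<le> sum f S + sum f T" if "finite S" "finite T" "\<And>e. 0 \<le> f e" for f :: "nat \<Rightarrow> real" and S T
        using sum.union_inter[OF that(1,2), of f] sum_nonneg[of "S \<inter> T" f, OF that(3)] by linarith
      have "(\<Sum>e\<in>L1. meas M (C e)) \<le> 1"
        unfolding C_def by (rule sum_meas_killed_le_1) (auto simp: L1_def)
      moreover have "(\<Sum>e\<in>L2. meas M (C e)) \<le> (\<Sum>e\<in>L2. ?\<delta>)" by (rule sum_mono) (simp add: L2_def)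
      moreover have "(\<Sum>e\<in>L2. ?\<delta>) \<le> 2 ^ hi q * ?\<delta>"
      proof -
        have "card L2 \<le> card {t. t < M \<and> Omega_digits (Suc t) (hi q) \<noteq> Omega_digits t (hi q)}"
          by (rule card_mono) (auto simp: L2_def)
        also have "\<dots> \<le> 2 ^ hi q" by (rule card_changes_le)
        finally have "real (card L2) \<le> 2 ^ hi q" using of_nat_mono[of "card L2" "2 ^ hi q", where 'a = real] by simp
        then show ?thesis by (simp add: mult_right_mono)
      qed
      moreover have "(\<Sum>e\<in>{M}. meas M (C e)) \<le> 1" by (simp add: meas_le_1)
      moreover have "(\<Sum>e\<in>L. meas M (C e)) \<le> (\<Sum>e\<in>L1. meas M (C e)) +
          (\<Sum>e\<in>L2. meas M (C e)) + (\<Sum>e\<in>{M}. meas M (C e))"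
        unfolding L_def using fin un[of "L1 \<union> L2" "{M}" "\<lambda>e. meas M (C e)"]
          un[of L1 L2 "\<lambda>e. meas M (C e)"] by simp
      ultimately show "(\<Sum>e\<in>L. meas M (C e)) \<le> 1 + 2 ^ hi q * ?\<delta> + 1" by linarith
    qed simp
    also have "\<dots> \<le> (1/2) ^ q"
    proof -
      have hl: "hi q - lo q = lo q + (2 * q + 3)" and h: "hi q = (hi q - lo q) + lo q" by (simp_all add: hi_def)
      \<comment> \<open>The \<open>2 ^ hi q\<close> possible lives cancel against the guess of
        \<open>hi q - lo q\<close> bits; the remaining \<open>2 ^ lo q\<close> is absorbed by the
        threshold.\<close>
      have "(1/2::real) ^ (hi q - lo q) * (2 ^ hi q * ?\<delta>) = (1/2) ^ (q + 2)"
      proof -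
        have "(2::real) ^ hi q = 2 ^ (hi q - lo q) * 2 ^ lo q" by (subst h, rule power_add)
        moreover have "?\<delta> = (1/2) ^ lo q * (1/2) ^ (q + 2)" unfolding power_add[symmetric] by (simp add: add.assoc)
        ultimately show ?thesis by (simp add: power_divide)
      qed
      moreover have "(1/2::real) ^ (hi q - lo q) \<le> (1/2) ^ (q + 3)" by (rule power_decreasing) (simp_all add: hl)
      moreover have "(1/2::real) ^ (q + 3) = (1/2) ^ q / 8" "(1/2::real) ^ (q + 2) = (1/2) ^ q / 4"
        by (simp_all add: power_add power_divide)
      moreover have "0 \<le> (1/2::real) ^ q" by simp
      ultimately show ?thesis unfolding distrib_left mult_1_right by linarith
    qed
    finally show ?thesis .
  qed
qed

section \<open>The constructed sets\<close>

definition witnesses :: "nat set \<Rightarrow> nat set" where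
  "witnesses D = {z. idx (fst (prod_decode z)) \<in> D \<and>
     (\<exists>t. killed (fst (prod_decode z)) t \<and> start (fst (prod_decode z)) t = snd (prod_decode z))}"

definition witnesses_stage :: "nat set \<Rightarrow> nat \<Rightarrow> nat set" where
  "witnesses_stage D u = {z. idx (fst (prod_decode z)) \<in> D \<and>
     (\<exists>t<u. killed (fst (prod_decode z)) t \<and> start (fst (prod_decode z)) t = snd (prod_decode z))}"

lemma W_stage_mono: "u \<le> v \<Longrightarrow> witnesses_stage D u \<subseteq> witnesses_stage D v"
  unfolding witnesses_stage_def by (auto intro: order_less_le_trans)

lemma witnesses_eq_UN: "witnesses D = (\<Union>u. witnesses_stage D u)"
  unfolding witnesses_def witnesses_stage_def by auto

lemma computable_witnesses_stage:
  assumes D: "computable A (\<lambda>i. i \<in> D)" and "computable A f" "computable A g"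
  shows "computable A (\<lambda>x. f x \<in> witnesses_stage D (g x))"
  unfolding witnesses_stage_def mem_Collect_eq
  by (rule comp_intros assms(2-)[THEN computable_comp] D[THEN computable_comp] assms(2-))+

lemma restr_witnesses_limit: "\<exists>u. restr (witnesses_stage D u) n = restr (witnesses D) n"
proof -
  have "\<exists>u. \<forall>z<n. z \<in> witnesses D \<longrightarrow> z \<in> witnesses_stage D u"
  proof (induction n)
    case (Suc n)
    then obtain u where u: "\<And>z. z < n \<Longrightarrow> z \<in> witnesses D \<Longrightarrow> z \<in> witnesses_stage D u" by blast
    obtain v where v: "n \<in> witnesses D \<Longrightarrow> n \<in> witnesses_stage D v" unfolding witnesses_eq_UN by blast
    have "z \<in> witnesses_stage D (max u v)" if "z < Suc n" "z \<in> witnesses D" for z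
      using that u[of z] v W_stage_mono[of u "max u v" D] W_stage_mono[of v "max u v" D]
      by (cases "z = n") auto
    then show ?case by blast
  qed simp
  then show ?thesis unfolding restr_eq_iff witnesses_eq_UN by blast
qed

text \<open>Requirement \<open>q\<close> has at most \<open>2 ^ (lo q + q + 2)\<close> kills, and
  \<open>hi q\<close> exceeds this exponent by \<open>lo q + Suc q\<close>.\<close>

lemma sum_cost_le_1:
  assumes "finite J" "\<And>k. k \<in> J \<Longrightarrow> killed (fst k) (snd k)"
  shows "(\<Sum>k\<in>J. (1/2) ^ hi (fst k)) \<le> (1::real)"
proof (rule sum_group_le[OF assms(1), where e = fst])
  fix q
  let ?J = "{k \<in> J. fst k = q}"
  have "card ?J = card (snd ` ?J)"
    by (rule card_image[symmetric]) (auto intro!: inj_onI simp: prod_eq_iff)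
  also have "\<dots> \<le> 2 ^ (lo q + q + 2)"
    by (rule card_killed_le) (use assms in auto)
  finally have card: "real (card ?J) \<le> 2 ^ (lo q + q + 2)"
    using of_nat_mono[of "card ?J" "2 ^ (lo q + q + 2)", where 'a = real] by simp
  have "(\<Sum>k\<in>?J. (1/2) ^ hi (fst k)) = real (card ?J) * (1/2::real) ^ hi q" by simp
  also have "\<dots> \<le> 2 ^ (lo q + q + 2) * (1/2) ^ hi q" by (rule mult_right_mono[OF card]) simp
  also have "hi q = (lo q + q + 2) + (lo q + Suc q)" by (simp add: hi_def)
  also have "2 ^ (lo q + q + 2) * (1/2::real) ^ \<dots> = (1/2) ^ (lo q + Suc q)"
    unfolding power_add[of _ "lo q + q + 2"] by (simp add: power_divide)
  also have "\<dots> \<le> (1/2) ^ Suc q" by (rule power_decreasing) auto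
  finally show "(\<Sum>k\<in>?J. (1/2) ^ hi (fst k)) \<le> (1/2::real) ^ Suc q" .
qed

text \<open>While the first \<open>n\<close> digits stand still, \<open>Omega_stage\<close> grows by
  at most \<open>(1/2) ^ n\<close>; the factor 2 undoes the halving in its definition.\<close>

lemma dom_stage_diff_weight:
  assumes "s \<le> t" "Omega_digits s n = Omega_digits t n"
  shows "(\<Sum>p\<in>dom_stage t - dom_stage s. (1/2) ^ length p) \<le> 2 * (1/2::real) ^ n"
proof -
  have "(\<Sum>p\<in>dom_stage t - dom_stage s. (1/2) ^ length p) = 2 * (\<Sum>p\<in>dom_stage t - dom_stage s. (1/2::real) ^ Suc (length p))"
    unfolding sum_distrib_left by simp
  also have "\<dots> = 2 * (Omega_stage t - Omega_stage s)"
    unfolding Omega_stage_def by (subst sum_diff) (simp_all add: dom_stage_mono[OF assms(1)])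
  also have "\<dots> \<le> 2 * (1/2) ^ n" using Omega_stage_diff[OF assms(2)] by simp
  finally show ?thesis .
qed

text \<open>A description of \<open>n\<close> found at a stage \<open>s > n\<close> is turned into descriptions of the first \<open>n\<close> bits of the
  set. They must be redone when a witness below \<open>n\<close> enters; its life began before stage \<open>n\<close>, so only
  descriptions found during that life are affected.\<close>

theorem K_trivial_witnesses:
  assumes D: "computable {} (\<lambda>i. i \<in> D)"
  shows "K_trivial (witnesses D)"
proof -
  \<comment> \<open>A request is a triple \<open>(p, n, s)\<close>. Stage 0 causes no trouble with
    \<open>s - 1\<close>, since \<open>U_stage 0\<close> never holds.\<close>
  define fresh where "fresh x \<longleftrightarrow> \<not> U_stage (snd (snd x) - 1) (fst x) (fst (snd x))" for x :: "bool list \<times> nat \<times> nat"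
  define Q where "Q x \<longleftrightarrow> U_stage (snd (snd x)) (fst x) (fst (snd x)) \<and>
      (fresh x \<or> restr (witnesses_stage D (snd (snd x))) (fst (snd x)) \<noteq> restr (witnesses_stage D (snd (snd x) - 1)) (fst (snd x)))"
    for x :: "bool list \<times> nat \<times> nat"
  have comp_restr: "computable {} (\<lambda>x. restr (witnesses_stage D (f x)) (g x))" if "computable {} f" "computable {} g"
    for f g :: "bool list \<times> nat \<times> nat \<Rightarrow> nat"
    unfolding restr_def by (rule comp_intros computable_witnesses_stage[OF D] that[THEN computable_comp] that)+
  have "\<exists>c. \<forall>x. Q x \<longrightarrow> (\<exists>p. machine U p (restr (witnesses_stage D (snd (snd x))) (fst (snd x))) \<and>
      length p \<le> (length (fst x) + 2) + c)"
  proof (rule Kraft_Chaitin_U)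
    show "computable {} Q"
      unfolding Q_def[abs_def] fresh_def by (rule comp_intros comp_restr)+
    show "computable {} (\<lambda>x :: bool list \<times> nat \<times> nat. restr (witnesses_stage D (snd (snd x))) (fst (snd x)))"
      by (rule comp_intros comp_restr)+
    show "computable {} (\<lambda>x :: bool list \<times> nat \<times> nat. length (fst x) + 2)" by (rule comp_intros)+
    fix F assume F: "finite F" "\<And>x. x \<in> F \<Longrightarrow> Q x"
    \<comment> \<open>Fresh requests will weigh at most 1 and repetitions at most 2; the two extra
      bits of each request bring the sum below 1.\<close>
    define F1 where "F1 = {x \<in> F. fresh x}"
    define F2 where "F2 = {x \<in> F. \<not> fresh x}"
    have dom: "fst x \<in> dom_stage (snd (snd x))" if "x \<in> F" for x
      using F(2)[OF that] unfolding Q_def dom_stage_def by blast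
    have same_n: "fst (snd x) = fst (snd y)" if "x \<in> F" "y \<in> F" "fst x = fst y" for x y
      using F(2)[OF that(1)] F(2)[OF that(2)] that(3) U_stage_unique unfolding Q_def by metis
    have "(\<Sum>x\<in>F1. (1/2) ^ length (fst x)) \<le> (1::real)"
    proof -
      have "snd (snd x) \<le> snd (snd y)" if "x \<in> F1" "y \<in> F1" "fst x = fst y" for x y
      proof (rule ccontr)
        assume "\<not> ?thesis"
        then have "snd (snd y) \<le> snd (snd x) - 1" by simp
        moreover have "U_stage (snd (snd y)) (fst x) (fst (snd x))"
          using F(2)[of y] that same_n[of x y] unfolding F1_def Q_def by auto
        ultimately have "\<not> fresh x" unfolding fresh_def using U_stage_mono by blast
        then show False using that(1) by (simp add: F1_def)
      qed
      then have inj: "inj_on fst F1"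
        using same_n by (intro inj_onI) (auto simp: prod_eq_iff F1_def intro: antisym)
      have "(\<Sum>x\<in>F1. (1/2) ^ length (fst x)) = (\<Sum>p\<in>fst ` F1. (1/2::real) ^ length p)"
        unfolding sum.reindex[OF inj] by simp
      also have "\<dots> \<le> 1"
      proof (rule Kraft)
        fix p q assume "p \<in> fst ` F1" "q \<in> fst ` F1" "prefix p q"
        moreover from this obtain x y where "x \<in> F" "y \<in> F" "p = fst x" "q = fst y" by (auto simp: F1_def)
        ultimately show "p = q" using dom_stage_prefix_free[OF dom[of x] dom[of y]] by simp
      qed (use F(1) in \<open>simp add: F1_def\<close>)
      finally show ?thesis .
    qed
    moreover have "(\<Sum>x\<in>F2. (1/2) ^ length (fst x)) \<le> (2::real)"
    proof -
      \<comment> \<open>Each repetition is charged to the kill that caused it, and that kill pays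
        for the descriptions found during its life.\<close>
      have "\<exists>k. killed (fst k) (snd k) \<and> snd (snd x) = Suc (snd k) \<and>
          fst x \<in> dom_stage (snd k) - dom_stage (start (fst k) (snd k))" if "x \<in> F2" for x
      proof -
        obtain p n s where x: "x = (p, n, s)" by (cases x)
        have Qx: "U_stage (s - 1) p n" "restr (witnesses_stage D s) n \<noteq> restr (witnesses_stage D (s - 1)) n"
          using that F(2)[of x] unfolding F2_def Q_def fresh_def x by auto
        then obtain z where z: "z < n" "(z \<in> witnesses_stage D s) \<noteq> (z \<in> witnesses_stage D (s - 1))"
          unfolding restr_eq_iff by blast
        with W_stage_mono[of "s - 1" s D] have z': "z \<in> witnesses_stage D s" "z \<notin> witnesses_stage D (s - 1)" by auto
        define q where "q = fst (prod_decode z)"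
        from z'(1) obtain t where t: "t < s" "killed q t" "start q t = snd (prod_decode z)"
          unfolding witnesses_stage_def q_def by blast
        with z' have "\<not> t < s - 1" unfolding witnesses_stage_def q_def by blast
        with t(1) have s: "s = Suc t" by simp
        have "z = prod_encode (q, start q t)" unfolding t(3) unfolding q_def by simp
        then have "start q t \<le> z" using le_prod_encode_2 by simp
        with z(1) have "start q t < n" by simp
        have "p \<notin> dom_stage (start q t)"
        proof
          assume "p \<in> dom_stage (start q t)"
          then obtain m where m: "U_stage (start q t) p m" unfolding dom_stage_def by blast
          then have "m = n" using Qx(1) U_stage_unique by blast
          with m \<open>start q t < n\<close> show False by (simp add: U_stage_def)
        qed
        moreover have "p \<in> dom_stage t" using Qx(1) s unfolding dom_stage_def by auto
        ultimately show ?thesis using t(2) s x by (intro exI[of _ "(q, t)"]) simp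
      qed
      then obtain k where k: "\<And>x. x \<in> F2 \<Longrightarrow> killed (fst (k x)) (snd (k x)) \<and> snd (snd x) = Suc (snd (k x)) \<and>
          fst x \<in> dom_stage (snd (k x)) - dom_stage (start (fst (k x)) (snd (k x)))" by metis
      have fin: "finite (k ` F2)" using F(1) by (simp add: F2_def)
      let ?S = "SIGMA j:k ` F2. dom_stage (snd j) - dom_stage (start (fst j) (snd j))"
      have inj: "inj_on (\<lambda>x. (k x, fst x)) F2"
      proof (rule inj_onI)
        fix x y assume xy: "x \<in> F2" "y \<in> F2" "(k x, fst x) = (k y, fst y)"
        then have "snd (snd x) = snd (snd y)" using k[of x] k[of y] by simp
        with xy same_n[of x y] show "x = y" by (simp add: prod_eq_iff F2_def)
      qed
      have "(\<Sum>x\<in>F2. (1/2) ^ length (fst x)) = (\<Sum>y\<in>(\<lambda>x. (k x, fst x)) ` F2. (1/2::real) ^ length (snd y))"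
        unfolding sum.reindex[OF inj] by simp
      also have "\<dots> \<le> (\<Sum>y\<in>?S. (1/2) ^ length (snd y))"
        using fin k by (intro sum_mono2) auto
      also have "\<dots> = (\<Sum>j\<in>k ` F2. \<Sum>p\<in>dom_stage (snd j) - dom_stage (start (fst j) (snd j)). (1/2) ^ length p)"
        using fin by (subst sum.Sigma) (auto simp: case_prod_unfold)
      also have "\<dots> \<le> (\<Sum>j\<in>k ` F2. 2 * (1/2) ^ hi (fst j))"
        by (intro sum_mono dom_stage_diff_weight start_le start_digits)
      also have "\<dots> = 2 * (\<Sum>j\<in>k ` F2. (1/2) ^ hi (fst j))" by (simp add: sum_distrib_left)
      also have "\<dots> \<le> 2 * 1"
      proof (intro mult_left_mono sum_cost_le_1[OF fin])
        show "killed (fst j) (snd j)" if "j \<in> k ` F2" for j using that k by blast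
      qed simp
      finally show ?thesis by simp
    qed
    moreover have "F = F1 \<union> F2" "F1 \<inter> F2 = {}" "finite F1" "finite F2"
      using F(1) by (auto simp: F1_def F2_def)
    then have "(\<Sum>x\<in>F. (1/2) ^ length (fst x)) =
        (\<Sum>x\<in>F1. (1/2) ^ length (fst x)) + (\<Sum>x\<in>F2. (1/2::real) ^ length (fst x))"
      using sum.union_disjoint by metis
    ultimately have "(\<Sum>x\<in>F. (1/2) ^ length (fst x)) \<le> (3::real)" by linarith
    moreover have "(\<Sum>x\<in>F. (1/2) ^ (length (fst x) + 2)) = (\<Sum>x\<in>F. (1/2::real) ^ length (fst x)) / 4"
      unfolding sum_divide_distrib by (intro sum.cong) (auto simp: power_add power_divide)
    ultimately show "(\<Sum>x\<in>F. (1/2) ^ (length (fst x) + 2)) \<le> (1::real)" by linarith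
  qed
  then obtain c where c: "\<And>x. Q x \<Longrightarrow> \<exists>p. machine U p (restr (witnesses_stage D (snd (snd x))) (fst (snd x))) \<and>
      length p \<le> (length (fst x) + 2) + c" by blast
  have "K (restr (witnesses D) n) \<le> K (nat_str n) + (c + 2)" for n
  proof -
    obtain p where p: "machine U p (nat_str n)" "length p = K (nat_str n)" using K_attained by blast
    obtain s1 where s1: "U_stage s1 p n" using machine_U_stage[OF p(1)] by blast
    obtain u where u: "restr (witnesses_stage D u) n = restr (witnesses D) n" using restr_witnesses_limit by blast
    \<comment> \<open>At the first stage where the description is present and the restriction is
      final, one of the two has only just become so; hence a request is made there.\<close>
    define G where "G s \<longleftrightarrow> U_stage s p n \<and> restr (witnesses_stage D s) n = restr (witnesses D) n" for s
    have "restr (witnesses_stage D (max s1 u)) n = restr (witnesses D) n"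
      using u W_stage_mono[of u "max s1 u" D] witnesses_eq_UN[of D] unfolding restr_eq_iff by auto
    then have "G (max s1 u)" unfolding G_def using U_stage_mono[OF s1, of "max s1 u"] by simp
    then obtain s where s: "G s" "\<And>t. t < s \<Longrightarrow> \<not> G t" using exists_least_iff[of G] by blast
    have "s > 0" using s(1) by (auto simp: G_def U_stage_def)
    then have "\<not> G (s - 1)" using s(2) by simp
    then have "Q (p, n, s)" using s(1) unfolding Q_def fresh_def G_def by auto
    from c[OF this] s(1) obtain p' where "machine U p' (restr (witnesses D) n)" "length p' \<le> length p + 2 + c"
      unfolding G_def by auto
    then show ?thesis using K_le[of p' "restr (witnesses D) n"] p(2) by simp
  qed
  then show ?thesis unfolding K_trivial_def by blast
qed

lemma finite_witnesses_below: "finite {z \<in> witnesses D. fst (prod_decode z) < n}"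
proof (rule finite_subset)
  show "{z \<in> witnesses D. fst (prod_decode z) < n} \<subseteq> (\<Union>q<n. (\<lambda>t. prod_encode (q, start q t)) ` {t. killed q t})"
  proof
    fix z assume "z \<in> {z \<in> witnesses D. fst (prod_decode z) < n}"
    then obtain t where t: "fst (prod_decode z) < n" "killed (fst (prod_decode z)) t"
        "start (fst (prod_decode z)) t = snd (prod_decode z)"
      unfolding witnesses_def by blast
    have "z = prod_encode (fst (prod_decode z), start (fst (prod_decode z)) t)" unfolding t(3) by simp
    with t show "z \<in> (\<Union>q<n. (\<lambda>t. prod_encode (q, start q t)) ` {t. killed q t})" by blast
  qed
qed (use finite_killed in auto)

theorem witnesses_turing_le_gapped:
  assumes D: "computable (gapped i) (\<lambda>i. i \<in> D)" and i: "i \<notin> D"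
  shows "turing_le (witnesses D) (gapped i)"
proof -
  obtain n where n: "\<And>q t. n \<le> q \<Longrightarrow> killed q t \<Longrightarrow> \<exists>j. lo q \<le> j \<and> j < hi q \<and> (j \<in> Omega_approx t) \<noteq> (j \<in> Omega)"
    using almost_no_kill_at_limit by blast
  obtain l where l: "set l = {z \<in> witnesses D. fst (prod_decode z) < n}"
    using finite_list[OF finite_witnesses_below] by blast
  \<comment> \<open>\<open>z \<le> s\<close> puts \<open>s\<close> after the start of the life named
    by \<open>z\<close>. If the interval belongs to \<open>i\<close> nothing can be checked, but
    then \<open>z\<close> is outside the set because \<open>i \<notin> D\<close>.\<close>
  define ok where "ok z s \<longleftrightarrow> z \<le> s \<and> (idx (fst (prod_decode z)) = i \<or>
      (\<forall>j<hi (fst (prod_decode z)). lo (fst (prod_decode z)) \<le> j \<longrightarrow> (j \<in> Omega_approx s) = (rank i j \<in> gapped i)))" for z s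
  have ok_ex: "\<exists>s. ok z s" for z
  proof -
    define q where "q = fst (prod_decode z)"
    obtain s0 where s0: "\<And>s. s \<ge> s0 \<Longrightarrow> restr (Omega_approx s) (hi q) = restr Omega (hi q)" using restr_Omega_limit by blast
    have "j \<in> Omega_approx (max z s0) \<longleftrightarrow> rank i j \<in> gapped i" if "idx q \<noteq> i" "lo q \<le> j" "j < hi q" for j
      using s0[of "max z s0"] that interval_in_kept[OF that] by (simp add: restr_eq_iff rank_in_gapped_iff)
    then show ?thesis unfolding ok_def q_def[symmetric] by (intro exI[of _ "max z s0"]) auto
  qed
  define d where "d z \<longleftrightarrow> (if fst (prod_decode z) < n then z \<in> set l else z \<in> witnesses_stage D (LEAST s. ok z s))" for z
  have comp_ok: "computable (gapped i) (\<lambda>p. ok (fst p) (snd p))"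
    unfolding ok_def by (rule comp_intros)+
  have "computable (gapped i) d"
    unfolding d_def[abs_def] by (rule comp_intros computable_witnesses_stage[OF D] computable_Least[OF ok_ex] computable_comp2[OF comp_ok])+
  moreover have "d z \<longleftrightarrow> z \<in> witnesses D" for z
  proof (cases "fst (prod_decode z) < n")
    case True
    then show ?thesis by (simp add: d_def l)
  next
    case False
    define q where "q = fst (prod_decode z)"
    define s where "s = (LEAST s. ok z s)"
    have ok: "ok z s" unfolding s_def using ok_ex by (rule LeastI_ex)
    have "z \<in> witnesses_stage D s" if "z \<in> witnesses D"
    proof -
      from that obtain t where t: "idx q \<in> D" "killed q t" "start q t = snd (prod_decode z)"
        unfolding witnesses_def q_def by blast
      \<comment> \<open>A kill at \<open>t \<ge> s\<close> would end a life that contains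
        \<open>s\<close>, so the interval would show its final bits at the kill, against the choice
        of \<open>n\<close>.\<close>
      have "t < s"
      proof (rule ccontr)
        assume "\<not> t < s"
        have "z = prod_encode (q, start q t)" unfolding t(3) unfolding q_def by simp
        then have "start q t \<le> s" using le_prod_encode_2[of "start q t" q] ok by (simp add: ok_def)
        then have digits: "Omega_digits s (hi q) = Omega_digits t (hi q)"
          by (rule Omega_digits_eq_between[OF start_digits[of q t]]) (use \<open>\<not> t < s\<close> in simp)
        have "idx q \<noteq> i" using t(1) i by blast
        have "(j \<in> Omega_approx t) = (j \<in> Omega)" if "lo q \<le> j" "j < hi q" for j
        proof -
          have "(j \<in> Omega_approx t) = (j \<in> Omega_approx s)"
            using digits that restr_Omega_approx_eq_iff[of s "hi q" t] by (simp add: restr_eq_iff)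
          also have "\<dots> = (rank i j \<in> gapped i)"
            using ok \<open>idx q \<noteq> i\<close> that unfolding ok_def q_def by simp
          also have "\<dots> = (j \<in> Omega)" using rank_in_gapped_iff interval_in_kept[OF \<open>idx q \<noteq> i\<close> that] by simp
          finally show ?thesis .
        qed
        with n[OF _ t(2)] False show False unfolding q_def by fastforce
      qed
      with t show ?thesis unfolding witnesses_stage_def q_def by blast
    qed
    moreover have "z \<in> witnesses D" if "z \<in> witnesses_stage D s" using that unfolding witnesses_eq_UN by blast
    ultimately show ?thesis using False unfolding d_def s_def[symmetric] by auto
  qed
  then have "d = (\<lambda>z. z \<in> witnesses D)" by blast
  ultimately show ?thesis unfolding turing_le_iff by simp
qed

text \<open>If program \<open>e\<close> succeeded on \<open>gapped i\<close>, then
  \<open>Omega\<close> would be in \<open>req_test\<close> of every requirement for \<open>i\<close>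
  and \<open>e\<close>: it guesses its own bits correctly in the limit.\<close>

theorem witnesses_not_turing_le_gapped:
  assumes i: "i \<in> D"
  shows "\<not> turing_le (witnesses D) (gapped i)"
proof
  assume "turing_le (witnesses D) (gapped i)"
  then obtain f where f: "\<And>z. orc_eval (gapped i) f [z] (if z \<in> witnesses D then 1 else 0)"
    unfolding turing_le_def by blast
  define e where "e = recf_code f"
  \<comment> \<open>The component \<open>n\<close> is padding: it yields infinitely many
    requirements for the same \<open>i\<close> and \<open>e\<close>, hence the levels of a
    test.\<close>
  define req where "req n = prod_encode (i, prod_encode (e, n))" for n
  have req: "idx (req n) = i" "prog (req n) = e" for n
    by (simp_all add: req_def idx_def prog_def)
  have refuted: "z \<notin> witnesses D" if "conv (restr (gapped i) r) t e [z] 0" for r t z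
  proof -
    have "conv (restr (gapped i) (max r t)) (max r t) e [z] 0"
      using that by (rule conv_mono) (simp_all add: prefix_restr)
    then have "orc_eval (gapped i) f [z] 0" unfolding e_def orc_eval_iff_conv by blast
    from orc_eval_det[OF this f[of z]] show ?thesis by (auto split: if_splits)
  qed
  have "MLtest (\<lambda>n. req_test (req n))"
    unfolding MLtest_def
  proof (intro conjI allI)
    have "unif_ce (\<lambda>n. {\<sigma>. \<exists>z::nat. \<sigma> \<in> req_test (req n)})"
      unfolding req_test_def req_def mem_Collect_eq by (rule unif_ceI) (rule comp_intros)+
    then show "unif_ce (\<lambda>n. req_test (req n))" by simp
    fix n
    have "n \<le> req n" unfolding req_def using le_prod_encode_2 le_trans by blast
    then have "(1/2::real) ^ req n \<le> (1/2) ^ n" by (rule power_decreasing) auto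
    then show "open_measure (req_test (req n)) \<le> (1/2) ^ n"
      using open_measure_req_test[of "req n"] by linarith
  qed
  moreover have "in_open Omega (req_test (req n))" for n
  proof -
    define q where "q = req n"
    have q: "idx q = i" "prog q = e" using req by (simp_all add: q_def)
    obtain s0 where s0: "\<And>s. s \<ge> s0 \<Longrightarrow> Omega_digits s (hi q) = Omega_digits s0 (hi q)"
      using Omega_digits_stable by blast
    define s where "s = start q s0"
    have start: "start q t = s" if "t \<ge> s0" for t unfolding s_def by (rule start_cong[OF s0[OF that]])
    \<comment> \<open>The last life never ends, so its witness stays out and the program must answer
      0 there.\<close>
    have "prod_encode (q, s) \<notin> witnesses D"
    proof
      assume "prod_encode (q, s) \<in> witnesses D"
      then obtain t where t: "killed q t" "start q t = s" unfolding witnesses_def by auto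
      have digits: "Omega_digits t (hi q) = Omega_digits s0 (hi q)"
        using start_digits[of q t] start_digits[of q s0] t(2) by (simp add: s_def)
      have "Omega_digits (Suc t) (hi q) = Omega_digits s0 (hi q)"
      proof (cases "Suc t \<le> s0")
        case True
        show ?thesis by (rule Omega_digits_eq_between[OF digits]) (use True in simp_all)
      qed (use s0[of "Suc t"] in simp)
      with digits killed_hi[OF t(1)] show False by simp
    qed
    with f[of "prod_encode (q, s)"] have "orc_eval (gapped i) f [prod_encode (q, s)] 0" by simp
    then obtain s1 where s1: "conv (restr (gapped i) s1) s1 e [prod_encode (q, s)] 0"
      unfolding orc_eval_iff_conv e_def by blast
    obtain t1 where t1: "s1 \<le> rank i t1" using rank_unbounded by blast
    obtain t2 where t2: "\<And>s. s \<ge> t2 \<Longrightarrow> restr (Omega_approx s) (hi q) = restr Omega (hi q)" using restr_Omega_limit by blast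
    define t where "t = Max {s0, s1, t1, t2, hi q}"
    have t: "s0 \<le> t" "s1 \<le> t" "t1 \<le> t" "t2 \<le> t" "hi q \<le> t" by (simp_all add: t_def)
    have good_iff: "good q r u (restr Omega u) \<longleftrightarrow> conv (restr (gapped i) (rank i u)) u e [prod_encode (q, r)] 0" for r u
      by (simp add: good_def q nths_restr)
    have "s1 \<le> rank i t" using t1 rank_mono[OF t(3)] by (rule le_trans)
    then have "good q (start q t) t (restr Omega t)"
      unfolding good_iff start[OF t(1)] using s1 t(2) by (auto intro: conv_mono prefix_restr)
    \<comment> \<open>A killed witness is in the set, so the program answers 1 there and the true
      oracle is never refuted.\<close>
    moreover have "\<not> good q (start q u) u (take u (restr Omega t))" if "u < t" "killed q u" for u
    proof
      assume "good q (start q u) u (take u (restr Omega t))"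
      with that(1) have "good q (start q u) u (restr Omega u)" by (simp add: min_absorb1)
      then have "prod_encode (q, start q u) \<notin> witnesses D" unfolding good_iff by (rule refuted)
      moreover have "prod_encode (q, start q u) \<in> witnesses D" unfolding witnesses_def using that(2) i q by auto
      ultimately show False by blast
    qed
    ultimately have "candidate q t (restr Omega t)" unfolding candidate_iff by blast
    moreover have "lnth (restr Omega t) j = (j \<in> Omega_approx t)" if "j < hi q" for j
      using t2[OF t(4)] that t(5) by (simp add: restr_eq_iff)
    ultimately have "restr Omega t \<in> req_test q" unfolding req_test_def using t(5) by simp
    then show ?thesis unfolding in_open_def q_def by force
  qed
  ultimately show False using MLrandom_Omega unfolding MLrandom_def by blast
qed

lemma witnesses_turing_mono:
  assumes "computable A (\<lambda>i. i \<in> D)" "D \<subseteq> D'" "turing_le (witnesses D') A"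
  shows "turing_le (witnesses D) A"
proof -
  have eq: "z \<in> witnesses D \<longleftrightarrow> idx (fst (prod_decode z)) \<in> D \<and> z \<in> witnesses D'" for z
    using assms(2) by (auto simp: witnesses_def)
  show ?thesis
    using assms(3) unfolding turing_le_iff eq
    by (intro computable_conj computable_comp[OF assms(1)] comp_intros) auto
qed

text \<open>For \<open>i\<close> in \<open>D\<close> but not in \<open>D'\<close>, the random set
  \<open>gapped i\<close> computes the second set and not the first.\<close>

theorem MLred_le_witnesses_iff:
  assumes "\<And>A. computable A (\<lambda>i. i \<in> D)" "\<And>A. computable A (\<lambda>i. i \<in> D')"
  shows "MLred_le (witnesses D) (witnesses D') \<longleftrightarrow> D \<subseteq> D'"
proof
  assume le: "MLred_le (witnesses D) (witnesses D')"
  show "D \<subseteq> D'"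
  proof
    fix i assume "i \<in> D"
    then have "\<not> turing_le (witnesses D) (gapped i)" by (rule witnesses_not_turing_le_gapped)
    with le MLrandom_gapped have "\<not> turing_le (witnesses D') (gapped i)" unfolding MLred_le_def by blast
    with witnesses_turing_le_gapped[OF assms(2)] show "i \<in> D'" by blast
  qed
qed (auto simp: MLred_le_def intro: witnesses_turing_mono[OF assms(1)])

section \<open>Representing countable orders by computable sets\<close>

text \<open>The bits of \<open>n\<close> are corrected, one after the other, to the characteristic function of an upward closed
  set; \<open>{n. corrected le n k}\<close> is then a computable set that represents \<open>k\<close>.\<close>

function corrected :: "(nat \<Rightarrow> nat \<Rightarrow> bool) \<Rightarrow> nat \<Rightarrow> nat \<Rightarrow> bool" where
  "corrected le n k \<longleftrightarrow> (\<exists>j\<in>{..<k}. le j k \<and> corrected le n j) \<or>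
     \<not> (\<exists>j\<in>{..<k}. le k j \<and> \<not> corrected le n j) \<and> odd (n div 2 ^ k)"
  by auto
termination by (relation "measure (\<lambda>(le, n, k). k)") auto

declare corrected.simps [simp del]

lemma computable_ex_fixed:
  assumes "\<And>j. j < k \<Longrightarrow> computable A (\<lambda>x. P j x)"
  shows "computable A (\<lambda>x. \<exists>j\<in>{..<k::nat}. P j x)"
  using assms
proof (induction k)
  case (Suc k)
  have "computable A (\<lambda>x. P k x \<or> (\<exists>j\<in>{..<k}. P j x))"
    by (intro computable_disj Suc) auto
  then show ?case by (simp add: lessThan_Suc)
qed (simp add: computable_const)

text \<open>For fixed \<open>k\<close> only the finitely many values of \<open>le\<close> on numbers
  up to \<open>k\<close> enter, and they are built into the program. This nonuniformity admits
  arbitrary countable orders.\<close>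

lemma computable_corrected: "computable A (\<lambda>n. corrected le n k)"
proof (induction k rule: less_induct)
  case (less k)
  show ?case
    unfolding corrected.simps[of le _ k]
    by (intro computable_disj computable_conj computable_not computable_ex_fixed computable_const less
      comp_intros)
qed

text \<open>A bit forced in by some earlier \<open>a\<close> below it passes this on by
  transitivity; an unforced bit is set only if no earlier element above it is missing.\<close>

lemma corrected_mono:
  assumes trans: "\<And>a b c. le a b \<Longrightarrow> le b c \<Longrightarrow> le a c"
    and "corrected le n j" "le j k"
  shows "corrected le n k"
proof -
  have "\<forall>a\<le>m. \<forall>b\<le>m. le a b \<longrightarrow> corrected le n a \<longrightarrow> corrected le n b" for m
  proof (induction m)
    case (Suc m)
    have up: "corrected le n (Suc m)" if "a \<le> m" "le a (Suc m)" "corrected le n a" for a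
      unfolding corrected.simps[of le n "Suc m"] using that by auto
    have down: "corrected le n b" if b: "b \<le> m" "le (Suc m) b" and c: "corrected le n (Suc m)" for b
    proof (rule ccontr)
      assume "\<not> corrected le n b"
      with b have "\<exists>j\<in>{..<Suc m}. le (Suc m) j \<and> \<not> corrected le n j" by auto
      with c obtain a where "a < Suc m" "le a (Suc m)" "corrected le n a"
        unfolding corrected.simps[of le n "Suc m"] by auto
      with trans[of a "Suc m" b] b have "a \<le> m" "le a b" by auto
      with b(1) \<open>corrected le n a\<close> Suc have "corrected le n b" by blast
      with \<open>\<not> corrected le n b\<close> show False by simp
    qed
    show ?case using Suc up down by (metis le_Suc_eq)
  qed simp
  from this[of "max j k"] assms(2,3) show ?thesis by (meson max.cobounded1 max.cobounded2)
qed

lemma exists_bits: "\<exists>n::nat. \<forall>k<m. odd (n div 2 ^ k) \<longleftrightarrow> P k"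
proof (induction m arbitrary: P)
  case (Suc m)
  obtain n :: nat where n: "\<And>k. k < m \<Longrightarrow> odd (n div 2 ^ k) \<longleftrightarrow> P (Suc k)" using Suc[of "\<lambda>k. P (Suc k)"] by blast
  define n' where "n' = 2 * n + (if P 0 then 1 else 0)"
  have "odd (n' div 2 ^ k) \<longleftrightarrow> P k" if "k < Suc m" for k
  proof (cases k)
    case (Suc k')
    have "n' div 2 ^ k = n div 2 ^ k'" by (simp add: n'_def Suc div_mult2_eq)
    then show ?thesis using n[of k'] that Suc by simp
  qed (simp add: n'_def)
  then show ?case by blast
qed simp

lemma corrected_subset_iff:
  assumes refl: "\<And>a. le a a" and trans: "\<And>a b c. le a b \<Longrightarrow> le b c \<Longrightarrow> le a c"
  shows "{n. corrected le n j} \<subseteq> {n. corrected le n k} \<longleftrightarrow> le j k"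
proof
  assume sub: "{n. corrected le n j} \<subseteq> {n. corrected le n k}"
  \<comment> \<open>The bits of \<open>n\<close> form the cone above \<open>j\<close>. It is already
    upward closed, so the correction does not alter it, and \<open>k\<close> gets a bit only if
    \<open>le j k\<close>.\<close>
  obtain n :: nat where n: "\<And>m. m < Suc (max j k) \<Longrightarrow> odd (n div 2 ^ m) \<longleftrightarrow> le j m"
    using exists_bits[of "Suc (max j k)" "le j"] by blast
  have iff: "corrected le n m \<longleftrightarrow> le j m" if "m < Suc (max j k)" for m
    using that
  proof (induction m rule: less_induct)
    case (less m)
    then have IH: "corrected le n a \<longleftrightarrow> le j a" if "a < m" for a using that by auto
    show ?case
      unfolding corrected.simps[of le n m] using IH n[OF less.prems] trans by blast
  qed
  have "corrected le n j" using iff[of j] refl by (simp add: less_Suc_eq_le)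
  with sub have "corrected le n k" by blast
  then show "le j k" using iff[of k] by (simp add: less_Suc_eq_le)
qed (use corrected_mono trans in blast)

section \<open>The embedding\<close>

lemma countable_order_embeds:
  fixes P :: "'a set" and E :: "'a rel"
  assumes "countable P" "partial_order_on P E"
  shows "\<exists>f :: 'a \<Rightarrow> nat set. (\<forall>x\<in>P. K_trivial (f x)) \<and>
    (\<forall>x\<in>P. \<forall>y\<in>P. (x, y) \<in> E \<longleftrightarrow> MLred_le (f x) (f y))"
proof -
  obtain g :: "'a \<Rightarrow> nat" where g: "inj_on g P" using assms(1) by (auto simp: countable_def)
  have order: "refl_on P E" "trans E" using assms(2) by (auto simp: partial_order_on_def preorder_on_def)
  \<comment> \<open>Numbers outside the image of \<open>P\<close> are related to themselves only,
    which makes \<open>le\<close> reflexive on all natural numbers.\<close>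
  define le where "le j k \<longleftrightarrow> j = k \<or> (\<exists>x\<in>P. \<exists>y\<in>P. j = g x \<and> k = g y \<and> (x, y) \<in> E)" for j k
  have le_trans: "le a c" if "le a b" "le b c" for a b c
    using that g order(2) unfolding le_def by (metis inj_onD transD)
  have le_iff: "le (g x) (g y) \<longleftrightarrow> (x, y) \<in> E" if "x \<in> P" "y \<in> P" for x y
    using that g order(1) unfolding le_def by (metis inj_onD refl_onD)
  define f where "f x = witnesses {n. corrected le n (g x)}" for x
  have comp: "computable A (\<lambda>i. i \<in> {n. corrected le n k})" for A k
    by (simp add: computable_corrected)
  have "K_trivial (f x)" for x unfolding f_def by (rule K_trivial_witnesses[OF comp])
  moreover have "(x, y) \<in> E \<longleftrightarrow> MLred_le (f x) (f y)" if "x \<in> P" "y \<in> P" for x y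
  proof -
    have "MLred_le (f x) (f y) \<longleftrightarrow> le (g x) (g y)"
      unfolding f_def MLred_le_witnesses_iff[OF comp comp]
      by (rule corrected_subset_iff) (use le_trans in \<open>auto simp: le_def\<close>)
    then show ?thesis using le_iff[OF that] by simp
  qed
  ultimately show ?thesis by blast
qed

theorem theorem5p14:
  shows "(\<forall>(P :: 'a set) (R :: 'a rel). countable P \<and> partial_order_on P R \<longrightarrow>
            (\<exists>f :: 'a \<Rightarrow> nat set. (\<forall>x\<in>P. K_trivial (f x)) \<and>
               (\<forall>x\<in>P. \<forall>y\<in>P. (x, y) \<in> R \<longleftrightarrow> MLred_le (f x) (f y))))
       \<and> (\<exists>A :: nat \<Rightarrow> nat set. (\<forall>n. K_trivial (A n)) \<and>
            (\<forall>m n. m \<noteq> n \<longrightarrow> \<not> MLred_le (A m) (A n)))"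
proof (intro conjI allI impI; (elim conjE)?)
  show "\<exists>f :: 'a \<Rightarrow> nat set. (\<forall>x\<in>P. K_trivial (f x)) \<and>
      (\<forall>x\<in>P. \<forall>y\<in>P. (x, y) \<in> R \<longleftrightarrow> MLred_le (f x) (f y))"
    if "countable P" "partial_order_on P R" for P :: "'a set" and R :: "'a rel"
    using that by (rule countable_order_embeds)
  \<comment> \<open>The image of the discrete order on the natural numbers is the infinite
    antichain.\<close>
  have "partial_order_on UNIV (Id :: nat rel)"
    by (simp add: partial_order_on_def preorder_on_def refl_Id trans_Id antisym_Id)
  from countable_order_embeds[OF _ this] show "\<exists>A :: nat \<Rightarrow> nat set. (\<forall>n. K_trivial (A n)) \<and>
      (\<forall>m n. m \<noteq> n \<longrightarrow> \<not> MLred_le (A m) (A n))"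
    by auto
qed

end
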